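(* Let $m,n\ge1$ and let $M$ be a connected space-like extremal $m$-dimensional submanifold of the pseudo-Euclidean space $\mathbb{R}^{m+n}_n$ of index $n$. If $M$ is closed with respect to the Euclidean topology (i.e. $M$ is a closed subset of $\mathbb{R}^{m+n}$), then $M$ is an (affine) linear subspace. In particular, let $F:\mathbb{R}^m\to\mathbb{R}$ be a smooth function and let $M=\{(x;\nabla F(x)):x\in\mathbb{R}^m\}$ be the graph of its gradient $\nabla F=\left(\frac{\partial F}{\partial x^1},\dots,\frac{\partial F}{\partial x^m}\right)$ in null coordinates $(x;y)$ of $\mathbb{R}^{2m}_m$. If $M$ is a space-like extremal submanifold of $\mathbb{R}^{2m}_m$, then $F$ is a quadratic polynomial.
   Context: $\mathbb{R}^{m+n}_n$ is $\mathbb{R}^{m+n}$ with coordinates $(x_1,\dots,x_m;y_1,\dots,y_n)$ and the inner product $\langle\cdot,\cdot\rangle$ with quadratic form $\sum_i x_i^2-\sum_s y_s^2$. A smooth $m$-dimensional submanifold $M\subset\mathbb{R}^{m+n}_n$ is space-like if $\langle\cdot,\cdot\rangle$ is positive definite on every tangent space $T_xM$. Let $\nabla$ be the flat connection of $\mathbb{R}^{m+n}$. The second fundamental form is $B(V,W)=(\nabla_V W)^{\perp}$ (component in the normal bundle $NM=(TM)^\perp$) for tangent fields $V,W$, and the mean curvature vector is $H=\frac1m\sum_{i=1}^m B(e_i,e_i)$ for any local orthonormal tangent frame. $M$ is extremal if $H\equiv0$. Null coordinates $(x;y)=(x^1,\dots,x^m;y^1,\dots,y^m)$ on $\mathbb{R}^{2m}_m$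 are global linear coordinates in which the indefinite metric is $ds^2=\frac12\sum_i dx^i\,dy^i$. "Quadratic polynomial" means polynomial of degree at most two. *)

theory Defs
  imports "HOL-Analysis.Analysis"
begin

section \<open>Smooth maps\<close>

text \<open>
  Differentiability of order \<open>n\<close> on an open set, by recursion on directional derivatives. In finite
  dimension this is the class \<open>C\<^sup>n\<close>.
\<close>

primrec higher_differentiable_on ::
  "'a::real_normed_vector set \<Rightarrow> ('a \<Rightarrow> 'b::real_normed_vector) \<Rightarrow> nat \<Rightarrow> bool" where
  "higher_differentiable_on S f 0 \<longleftrightarrow> continuous_on S f"
| "higher_differentiable_on S f (Suc n) \<longleftrightarrow>
     (\<forall>x\<in>S. f differentiable (at x)) \<and>
     (\<forall>v. higher_differentiable_on S (\<lambda>x. frechet_derivative f (at x) v) n)"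

definition smooth_on ::
  "'a::real_normed_vector set \<Rightarrow> ('a \<Rightarrow> 'b::real_normed_vector) \<Rightarrow> bool" where
  "smooth_on S f \<longleftrightarrow> (\<forall>n. higher_differentiable_on S f n)"


section \<open>Pseudo-Euclidean space and its submanifolds\<close>

text \<open>
  The pseudo-Euclidean space of dimension \<open>m + n\<close> and index \<open>n\<close> is \<open>(real^'m) \<times> (real^'n)\<close> with
  \<open>m = CARD('m)\<close>, \<open>n = CARD('n)\<close>: the first component holds the coordinates \<open>x\<close>, the second the
  coordinates \<open>y\<close>. Its library topology is the Euclidean one.
\<close>

definition pseudo_inner ::
  "(real^'m) \<times> (real^'n) \<Rightarrow> (real^'m) \<times> (real^'n) \<Rightarrow> real" where
  "pseudo_inner p q = (\<Sum>i\<in>UNIV. fst p $ i * fst q $ i) - (\<Sum>s\<in>UNIV. snd p $ s * snd q $ s)"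

text \<open>
  Embedded smooth submanifolds of dimension \<open>CARD('m)\<close>, through slice charts: near each of its
  points, \<open>M\<close> is carried by an ambient diffeomorphism onto an open piece of \<open>real^'m \<times> {0}\<close>.
  Here the splitting of the target of the chart is only used to name a linear subspace of
  dimension \<open>CARD('m)\<close>; it has nothing to do with the metric.
\<close>

definition smooth_submanifold :: "((real^'m) \<times> (real^'n)) set \<Rightarrow> bool" where
  "smooth_submanifold M \<longleftrightarrow>
     (\<forall>p\<in>M. \<exists>U V (\<phi> :: (real^'m) \<times> (real^'n) \<Rightarrow> (real^'m) \<times> (real^'n)) \<psi>.
        open U \<and> p \<in> U \<and> open V \<and> homeomorphism U V \<phi> \<psi> \<and>
        smooth_on U \<phi> \<and> smooth_on V \<psi> \<and>
        \<phi> ` (M \<inter> U) = {z \<in> V. snd z = 0})"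

text \<open>Tangent vectors are the velocities of smooth curves in \<open>M\<close>.\<close>

definition tangent_space ::
  "((real^'m) \<times> (real^'n)) set \<Rightarrow> (real^'m) \<times> (real^'n) \<Rightarrow> ((real^'m) \<times> (real^'n)) set" where
  "tangent_space M p =
     {v. \<exists>\<epsilon>>0. \<exists>\<gamma>. smooth_on {-\<epsilon><..<\<epsilon>} \<gamma> \<and> \<gamma> ` {-\<epsilon><..<\<epsilon>} \<subseteq> M \<and> \<gamma> 0 = p \<and>
        (\<gamma> has_vector_derivative v) (at (0::real))}"

definition space_like :: "((real^'m) \<times> (real^'n)) set \<Rightarrow> bool" where
  "space_like M \<longleftrightarrow> (\<forall>p\<in>M. \<forall>v\<in>tangent_space M p. v \<noteq> 0 \<longrightarrow> pseudo_inner v v > 0)"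


section \<open>Second fundamental form and mean curvature\<close>

text \<open>
  The normal component of \<open>v\<close> along the subspace \<open>T\<close>, orthogonality being that of
  \<^const>\<open>pseudo_inner\<close>. It exists and is unique when \<open>T\<close> is space-like (more generally, nondegenerate).
\<close>

definition normal_component ::
  "((real^'m) \<times> (real^'n)) set \<Rightarrow> (real^'m) \<times> (real^'n) \<Rightarrow> (real^'m) \<times> (real^'n)" where
  "normal_component T v = (THE w. v - w \<in> T \<and> (\<forall>u\<in>T. pseudo_inner w u = 0))"

text \<open>
  A local tangent field is given by a smooth vector field on an open subset \<open>U\<close> of the ambient space
  that is tangent to \<open>M\<close> along \<open>M \<inter> U\<close>; every smooth tangent field of \<open>M\<close> has this form locally.
  In \<open>flat_connection V W p\<close>, only the values of \<open>W\<close> on \<open>M\<close> matter, as \<open>V p\<close> is tangent to \<open>M\<close>.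
\<close>

definition tangent_field ::
  "((real^'m) \<times> (real^'n)) set \<Rightarrow> ((real^'m) \<times> (real^'n)) set \<Rightarrow>
   ((real^'m) \<times> (real^'n) \<Rightarrow> (real^'m) \<times> (real^'n)) \<Rightarrow> bool" where
  "tangent_field M U W \<longleftrightarrow> smooth_on U W \<and> (\<forall>q\<in>M \<inter> U. W q \<in> tangent_space M q)"

definition flat_connection ::
  "('a::real_normed_vector \<Rightarrow> 'a) \<Rightarrow> ('a \<Rightarrow> 'a) \<Rightarrow> 'a \<Rightarrow> 'a" where
  "flat_connection V W p = frechet_derivative W (at p) (V p)"

definition second_fundamental_form ::
  "((real^'m) \<times> (real^'n)) set \<Rightarrow>
   ((real^'m) \<times> (real^'n) \<Rightarrow> (real^'m) \<times> (real^'n)) \<Rightarrow>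
   ((real^'m) \<times> (real^'n) \<Rightarrow> (real^'m) \<times> (real^'n)) \<Rightarrow>
   (real^'m) \<times> (real^'n) \<Rightarrow> (real^'m) \<times> (real^'n)" where
  "second_fundamental_form M V W p =
     normal_component (tangent_space M p) (flat_connection V W p)"

definition orthonormal_tangent_frame ::
  "((real^'m) \<times> (real^'n)) set \<Rightarrow> ((real^'m) \<times> (real^'n)) set \<Rightarrow>
   ('m \<Rightarrow> (real^'m) \<times> (real^'n) \<Rightarrow> (real^'m) \<times> (real^'n)) \<Rightarrow> bool" where
  "orthonormal_tangent_frame M U e \<longleftrightarrow>
     open U \<and> (\<forall>i. tangent_field M U (e i)) \<and>
     (\<forall>q\<in>M \<inter> U. \<forall>i j. pseudo_inner (e i q) (e j q) = (if i = j then 1 else 0))"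

text \<open>
  \<open>H\<close> is the mean curvature vector of \<open>M\<close> at \<open>p\<close>, computed in a local orthonormal tangent frame. On
  a space-like submanifold such frames exist near every point and the value does not depend on the
  choice.
\<close>

definition has_mean_curvature_vector ::
  "((real^'m) \<times> (real^'n)) set \<Rightarrow> (real^'m) \<times> (real^'n) \<Rightarrow> (real^'m) \<times> (real^'n) \<Rightarrow> bool" where
  "has_mean_curvature_vector M p H \<longleftrightarrow>
     (\<exists>U e. orthonormal_tangent_frame M U e \<and> p \<in> U \<and>
        H = (1 / real CARD('m)) *\<^sub>R (\<Sum>i\<in>UNIV. second_fundamental_form M (e i) (e i) p))"

definition extremal :: "((real^'m) \<times> (real^'n)) set \<Rightarrow> bool" where
  "extremal M \<longleftrightarrow> (\<forall>p\<in>M. has_mean_curvature_vector M p 0)"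


section \<open>Null coordinates and gradient graphs\<close>

text \<open>
  \<open>N (x, y)\<close> is the point whose null coordinates are \<open>(x; y)\<close>. The metric is prescribed through its
  quadratic form, which determines it by polarization.
\<close>

definition null_coordinates ::
  "((real^'m) \<times> (real^'m) \<Rightarrow> (real^'m) \<times> (real^'m)) \<Rightarrow> bool" where
  "null_coordinates N \<longleftrightarrow>
     linear N \<and> bij N \<and>
     (\<forall>x y. pseudo_inner (N (x, y)) (N (x, y)) = (1/2) * (\<Sum>i\<in>UNIV. x $ i * y $ i))"

lemma null_coordinates_exist:
  "null_coordinates (\<lambda>(x :: real^'m, y).
     ((1/2) *\<^sub>R x + (1/4) *\<^sub>R y, (1/2) *\<^sub>R x - (1/4) *\<^sub>R y))"
  (is "null_coordinates ?N")
proof -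
  have "linear ?N"
    by (rule linearI) (auto simp: algebra_simps)
  moreover have "bij ?N"
    by (rule o_bij[where g = "\<lambda>(a, b). (a + b, 2 *\<^sub>R (a - b))"])
       (auto simp: fun_eq_iff vec_eq_iff field_simps)
  moreover have "pseudo_inner (?N (x, y)) (?N (x, y)) = (1/2) * (\<Sum>i\<in>UNIV. x $ i * y $ i)" for x y
    by (simp add: pseudo_inner_def sum_subtractf[symmetric] sum_distrib_left algebra_simps)
  ultimately show ?thesis
    by (simp add: null_coordinates_def)
qed

definition gradient :: "(real^'m \<Rightarrow> real) \<Rightarrow> real^'m \<Rightarrow> real^'m" where
  "gradient F x = (\<chi> i. frechet_derivative F (at x) (axis i 1))"

definition gradient_graph ::
  "((real^'m) \<times> (real^'m) \<Rightarrow> (real^'m) \<times> (real^'m)) \<Rightarrow> (real^'m \<Rightarrow> real) \<Rightarrow>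
   ((real^'m) \<times> (real^'m)) set" where
  "gradient_graph N F = {N (x, gradient F x) | x. x \<in> UNIV}"

definition quadratic_polynomial :: "(real^'m \<Rightarrow> real) \<Rightarrow> bool" where
  "quadratic_polynomial F \<longleftrightarrow>
     (\<exists>(a :: 'm \<Rightarrow> 'm \<Rightarrow> real) (b :: 'm \<Rightarrow> real) (c :: real). \<forall>x.
        F x = (\<Sum>i\<in>UNIV. \<Sum>j\<in>UNIV. a i j * x $ i * x $ j) + (\<Sum>i\<in>UNIV. b i * x $ i) + c)"

end

theory Submission
  imports Defs
begin

text \<open>
  Let \<open>M\<close> be closed, connected, space-like and extremal. Along \<open>M\<close> one has \<open>|dy| < |dx|\<close>, so the projection of \<open>M\<close> to the space of the
  \<open>x\<close> is a local diffeomorphism along which paths can be lifted: their lifts are no longer than twice the paths, and do not leave the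
  closed set \<open>M\<close>. Therefore \<open>M\<close> is the graph of a function \<open>u\<close> defined on all of the space, with \<open>|Du v| < |v|\<close> (\<open>entire_graph\<close>). It
  remains to show that the second fundamental form \<open>B\<close> vanishes at an arbitrary point \<open>q\<close> of \<open>M\<close>.

  Let \<open>z p\<close> be the square of \<open>p - q\<close>. This function is proper on \<open>M\<close>, because \<open>|x| - |u|\<close>, measured from \<open>q\<close>, does not
  decrease along rays (\<open>escape\<close>), and its Laplacian is \<open>2 m\<close>, because \<open>M\<close> is extremal. The maximum principle on the compact
  sets \<open>{z \<le> k}\<close> is used twice. Applied to the squared length \<open>P\<close> of the normal part of \<open>p - q\<close>, with the weight
  \<open>(k - z)\<^sup>4\<^sup>m\<close>, it gives \<open>P \<le> C z\<close> (\<open>normal_part_bound\<close>, \<open>normal_part_estimate\<close>); the reason is Bochner's formula, with Ricci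
  curvature that is nonnegative on extremal space-like submanifolds. This bounds the gradient of \<open>z\<close>, as \<open>|grad z|\<^sup>2 = 4 (z + P)\<close>. Applied
  to \<open>|B(v,v)|\<^sup>2\<close> for unit vectors \<open>v\<close>, with the weight \<open>(k - z)\<^sup>2\<close>, it gives \<open>k\<^sup>2 |B(v,v)|\<^sup>2 \<le> C k\<close> at \<open>q\<close>
  (\<open>second_derivative_bound\<close>, \<open>second_derivative_estimate_sublevel\<close>); the reason is Simons' inequality, in which the
  quartic terms have a favourable sign since the normal bundle is negative definite. For \<open>k \<rightarrow> \<infinity>\<close> it follows that \<open>B = 0\<close> at \<open>q\<close>.

  Both maxima are evaluated after an isometry that moves the maximum point to the origin and its tangent space to the horizontal one
  (\<open>tangential_normal_form\<close>). There the induced metric is Euclidean up to second order, and \<open>B\<close> is \<open>D\<^sup>2u\<close>. To change coordinates in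
  this way one needs quantities that do not depend on them. The normal part of a vector \<open>X\<close> has squared length \<open>P\<close> equal to
  the maximum of \<open>- \<langle>X - t, X - t\<rangle>\<close> over tangent vectors \<open>t\<close>, and \<open>|B(v,v)|\<^sup>2\<close> is the maximum of
  \<open>- \<langle>\<gamma>'', \<gamma>''\<rangle>\<close> over curves \<open>\<gamma>\<close> in \<open>M\<close> with velocity \<open>v\<close>. So one may work with tangent vectors and accelerations of curves, which
  an isometry simply carries along. Letting \<open>t\<close> and \<open>\<gamma>''\<close> vary linearly near the maximum point, in a suitable way, recovers the terms
  of the formulas of Bochner and Simons.

  The graph of a gradient in null coordinates is closed and connected. If it is affine, then so is the gradient, and integration along rays
  shows that the function is a quadratic polynomial.
\<close>

section \<open>Iterated directional derivatives\<close>

text \<open>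
  The direction is the first argument, so that iterated derivatives are compositions of the operators \<open>pd v\<close>.
\<close>

definition pd :: "'a::real_normed_vector \<Rightarrow> ('a \<Rightarrow> 'b::real_normed_vector) \<Rightarrow> 'a \<Rightarrow> 'b" where
  "pd v f x = frechet_derivative f (at x) v"

lemma pd_eq: "(f has_derivative f') (at x) \<Longrightarrow> pd v f x = f' v"
  by (metis frechet_derivative_at pd_def)

lemma has_derivative_pd:
  "f differentiable (at x) \<Longrightarrow> (f has_derivative (\<lambda>v. pd v f x)) (at x)"
  by (simp add: pd_def frechet_derivative_works[symmetric])

lemma hdiff_Suc:
  "higher_differentiable_on S f (Suc n) \<longleftrightarrow>
     (\<forall>x\<in>S. f differentiable (at x)) \<and> (\<forall>v. higher_differentiable_on S (pd v f) n)"
  by (simp add: pd_def[abs_def])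

declare higher_differentiable_on.simps(2) [simp del]

lemma hdiff_lower: "higher_differentiable_on S f (Suc n) \<Longrightarrow> higher_differentiable_on S f n"
proof (induction n arbitrary: f)
  case 0
  then show ?case
    by (auto simp: hdiff_Suc intro!: continuous_at_imp_continuous_on differentiable_imp_continuous_within)
next
  case (Suc n)
  then show ?case by (auto simp: hdiff_Suc)
qed

lemma hdiff_subset: "higher_differentiable_on S f n \<Longrightarrow> T \<subseteq> S \<Longrightarrow> higher_differentiable_on T f n"
  by (induction n arbitrary: f) (auto simp: hdiff_Suc intro: continuous_on_subset)

lemma pd_cong_open:
  assumes "open S" "x \<in> S" "\<And>y. y \<in> S \<Longrightarrow> f y = g y"
  shows "pd v f x = pd v g x" "f differentiable (at x) \<longleftrightarrow> g differentiable (at x)"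
proof -
  have *: "(f has_derivative D) (at x) \<longleftrightarrow> (g has_derivative D) (at x)" for D
    using assms by (metis has_derivative_transform_within_open)
  show "pd v f x = pd v g x" unfolding pd_def frechet_derivative_def using * by simp
  show "f differentiable (at x) \<longleftrightarrow> g differentiable (at x)"
    unfolding differentiable_def using * by simp
qed

lemma hdiff_cong:
  assumes "open S" "\<And>x. x \<in> S \<Longrightarrow> f x = g x"
  shows "higher_differentiable_on S f n \<longleftrightarrow> higher_differentiable_on S g n"
  using assms(2)
proof (induction n arbitrary: f g)
  case 0
  then show ?case by (simp cong: continuous_on_cong)
next
  case (Suc n)
  have "\<And>v x. x \<in> S \<Longrightarrow> pd v f x = pd v g x"
    using pd_cong_open(1)[OF assms(1)] Suc.prems by blast
  then have "\<And>v. higher_differentiable_on S (pd v f) n \<longleftrightarrow> higher_differentiable_on S (pd v g) n"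
    using Suc.IH by blast
  then show ?case
    using pd_cong_open(2)[OF assms(1)] Suc.prems unfolding hdiff_Suc by blast
qed

lemma hdiff_SucI:
  assumes S: "open S"
    and D: "\<And>x. x \<in> S \<Longrightarrow> (f has_derivative (\<lambda>v. D v x)) (at x)"
    and "\<And>v. higher_differentiable_on S (D v) n"
  shows "higher_differentiable_on S f (Suc n)"
proof -
  have "pd v f x = D v x" if "x \<in> S" for v x by (rule pd_eq[OF D[OF that]])
  then have "higher_differentiable_on S (pd v f) n" for v
    using hdiff_cong[OF S, of "pd v f" "D v" n] assms(3) by simp
  moreover have "f differentiable (at x)" if "x \<in> S" for x
    by (rule Derivative.differentiableI[OF D[OF that]])
  ultimately show ?thesis by (simp add: hdiff_Suc)
qed

lemma hdiff_SucD:
  assumes "higher_differentiable_on S f (Suc n)"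
  shows "higher_differentiable_on S f n" "\<And>v. higher_differentiable_on S (pd v f) n"
    "\<And>x. x \<in> S \<Longrightarrow> (f has_derivative (\<lambda>v. pd v f x)) (at x)"
  using hdiff_lower[OF assms] assms by (simp_all add: hdiff_Suc has_derivative_pd)

lemma hdiff_local:
  assumes "\<And>x. x \<in> S \<Longrightarrow> \<exists>T. open T \<and> x \<in> T \<and> higher_differentiable_on T f n"
  shows "higher_differentiable_on S f n"
  using assms
proof (induction n arbitrary: f)
  case 0
  then show ?case
    by (auto intro!: continuous_at_imp_continuous_on dest!: continuous_on_interior simp: interior_open)
       (metis "0" continuous_on_eq_continuous_at higher_differentiable_on.simps(1))
next
  case (Suc n)
  then show ?case unfolding hdiff_Suc by meson
qed

lemma hdiff_const: "higher_differentiable_on S (\<lambda>x. c) n"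
proof (induction n arbitrary: c)
  case (Suc n)
  have "pd v (\<lambda>x. c) = (\<lambda>x. 0)" for v :: 'a and c :: 'b
    by (rule ext) (simp add: pd_def)
  then show ?case using Suc by (simp add: hdiff_Suc)
qed simp

lemma hdiff_bounded_linear:
  assumes "bounded_linear A" shows "higher_differentiable_on S A n"
proof (cases n)
  case 0
  then show ?thesis by (simp add: assms linear_continuous_on)
next
  case (Suc k)
  have "pd v A = (\<lambda>x. A v)" for v
    by (rule ext) (rule pd_eq[OF bounded_linear_imp_has_derivative[OF assms]])
  then show ?thesis
    by (auto simp: Suc hdiff_Suc hdiff_const intro!: bounded_linear_imp_differentiable assms)
qed

lemma hdiff_add:
  assumes S: "open S" and "higher_differentiable_on S f n" "higher_differentiable_on S g n"
  shows "higher_differentiable_on S (\<lambda>x. f x + g x) n"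
  using assms(2,3)
proof (induction n arbitrary: f g)
  case 0
  then show ?case by (simp add: continuous_on_add)
next
  case (Suc n)
  note f = hdiff_SucD[OF Suc.prems(1)] and g = hdiff_SucD[OF Suc.prems(2)]
  show ?case
    by (rule hdiff_SucI[OF S has_derivative_add[OF f(3) g(3)]], assumption+) (intro Suc.IH f g)
qed

lemma hdiff_bilinear:
  assumes p: "bounded_bilinear p" and S: "open S"
    and "higher_differentiable_on S f n" "higher_differentiable_on S g n"
  shows "higher_differentiable_on S (\<lambda>x. p (f x) (g x)) n"
  using assms(3,4)
proof (induction n arbitrary: f g)
  case 0
  then show ?case by (simp add: bounded_bilinear.continuous_on[OF p])
next
  case (Suc n)
  note f = hdiff_SucD[OF Suc.prems(1)] and g = hdiff_SucD[OF Suc.prems(2)]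
  show ?case
    by (rule hdiff_SucI[OF S bounded_bilinear.FDERIV[OF p f(3) g(3)]], assumption+) (intro hdiff_add S Suc.IH f g)
qed

lemma hdiff_linear_comp:
  assumes A: "bounded_linear A" and S: "open S" and "higher_differentiable_on S f n"
  shows "higher_differentiable_on S (\<lambda>x. A (f x)) n"
  using assms(3)
proof (induction n arbitrary: f)
  case 0
  then show ?case by (simp add: bounded_linear.continuous_on[OF A])
next
  case (Suc n)
  note f = hdiff_SucD[OF Suc.prems(1)]
  show ?case
    by (rule hdiff_SucI[OF S bounded_linear.has_derivative[OF A f(3)]], assumption+) (intro Suc.IH f)
qed

lemma hdiff_sum:
  assumes "open S" "finite I" "\<And>i. i \<in> I \<Longrightarrow> higher_differentiable_on S (f i) n"
  shows "higher_differentiable_on S (\<lambda>x. \<Sum>i\<in>I. f i x) n"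
  using assms(2,3) by (induction I rule: finite_induct) (auto simp: hdiff_const intro: hdiff_add[OF assms(1)])

lemma hdiff_prod:
  fixes f :: "'i \<Rightarrow> 'a::real_normed_vector \<Rightarrow> real"
  assumes "open S" "finite I" "\<And>i. i \<in> I \<Longrightarrow> higher_differentiable_on S (f i) n"
  shows "higher_differentiable_on S (\<lambda>x. \<Prod>i\<in>I. f i x) n"
  using assms(2,3)
  by (induction I rule: finite_induct)
     (auto simp: hdiff_const intro: hdiff_bilinear[OF bounded_bilinear_mult assms(1)])

lemma pd_comp:
  fixes g :: "'a::real_normed_vector \<Rightarrow> 'b::euclidean_space"
  assumes "g differentiable (at x)" "f differentiable (at (g x))"
  shows "((\<lambda>x. f (g x)) has_derivative (\<lambda>v. pd (pd v g x) f (g x))) (at x)"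
  using diff_chain_at[OF has_derivative_pd[OF assms(1)] has_derivative_pd[OF assms(2)]]
  by (simp add: o_def)

lemma pd_linear: "f differentiable (at x) \<Longrightarrow> linear (\<lambda>v. pd v f x)"
  by (simp add: pd_def linear_frechet_derivative)

lemma pd_expand:
  fixes f :: "'a::euclidean_space \<Rightarrow> 'b::real_normed_vector"
  assumes "f differentiable (at x)"
  shows "pd v f x = (\<Sum>b\<in>Basis. (v \<bullet> b) *\<^sub>R pd b f x)"
proof -
  interpret linear "\<lambda>v. pd v f x" by (rule pd_linear[OF assms])
  have "pd v f x = pd (\<Sum>b\<in>Basis. (v \<bullet> b) *\<^sub>R b) f x" by (simp add: euclidean_representation)
  also have "\<dots> = (\<Sum>b\<in>Basis. (v \<bullet> b) *\<^sub>R pd b f x)" by (simp add: sum scale)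
  finally show ?thesis .
qed

text \<open>
  Expanded in a basis, the derivative of \<open>f \<circ> g\<close> is a sum of products of derivatives of \<open>g\<close> and of compositions of lower order with \<open>g\<close>, to which the induction hypothesis applies.
\<close>

lemma hdiff_compose:
  fixes g :: "'a::real_normed_vector \<Rightarrow> 'b::euclidean_space"
  assumes S: "open S" and T: "open T" and sub: "g ` S \<subseteq> T"
    and "higher_differentiable_on T f n" "higher_differentiable_on S g n"
  shows "higher_differentiable_on S (\<lambda>x. f (g x)) n"
  using assms(4,5)
proof (induction n arbitrary: f)
  case 0
  then show ?case using sub by (metis continuous_on_compose2 higher_differentiable_on.simps(1))
next
  case (Suc n)
  note f = hdiff_SucD[OF Suc.prems(1)] and g = hdiff_SucD[OF Suc.prems(2)]
  have D: "((\<lambda>x. f (g x)) has_derivative (\<lambda>v. \<Sum>b\<in>Basis. (pd v g x \<bullet> b) *\<^sub>R pd b f (g x))) (at x)"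
    if "x \<in> S" for x
  proof -
    have fg: "f differentiable (at (g x))" "g differentiable (at x)"
      by (rule Derivative.differentiableI[OF f(3)], use sub that in blast, rule Derivative.differentiableI[OF g(3)[OF that]])
    have "(\<lambda>v. \<Sum>b\<in>Basis. (pd v g x \<bullet> b) *\<^sub>R pd b f (g x)) = (\<lambda>v. pd (pd v g x) f (g x))"
      by (rule ext) (rule pd_expand[OF fg(1), symmetric])
    with pd_comp[OF fg(2,1)] show ?thesis by simp
  qed
  have inner: "higher_differentiable_on S (\<lambda>x. pd v g x \<bullet> b) n" for v b
    by (rule hdiff_linear_comp[OF bounded_linear_inner_left S g(2)])
  have "higher_differentiable_on S (\<lambda>x. pd b f (g x)) n" for b
    by (rule Suc.IH[OF f(2) g(1)])
  with inner have "higher_differentiable_on S (\<lambda>x. \<Sum>b\<in>Basis. (pd v g x \<bullet> b) *\<^sub>R pd b f (g x)) n" for v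
    by (intro hdiff_sum S hdiff_bilinear[OF bounded_bilinear_scaleR] finite_Basis)
  with D show ?case by (rule hdiff_SucI[OF S])
qed

lemma hdiff_inverse:
  fixes f :: "'a::real_normed_vector \<Rightarrow> real"
  assumes S: "open S" and nz: "\<And>x. x \<in> S \<Longrightarrow> f x \<noteq> 0" and "higher_differentiable_on S f n"
  shows "higher_differentiable_on S (\<lambda>x. inverse (f x)) n"
  using assms(3)
proof (induction n)
  case 0
  then show ?case using nz by (simp add: continuous_on_inverse)
next
  case (Suc n)
  note f = hdiff_SucD[OF Suc.prems]
  have D: "((\<lambda>x. inverse (f x)) has_derivative (\<lambda>v. (- 1) * (inverse (f x) * pd v f x * inverse (f x)))) (at x)"
    if "x \<in> S" for x
    using Deriv.has_derivative_inverse[of f x "\<lambda>v. pd v f x" UNIV] nz[OF that] f(3)[OF that] by simp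
  have "higher_differentiable_on S (\<lambda>x. (- 1) * (inverse (f x) * pd v f x * inverse (f x))) n" for v
    by (rule hdiff_bilinear[OF bounded_bilinear_mult S hdiff_const
          hdiff_bilinear[OF bounded_bilinear_mult S hdiff_bilinear[OF bounded_bilinear_mult S]]])
       (rule Suc.IH[OF f(1)] f(2))+
  with D show ?case by (rule hdiff_SucI[OF S])
qed

lemma hdiff_vec:
  fixes f :: "'a::real_normed_vector \<Rightarrow> real^'n"
  assumes S: "open S" and "\<And>i. higher_differentiable_on S (\<lambda>x. f x $ i) n"
  shows "higher_differentiable_on S f n"
proof -
  have "f = (\<lambda>x. \<Sum>i\<in>UNIV. f x $ i *\<^sub>R axis i 1)"
    by (rule ext) (metis (no_types, lifting) basis_expansion scalar_mult_eq_scaleR sum.cong)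
  moreover have "higher_differentiable_on S (\<lambda>x. \<Sum>i\<in>UNIV. f x $ i *\<^sub>R (axis i 1 :: real^'n)) n"
    by (intro hdiff_sum S hdiff_bilinear[OF bounded_bilinear_scaleR] assms hdiff_const) auto
  ultimately show ?thesis by metis
qed

lemma hdiff_det:
  fixes A :: "'a::real_normed_vector \<Rightarrow> real^'n^'n"
  assumes S: "open S" and "\<And>i j. higher_differentiable_on S (\<lambda>x. A x $ i $ j) n"
  shows "higher_differentiable_on S (\<lambda>x. det (A x)) n"
  unfolding det_def
  by (intro hdiff_sum S hdiff_bilinear[OF bounded_bilinear_mult] hdiff_const hdiff_prod assms finite_permutations finite)

lemma hdiff_Pair:
  assumes S: "open S" and "higher_differentiable_on S f n" "higher_differentiable_on S g n"
  shows "higher_differentiable_on S (\<lambda>x. (f x, g x)) n"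
proof -
  have 1: "bounded_linear (\<lambda>x. (x, 0))" "bounded_linear (\<lambda>y. (0, y))"
    by (auto intro!: bounded_linear_Pair bounded_linear_ident bounded_linear_zero)
  have "higher_differentiable_on S (\<lambda>x. (f x, 0) + (0, g x)) n"
    using hdiff_linear_comp[OF 1(1) S assms(2)] hdiff_linear_comp[OF 1(2) S assms(3)] by (intro hdiff_add S)
  then show ?thesis by simp
qed

lemma smooth_differentiable: "smooth_on S f \<Longrightarrow> x \<in> S \<Longrightarrow> f differentiable (at x)"
  by (metis hdiff_Suc smooth_on_def)

lemma smooth_pd: "smooth_on S f \<Longrightarrow> smooth_on S (pd v f)"
  by (metis hdiff_Suc smooth_on_def)

lemma smooth_continuous: "smooth_on S f \<Longrightarrow> continuous_on S f"
  using higher_differentiable_on.simps(1) smooth_on_def by blast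

lemma smooth_has_derivative:
  "smooth_on S f \<Longrightarrow> x \<in> S \<Longrightarrow> (f has_derivative (\<lambda>v. pd v f x)) (at x)"
  by (simp add: has_derivative_pd smooth_differentiable)

lemma smooth_subset: "smooth_on S f \<Longrightarrow> T \<subseteq> S \<Longrightarrow> smooth_on T f"
  by (metis hdiff_subset smooth_on_def)

lemma smooth_cong: "open S \<Longrightarrow> (\<And>x. x \<in> S \<Longrightarrow> f x = g x) \<Longrightarrow> smooth_on S f \<longleftrightarrow> smooth_on S g"
  by (metis hdiff_cong smooth_on_def)

lemma smooth_local:
  "(\<And>x. x \<in> S \<Longrightarrow> \<exists>T. open T \<and> x \<in> T \<and> smooth_on T f) \<Longrightarrow> smooth_on S f"
  unfolding smooth_on_def using hdiff_local by metis

lemma smooth_const: "smooth_on S (\<lambda>x. c)"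
  by (simp add: hdiff_const smooth_on_def)

lemma smooth_linear: "bounded_linear A \<Longrightarrow> smooth_on S A"
  by (simp add: hdiff_bounded_linear smooth_on_def)

lemma smooth_linear_comp: "bounded_linear A \<Longrightarrow> open S \<Longrightarrow> smooth_on S f \<Longrightarrow> smooth_on S (\<lambda>x. A (f x))"
  by (simp add: hdiff_linear_comp smooth_on_def)

lemma smooth_bilinear:
  "bounded_bilinear p \<Longrightarrow> open S \<Longrightarrow> smooth_on S f \<Longrightarrow> smooth_on S g \<Longrightarrow> smooth_on S (\<lambda>x. p (f x) (g x))"
  by (simp add: hdiff_bilinear smooth_on_def)

lemma smooth_add: "open S \<Longrightarrow> smooth_on S f \<Longrightarrow> smooth_on S g \<Longrightarrow> smooth_on S (\<lambda>x. f x + g x)"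
  by (simp add: hdiff_add smooth_on_def)

lemma smooth_compose:
  fixes g :: "'a::real_normed_vector \<Rightarrow> 'b::euclidean_space"
  shows "open S \<Longrightarrow> open T \<Longrightarrow> g ` S \<subseteq> T \<Longrightarrow> smooth_on T f \<Longrightarrow> smooth_on S g \<Longrightarrow> smooth_on S (\<lambda>x. f (g x))"
  unfolding smooth_on_def using hdiff_compose by blast

lemma smooth_Pair: "open S \<Longrightarrow> smooth_on S f \<Longrightarrow> smooth_on S g \<Longrightarrow> smooth_on S (\<lambda>x. (f x, g x))"
  by (simp add: hdiff_Pair smooth_on_def)

lemma pd_scale: "f differentiable (at x) \<Longrightarrow> pd (c *\<^sub>R v) f x = c *\<^sub>R pd v f x"
  using linear_scale[OF pd_linear] by blast

lemma pd_plus: "f differentiable (at x) \<Longrightarrow> pd (v + w) f x = pd v f x + pd w f x"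
  using linear_add[OF pd_linear] by blast

lemma pd_zero: "f differentiable (at x) \<Longrightarrow> pd 0 f x = 0"
  using linear_0[OF pd_linear] by blast

lemma pd_sum: "f differentiable (at x) \<Longrightarrow> pd (\<Sum>i\<in>I. v i) f x = (\<Sum>i\<in>I. pd (v i) f x)"
  using linear_sum[OF pd_linear] by blast

lemma line_derivative:
  assumes "f differentiable (at (x + t *\<^sub>R v))"
  shows "((\<lambda>t. f (x + t *\<^sub>R v)) has_vector_derivative pd v f (x + t *\<^sub>R v)) (at t)"
proof -
  have "((\<lambda>t. x + t *\<^sub>R v) has_derivative (\<lambda>h. h *\<^sub>R v)) (at t)"
    by (auto intro!: derivative_eq_intros)
  from diff_chain_at[OF this has_derivative_pd[OF assms]]
  have "((\<lambda>t. f (x + t *\<^sub>R v)) has_derivative (\<lambda>h. pd (h *\<^sub>R v) f (x + t *\<^sub>R v))) (at t)"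
    by (simp add: o_def)
  then show ?thesis
    by (simp add: has_vector_derivative_def pd_scale[OF assms])
qed

text \<open>
  The mean value theorem, once in each direction.
\<close>

lemma second_difference:
  fixes f :: "'a::real_normed_vector \<Rightarrow> real"
  assumes h: "h > 0"
    and d: "\<And>s t. 0 \<le> s \<Longrightarrow> s \<le> h \<Longrightarrow> 0 \<le> t \<Longrightarrow> t \<le> h \<Longrightarrow>
       f differentiable (at (x + s *\<^sub>R v + t *\<^sub>R w)) \<and> pd v f differentiable (at (x + s *\<^sub>R v + t *\<^sub>R w))"
  obtains s t where "0 \<le> s" "s \<le> h" "0 \<le> t" "t \<le> h"
    "f (x + h *\<^sub>R v + h *\<^sub>R w) - f (x + h *\<^sub>R v) - f (x + h *\<^sub>R w) + f x
       = h\<^sup>2 * pd w (pd v f) (x + s *\<^sub>R v + t *\<^sub>R w)"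
proof -
  have D: "((\<lambda>s. f (x + s *\<^sub>R v + t *\<^sub>R w)) has_real_derivative pd v f (x + s *\<^sub>R v + t *\<^sub>R w)) (at s)"
    if "0 \<le> s" "s \<le> h" "0 \<le> t" "t \<le> h" for s t
    using line_derivative[of f "x + t *\<^sub>R w" s v] d[OF that]
    by (simp add: has_real_derivative_iff_has_vector_derivative add.assoc add.commute[of "t *\<^sub>R w"])
  have D2: "((\<lambda>t. pd v f (x + s *\<^sub>R v + t *\<^sub>R w)) has_real_derivative pd w (pd v f) (x + s *\<^sub>R v + t *\<^sub>R w)) (at t)"
    if "0 \<le> s" "s \<le> h" "0 \<le> t" "t \<le> h" for s t
    using line_derivative[of "pd v f" "x + s *\<^sub>R v" t w] d[OF that]
    by (simp add: has_real_derivative_iff_has_vector_derivative)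
  have "\<exists>s>0. s < h \<and> (f (x + h *\<^sub>R v + h *\<^sub>R w) - f (x + h *\<^sub>R v + 0 *\<^sub>R w)) - (f (x + 0 *\<^sub>R v + h *\<^sub>R w) - f (x + 0 *\<^sub>R v + 0 *\<^sub>R w))
     = (h - 0) * (pd v f (x + s *\<^sub>R v + h *\<^sub>R w) - pd v f (x + s *\<^sub>R v + 0 *\<^sub>R w))"
    by (rule MVT2[OF h, of "\<lambda>s. f (x + s *\<^sub>R v + h *\<^sub>R w) - f (x + s *\<^sub>R v + 0 *\<^sub>R w)"])
       (intro DERIV_diff D; use h in simp)
  then obtain s where s: "0 < s" "s < h" and e1: "(f (x + h *\<^sub>R v + h *\<^sub>R w) - f (x + h *\<^sub>R v)) - (f (x + h *\<^sub>R w) - f x)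
     = h * (pd v f (x + s *\<^sub>R v + h *\<^sub>R w) - pd v f (x + s *\<^sub>R v))" by auto
  have "\<exists>t>0. t < h \<and> pd v f (x + s *\<^sub>R v + h *\<^sub>R w) - pd v f (x + s *\<^sub>R v + 0 *\<^sub>R w)
     = (h - 0) * pd w (pd v f) (x + s *\<^sub>R v + t *\<^sub>R w)"
    by (rule MVT2[OF h, of "\<lambda>t. pd v f (x + s *\<^sub>R v + t *\<^sub>R w)"]) (intro D2; use s in simp)
  then obtain t where "0 < t" "t < h" "pd v f (x + s *\<^sub>R v + h *\<^sub>R w) - pd v f (x + s *\<^sub>R v)
     = h * pd w (pd v f) (x + s *\<^sub>R v + t *\<^sub>R w)" by auto
  with s e1 show ?thesis by (intro that[of s t]) (auto simp: power2_eq_square)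
qed

text \<open>
  The second difference over a parallelogram is symmetric in its two sides. It is \<open>h\<^sup>2\<close> times either mixed derivative, taken at points that tend to \<open>x\<close> with \<open>h\<close>.
\<close>

lemma pd_commute_real:
  fixes f :: "'a::real_normed_vector \<Rightarrow> real"
  assumes S: "open S" and f: "smooth_on S f" and x: "x \<in> S"
  shows "pd w (pd v f) x = pd v (pd w f) x"
proof -
  define A where "A = pd w (pd v f)"
  define B where "B = pd v (pd w f)"
  have "continuous_on S A" "continuous_on S B"
    unfolding A_def B_def by (rule smooth_continuous[OF smooth_pd[OF smooth_pd[OF f]]])+
  then have c: "(A \<longlongrightarrow> A x) (nhds x)" "(B \<longlongrightarrow> B x) (nhds x)"
    using S x by (simp_all add: continuous_on_eq_continuous_at continuous_at tendsto_at_iff_tendsto_nhds)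
  have "\<bar>A x - B x\<bar> < e" if e: "e > 0" for e
  proof -
    have e2: "e/2 > 0" using e by simp
    have "eventually (\<lambda>y. \<bar>A y - A x\<bar> < e/2) (nhds x)" "eventually (\<lambda>y. \<bar>B y - B x\<bar> < e/2) (nhds x)"
      using tendstoD[OF c(1) e2] tendstoD[OF c(2) e2] by (simp_all add: dist_real_def)
    moreover have "eventually (\<lambda>y. y \<in> S) (nhds x)"
      using S x eventually_nhds by blast
    ultimately have "eventually (\<lambda>y. \<bar>A y - A x\<bar> < e/2 \<and> \<bar>B y - B x\<bar> < e/2 \<and> y \<in> S) (nhds x)"
      by eventually_elim auto
    then obtain r where r: "r > 0" "\<And>y. dist y x < r \<Longrightarrow> \<bar>A y - A x\<bar> < e/2 \<and> \<bar>B y - B x\<bar> < e/2 \<and> y \<in> S"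
      unfolding eventually_nhds_metric by auto
    define N where "N = norm v + norm w + 1"
    define h where "h = r / (2 * N)"
    have n: "N > 0" unfolding N_def by (smt (verit) norm_ge_zero)
    have h: "h > 0" using r n by (simp add: h_def)
    have near: "dist (x + s *\<^sub>R v + t *\<^sub>R w) x < r" if "0 \<le> s" "s \<le> h" "0 \<le> t" "t \<le> h" for s t
    proof -
      have "dist (x + s *\<^sub>R v + t *\<^sub>R w) x = norm (s *\<^sub>R v + t *\<^sub>R w)" by (simp add: dist_norm add.assoc)
      also have "\<dots> \<le> s * norm v + t * norm w" using that norm_triangle_ineq[of "s *\<^sub>R v" "t *\<^sub>R w"] by simp
      also have "\<dots> \<le> h * norm v + h * norm w" using that by (intro add_mono mult_right_mono) auto
      also have "\<dots> \<le> h * N" using h by (simp add: N_def algebra_simps)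
      also have "\<dots> = r / 2" using n by (simp add: h_def)
      also have "\<dots> < r" using r by simp
      finally show ?thesis .
    qed
    obtain s t where 1: "0 \<le> s" "s \<le> h" "0 \<le> t" "t \<le> h"
      "f (x + h *\<^sub>R v + h *\<^sub>R w) - f (x + h *\<^sub>R v) - f (x + h *\<^sub>R w) + f x = h\<^sup>2 * A (x + s *\<^sub>R v + t *\<^sub>R w)"
      unfolding A_def
    proof (rule second_difference[OF h, of f x v w])
      fix s t :: real assume "0 \<le> s" "s \<le> h" "0 \<le> t" "t \<le> h"
      from near[OF this] r(2) have "x + s *\<^sub>R v + t *\<^sub>R w \<in> S" by blast
      then show "f differentiable (at (x + s *\<^sub>R v + t *\<^sub>R w)) \<and> pd v f differentiable (at (x + s *\<^sub>R v + t *\<^sub>R w))"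
        using smooth_differentiable[OF f] smooth_differentiable[OF smooth_pd[OF f]] by blast
    qed
    obtain s' t' where 2: "0 \<le> s'" "s' \<le> h" "0 \<le> t'" "t' \<le> h"
      "f (x + h *\<^sub>R w + h *\<^sub>R v) - f (x + h *\<^sub>R w) - f (x + h *\<^sub>R v) + f x = h\<^sup>2 * B (x + s' *\<^sub>R w + t' *\<^sub>R v)"
      unfolding B_def
    proof (rule second_difference[OF h, of f x w v])
      fix s t :: real assume "0 \<le> s" "s \<le> h" "0 \<le> t" "t \<le> h"
      then have "x + t *\<^sub>R v + s *\<^sub>R w \<in> S" using near[of t s] r(2) by blast
      moreover have "x + s *\<^sub>R w + t *\<^sub>R v = x + t *\<^sub>R v + s *\<^sub>R w" by (simp add: add_ac)
      ultimately have "x + s *\<^sub>R w + t *\<^sub>R v \<in> S" by metis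
      then show "f differentiable (at (x + s *\<^sub>R w + t *\<^sub>R v)) \<and> pd w f differentiable (at (x + s *\<^sub>R w + t *\<^sub>R v))"
        using smooth_differentiable[OF f] smooth_differentiable[OF smooth_pd[OF f]] by blast
    qed
    have swap: "x + h *\<^sub>R w + h *\<^sub>R v = x + h *\<^sub>R v + h *\<^sub>R w" by simp
    from 1(5) 2(5)[unfolded swap] have "h\<^sup>2 * A (x + s *\<^sub>R v + t *\<^sub>R w) = h\<^sup>2 * B (x + s' *\<^sub>R w + t' *\<^sub>R v)" by linarith
    then have "A (x + s *\<^sub>R v + t *\<^sub>R w) = B (x + s' *\<^sub>R w + t' *\<^sub>R v)" using h by simp
    also have "x + s' *\<^sub>R w + t' *\<^sub>R v = x + t' *\<^sub>R v + s' *\<^sub>R w" by simp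
    finally have "A (x + s *\<^sub>R v + t *\<^sub>R w) = B (x + t' *\<^sub>R v + s' *\<^sub>R w)" .
    with r(2)[OF near[OF 1(1-4)]] r(2)[OF near[OF 2(3,4,1,2)]]
    show ?thesis by linarith
  qed
  from this[of "\<bar>A x - B x\<bar>"] have "A x = B x" by fastforce
  then show ?thesis by (simp add: A_def B_def)
qed

lemma pd_inner:
  assumes "f differentiable (at x)" shows "pd v (\<lambda>x. f x \<bullet> c) x = pd v f x \<bullet> c"
  by (rule pd_eq) (intro has_derivative_inner_left has_derivative_pd assms)

lemma pd_commute:
  fixes f :: "'a::real_normed_vector \<Rightarrow> 'b::euclidean_space"
  assumes S: "open S" and f: "smooth_on S f" and x: "x \<in> S"
  shows "pd w (pd v f) x = pd v (pd w f) x"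
proof (rule euclidean_eqI)
  fix c :: 'b
  have sm: "smooth_on S (\<lambda>x. f x \<bullet> c)"
    by (rule smooth_linear_comp[OF bounded_linear_inner_left S f])
  have "pd w (pd v (\<lambda>x. f x \<bullet> c)) x = pd w (pd v f) x \<bullet> c" for v w
  proof -
    have "pd w (pd v (\<lambda>x. f x \<bullet> c)) x = pd w (\<lambda>x. pd v f x \<bullet> c) x"
      by (rule pd_cong_open(1)[OF S x]) (rule pd_inner, rule smooth_differentiable[OF f])
    also have "\<dots> = pd w (pd v f) x \<bullet> c"
      by (rule pd_inner, rule smooth_differentiable[OF smooth_pd[OF f] x])
    finally show ?thesis .
  qed
  with pd_commute_real[OF S sm x] show "pd w (pd v f) x \<bullet> c = pd v (pd w f) x \<bullet> c" by metis
qed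

text \<open>
  The \<open>C\<^sup>1\<close> theorem provides the inverse \<open>g\<close>, whose derivative at \<open>y\<close> inverts that of \<open>f\<close> at \<open>g y\<close>.
  By Cramer's rule it is a rational expression in derivatives of \<open>f\<close> at \<open>g y\<close>; so if \<open>g\<close> is of class
  \<open>C\<^sup>n\<close>, then so are its derivatives, and \<open>g\<close> is of class \<open>C\<^sup>n\<^sup>+\<^sup>1\<close>.
\<close>

theorem smooth_inverse_function:
  fixes f :: "real^'m \<Rightarrow> real^'m"
  assumes S: "open S" and f: "smooth_on S f" and x0: "x0 \<in> S"
    and inj: "\<And>v. pd v f x0 = 0 \<Longrightarrow> v = 0"
  obtains U V g where "open U" "U \<subseteq> S" "x0 \<in> U" "open V" "f x0 \<in> V" "homeomorphism U V f g" "smooth_on V g"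
proof -
  have bl: "bounded_linear (\<lambda>v. pd v f x)" if "x \<in> S" for x
    using has_derivative_bounded_linear[OF smooth_has_derivative[OF f that]] .
  define f' where "f' = (\<lambda>x. Blinfun (\<lambda>v. pd v f x))"
  have f': "blinfun_apply (f' x) = (\<lambda>v. pd v f x)" if "x \<in> S" for x
    by (simp add: f'_def bounded_linear_Blinfun_apply[OF bl[OF that]])
  have der: "(f has_derivative blinfun_apply (f' x)) (at x)" if "x \<in> S" for x
    using smooth_has_derivative[OF f that] by (simp add: f'[OF that])
  have cont: "continuous_on S f'"
  proof (rule continuous_on_blinfun_componentwise)
    fix i :: "real^'m"
    have "continuous_on S (pd i f)" by (rule smooth_continuous[OF smooth_pd[OF f]])
    then show "continuous_on S (\<lambda>x. blinfun_apply (f' x) i)"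
      by (rule continuous_on_eq) (simp add: f')
  qed
  have lin: "linear (\<lambda>v. pd v f x0)" by (rule bounded_linear.linear[OF bl[OF x0]])
  have "inj (\<lambda>v. pd v f x0)" using inj linear_injective_0[OF lin] by blast
  with lin obtain h where h: "linear h" "h \<circ> (\<lambda>v. pd v f x0) = id"
    using linear_injective_left_inverse by blast
  have "Blinfun h o\<^sub>L f' x0 = id_blinfun"
  proof (rule blinfun_eqI)
    fix v
    have "blinfun_apply (Blinfun h) = h"
      using h(1) by (simp add: bounded_linear_Blinfun_apply linear_conv_bounded_linear)
    then show "blinfun_apply (Blinfun h o\<^sub>L f' x0) v = blinfun_apply id_blinfun v"
      using fun_cong[OF h(2), of v] by (simp add: f'[OF x0])
  qed
  from inverse_function_theorem[OF S der cont x0 this]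
  obtain U V g g' where U: "open U" "U \<subseteq> S" "x0 \<in> U" "open V" "f x0 \<in> V" "homeomorphism U V f g"
    and g: "\<And>y. y \<in> V \<Longrightarrow> (g has_derivative g' y) (at y)"
      "\<And>y. y \<in> V \<Longrightarrow> g' y = inv (blinfun_apply (f' (g y)))"
    and bij: "\<And>y. y \<in> V \<Longrightarrow> bij (blinfun_apply (f' (g y)))" by metis
  have gV: "g ` V \<subseteq> S" using U(2,6) by (auto simp: homeomorphism_def)
  define A where "A y = (\<chi> i j. pd (axis j 1) f (g y) $ i)" for y
  have A: "A y *v v = pd v f (g y)" if "y \<in> V" for y v
  proof -
    have gy: "g y \<in> S" using gV that by auto
    have "matrix (\<lambda>v. pd v f (g y)) *v v = pd v f (g y)"
      by (rule matrix_works) (metis linear_matrix_vector_mul_eq pd_linear smooth_differentiable[OF f gy])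
    then show ?thesis by (simp add: A_def matrix_def)
  qed
  have pg: "pd v g y = g' y v" if "y \<in> V" for y v by (rule pd_eq[OF g(1)[OF that]])
  have eq: "A y *v pd v g y = v" if "y \<in> V" for y v
  proof -
    have "pd (inv (blinfun_apply (f' (g y))) v) f (g y) = v"
      using bij[OF that] f'[of "g y"] gV that by (metis bij_is_surj image_subset_iff surj_f_inv_f)
    then show ?thesis by (simp add: A[OF that] pg[OF that] g(2)[OF that])
  qed
  have det: "det (A y) \<noteq> 0" if "y \<in> V" for y
  proof -
    have "A y ** matrix (g' y) = mat 1"
    proof -
      have "linear (g' y)" using g(1)[OF that] by (simp add: has_derivative_linear)
      then show ?thesis
        using eq[OF that] pg[OF that]
        by (simp add: matrix_eq matrix_vector_mul_assoc[symmetric] matrix_works)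
    qed
    then show ?thesis by (metis det_I det_mul mult_zero_left zero_neq_one)
  qed
  have cr: "pd v g y = (\<chi> k. det (\<chi> i j. if j = k then v $ i else A y $ i $ j) / det (A y))" if "y \<in> V" for y v
    using cramer[OF det[OF that], of "pd v g y" v] eq[OF that] by simp
  have "higher_differentiable_on V g n" for n
  proof (induction n)
    case 0
    then show ?case using U(6) by (simp add: homeomorphism_def)
  next
    case (Suc n)
    have pf: "higher_differentiable_on S (pd v f) n" for v
      using smooth_pd[OF f] by (simp add: smooth_on_def)
    have hA: "higher_differentiable_on V (\<lambda>y. A y $ i $ j) n" for i j
    proof -
      have "higher_differentiable_on V (\<lambda>y. pd (axis j 1) f (g y)) n"
        by (rule hdiff_compose[OF U(4) S gV pf Suc.IH])
      from hdiff_linear_comp[OF bounded_linear_vec_nth U(4) this, of i] show ?thesis by (simp add: A_def)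
    qed
    have comp: "higher_differentiable_on V (\<lambda>y. det (\<chi> i j. if j = k then v $ i else A y $ i $ j) * inverse (det (A y))) n" for v k
    proof (rule hdiff_bilinear[OF bounded_bilinear_mult U(4)])
      show "higher_differentiable_on V (\<lambda>y. det (\<chi> i j. if j = k then v $ i else A y $ i $ j)) n"
      proof (rule hdiff_det[OF U(4)])
        show "higher_differentiable_on V (\<lambda>y. (\<chi> i j. if j = k then v $ i else A y $ i $ j) $ i $ j) n" for i j
          by (cases "j = k") (simp_all add: hdiff_const hA)
      qed
      show "higher_differentiable_on V (\<lambda>y. inverse (det (A y))) n"
        by (rule hdiff_inverse[OF U(4) det hdiff_det[OF U(4) hA]])
    qed
    show ?case
    proof (rule hdiff_SucI[OF U(4)])
      show "(g has_derivative (\<lambda>v. \<chi> k. det (\<chi> i j. if j = k then v $ i else A y $ i $ j) / det (A y))) (at y)"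
        if "y \<in> V" for y
      proof -
        have "g' y = (\<lambda>v. \<chi> k. det (\<chi> i j. if j = k then v $ i else A y $ i $ j) / det (A y))"
          by (rule ext) (metis pg[OF that] cr[OF that])
        with g(1)[OF that] show ?thesis by simp
      qed
      show "higher_differentiable_on V (\<lambda>y. \<chi> k. det (\<chi> i j. if j = k then v $ i else A y $ i $ j) / det (A y)) n" for v
        using comp by (intro hdiff_vec[OF U(4)]) (simp add: divide_inverse)
    qed
  qed
  then show ?thesis using that[OF U] by (simp add: smooth_on_def)
qed

section \<open>Pseudo-Euclidean linear algebra\<close>

lemma pseudo_inner_eq: "pseudo_inner p q = fst p \<bullet> fst q - snd p \<bullet> snd q"
  by (simp add: pseudo_inner_def inner_vec_def)

lemma pseudo_inner_bilinear:
  "pseudo_inner (p + q) r = pseudo_inner p r + pseudo_inner q r"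
  "pseudo_inner r (p + q) = pseudo_inner r p + pseudo_inner r q"
  "pseudo_inner (p - q) r = pseudo_inner p r - pseudo_inner q r"
  "pseudo_inner r (p - q) = pseudo_inner r p - pseudo_inner r q"
  "pseudo_inner (c *\<^sub>R p) q = c * pseudo_inner p q"
  "pseudo_inner p (c *\<^sub>R q) = c * pseudo_inner p q"
  "pseudo_inner 0 q = 0" "pseudo_inner p 0 = 0"
  by (auto simp: pseudo_inner_eq inner_add_left inner_add_right inner_diff_left inner_diff_right
      algebra_simps)

text \<open>
  Gram-Schmidt for the form \<open>v \<bullet> w - L v \<bullet> L w\<close>, which is the pseudo-Euclidean one on the graph of \<open>L\<close> and is positive definite.
\<close>

lemma contraction_orthonormalization:
  fixes L :: "'a::euclidean_space \<Rightarrow> 'b::real_inner"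
  assumes L: "linear L" and contr: "\<And>v. v \<noteq> 0 \<Longrightarrow> norm (L v) < norm v"
  obtains A :: "'a \<Rightarrow> 'a" where "linear A" "bij A" "\<And>v w. A v \<bullet> A w - L (A v) \<bullet> L (A w) = v \<bullet> w"
proof -
  interpret linear L by fact
  define b where "b v w = v \<bullet> w - L v \<bullet> L w" for v w
  have b_sym: "b v w = b w v" for v w by (simp add: b_def inner_commute)
  have b_lin: "linear (\<lambda>v. b v w)" for w
    by (rule linearI) (auto simp: b_def add scale inner_add_left algebra_simps)
  have b_pos: "b v v > 0" if "v \<noteq> 0" for v
  proof -
    have "(norm (L v))\<^sup>2 < (norm v)\<^sup>2" using contr[OF that] by (simp add: power_strict_mono)
    then show ?thesis by (simp add: b_def power2_norm_eq_inner)
  qed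
  have "\<exists>e. (\<forall>i\<in>F. e i \<in> span F) \<and> (\<forall>i\<in>F. \<forall>j\<in>F. b (e i) (e j) = (if i = j then 1 else 0))"
    if "finite F" "F \<subseteq> Basis" for F :: "'a set"
    using that
  proof (induction F rule: finite_induct)
    case (insert i0 F)
    then obtain e :: "'a \<Rightarrow> 'a" where e0: "\<forall>i\<in>F. e i \<in> span F"
      "\<forall>i\<in>F. \<forall>j\<in>F. b (e i) (e j) = (if i = j then 1 else 0)" by auto
    then have e: "\<And>i. i \<in> F \<Longrightarrow> e i \<in> span F"
      "\<And>i j. i \<in> F \<Longrightarrow> j \<in> F \<Longrightarrow> b (e i) (e j) = (if i = j then 1 else 0)" by blast+
    define w where "w = i0 - (\<Sum>j\<in>F. b i0 (e j) *\<^sub>R e j)"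
    have sF: "(\<Sum>j\<in>F. b i0 (e j) *\<^sub>R e j) \<in> span F" by (intro span_sum span_scale e)
    have "i0 \<notin> span F"
    proof
      assume "i0 \<in> span F"
      then have "dependent (insert i0 F)"
        using insert.hyps(2) by (auto simp: dependent_def intro!: bexI[of _ i0])
      then show False using insert.prems independent_Basis dependent_mono by blast
    qed
    then have w0: "w \<noteq> 0" using sF by (auto simp: w_def)
    have bw: "b w (e k) = 0" if k: "k \<in> F" for k
    proof -
      have "b w (e k) = b i0 (e k) - (\<Sum>j\<in>F. b i0 (e j) * b (e j) (e k))"
        by (simp add: w_def linear_diff[OF b_lin] linear_sum[OF b_lin] linear_scale[OF b_lin])
      also have "(\<Sum>j\<in>F. b i0 (e j) * b (e j) (e k)) = (\<Sum>j\<in>F. if j = k then b i0 (e j) else 0)"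
        by (rule sum.cong) (use e(2) k in auto)
      also have "\<dots> = b i0 (e k)" using k insert.hyps(1) by simp
      finally show ?thesis by simp
    qed
    define w' where "w' = (1 / sqrt (b w w)) *\<^sub>R w"
    have bsc: "b (c *\<^sub>R x) y = c * b x y" "b y (c *\<^sub>R x) = c * b y x" for c x y
      using linear_scale[OF b_lin] b_sym by (metis real_scaleR_def)+
    have w'1: "b w' w' = 1" using b_pos[OF w0] by (simp add: w'_def bsc)
    have w'2: "b w' (e k) = 0" "b (e k) w' = 0" if "k \<in> F" for k
      using bw[OF that] b_sym by (simp_all add: w'_def bsc)
    have w'3: "w' \<in> span (insert i0 F)"
      unfolding w'_def w_def
      using sF span_mono[of F "insert i0 F"] by (intro span_scale span_diff span_base[of i0]) auto
    have "e k \<in> span (insert i0 F)" if "k \<in> F" for k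
      using e(1)[OF that] span_mono[of F "insert i0 F"] by auto
    then show ?case
      using w'1 w'2 w'3 e insert.hyps(2)
      by (intro exI[of _ "e(i0 := w')"]) auto
  qed simp
  from this[OF finite_Basis order_refl] obtain e :: "'a \<Rightarrow> 'a" where
    "(\<forall>i\<in>Basis. e i \<in> span Basis) \<and>
     (\<forall>i\<in>Basis. \<forall>j\<in>Basis. b (e i) (e j) = (if i = j then 1 else 0))" ..
  then have e: "\<And>i j. i \<in> Basis \<Longrightarrow> j \<in> Basis \<Longrightarrow> b (e i) (e j) = (if i = j then 1 else 0)" by blast
  define A where "A x = (\<Sum>i\<in>Basis. (x \<bullet> i) *\<^sub>R e i)" for x :: 'a
  have lA: "linear A"
    by (rule linearI) (auto simp: A_def inner_add_left scaleR_add_left sum.distrib scaleR_sum_right)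
  have bA1: "b (A v) w = (\<Sum>i\<in>Basis. (v \<bullet> i) * b (e i) w)" for v w
    unfolding A_def by (simp add: linear_sum[OF b_lin] linear_scale[OF b_lin])
  have bA2: "b (e i) (A w) = w \<bullet> i" if i: "i \<in> Basis" for i w
  proof -
    have "b (e i) (A w) = (\<Sum>j\<in>Basis. (w \<bullet> j) * b (e j) (e i))" by (subst b_sym) (rule bA1)
    also have "\<dots> = (\<Sum>j\<in>Basis. if j = i then w \<bullet> j else 0)"
      by (rule sum.cong) (use e i in auto)
    also have "\<dots> = w \<bullet> i" using i by simp
    finally show ?thesis .
  qed
  have bA: "b (A v) (A w) = v \<bullet> w" for v w
    by (simp add: bA1 bA2 euclidean_inner[of v w])
  have "inj A"
  proof -
    have "x = 0" if "A x = 0" for x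
    proof -
      have "x \<bullet> x = b (A x) (A x)" by (simp add: bA)
      also have "\<dots> = 0" by (simp add: that linear_0[OF b_lin])
      finally show ?thesis by simp
    qed
    then show ?thesis using linear_injective_0[OF lA] by blast
  qed
  then have "bij A" using lA by (simp add: bij_def linear_injective_imp_surjective)
  with lA bA show ?thesis by (intro that[of A]) (auto simp: b_def)
qed

text \<open>
  The pseudo-orthogonal complement of the graph of \<open>L\<close> is \<open>{(K w, w)}\<close> with \<open>K\<close> the adjoint of \<open>L\<close>, again a
  strict contraction. Orthonormal bases of the two spaces, given by \<open>A\<close> and \<open>C\<close>, make up an isometry \<open>\<Psi>\<close>
  that takes \<open>real^'m \<times> {0}\<close> to the graph of \<open>L\<close>; \<open>\<Phi>\<close> is its inverse.
\<close>

lemma boost_exists: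
  fixes L :: "real^'m \<Rightarrow> real^'n"
  assumes L: "linear L" and contr: "\<And>v. v \<noteq> 0 \<Longrightarrow> norm (L v) < norm v"
  obtains \<Phi> :: "(real^'m) \<times> (real^'n) \<Rightarrow> (real^'m) \<times> (real^'n)" where
    "linear \<Phi>" "bij \<Phi>" "\<And>p q. pseudo_inner (\<Phi> p) (\<Phi> q) = pseudo_inner p q"
    "\<And>v. snd (\<Phi> (v, L v)) = 0" "\<And>p. snd (\<Phi> p) = 0 \<Longrightarrow> snd p = L (fst p)"
proof -
  define K where "K = adjoint L"
  have K: "linear K" "\<And>x y. x \<bullet> K y = L x \<bullet> y"
    using adjoint_linear[OF L] adjoint_works[OF L] by (auto simp: K_def)
  have Kc: "norm (K w) < norm w" if "w \<noteq> 0" for w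
  proof (cases "K w = 0")
    case False
    have "(norm (K w))\<^sup>2 = L (K w) \<bullet> w" using K(2)[of "K w" w] by (simp add: power2_norm_eq_inner)
    also have "\<dots> \<le> norm (L (K w)) * norm w" by (rule norm_cauchy_schwarz)
    also have "\<dots> < norm (K w) * norm w" using contr[OF False] that by (intro mult_strict_right_mono) auto
    finally show ?thesis using False by (simp add: power2_eq_square)
  qed (use that in simp)
  obtain A :: "real^'m \<Rightarrow> real^'m" where A: "linear A" "bij A" "\<And>v w. A v \<bullet> A w - L (A v) \<bullet> L (A w) = v \<bullet> w"
    using contraction_orthonormalization[OF L contr] by blast
  obtain C :: "real^'n \<Rightarrow> real^'n" where C: "linear C" "bij C" "\<And>v w. C v \<bullet> C w - K (C v) \<bullet> K (C w) = v \<bullet> w"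
    using contraction_orthonormalization[OF K(1) Kc] by blast
  define \<Psi> where "\<Psi> p = (A (fst p) + K (C (snd p)), L (A (fst p)) + C (snd p))" for p :: "(real^'m) \<times> (real^'n)"
  have lin: "linear \<Psi>"
    by (rule linearI) (auto simp: \<Psi>_def linear_add[OF A(1)] linear_add[OF C(1)] linear_add[OF L] linear_add[OF K(1)]
        linear_scale[OF A(1)] linear_scale[OF C(1)] linear_scale[OF L] linear_scale[OF K(1)] algebra_simps)
  have iso: "pseudo_inner (\<Psi> p) (\<Psi> q) = pseudo_inner p q" for p q
  proof -
    have "pseudo_inner (\<Psi> p) (\<Psi> q) =
      (A (fst p) \<bullet> A (fst q) - L (A (fst p)) \<bullet> L (A (fst q))) - (C (snd p) \<bullet> C (snd q) - K (C (snd p)) \<bullet> K (C (snd q)))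
      + (A (fst p) \<bullet> K (C (snd q)) - L (A (fst p)) \<bullet> C (snd q))
      + (A (fst q) \<bullet> K (C (snd p)) - L (A (fst q)) \<bullet> C (snd p))"
      by (simp add: pseudo_inner_eq \<Psi>_def inner_add_left inner_add_right inner_commute)
    also have "\<dots> = pseudo_inner p q"
      using K(2)[of "A (fst p)" "C (snd q)"] K(2)[of "A (fst q)" "C (snd p)"]
      by (simp only: A(3) C(3) pseudo_inner_eq)
    finally show ?thesis .
  qed
  have "inj \<Psi>"
  proof -
    have "p = 0" if "\<Psi> p = 0" for p
    proof -
      have *: "pseudo_inner p q = 0" for q
        using iso[of p q] that by (simp add: pseudo_inner_bilinear)
      have "fst p \<bullet> fst p = 0" "snd p \<bullet> snd p = 0"
        using *[of "(fst p, 0)"] *[of "(0, snd p)"] by (simp_all add: pseudo_inner_eq)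
      then show ?thesis by (simp add: prod_eq_iff)
    qed
    then show ?thesis using linear_injective_0[OF lin] by blast
  qed
  then have bij: "bij \<Psi>" using lin by (simp add: bij_def linear_injective_imp_surjective)
  define \<Phi> where "\<Phi> = inv \<Psi>"
  have \<Phi>: "\<Phi> (\<Psi> p) = p" "\<Psi> (\<Phi> p) = p" for p
    using bij by (simp_all add: \<Phi>_def bij_is_inj bij_is_surj surj_f_inv_f)
  show ?thesis
  proof
    show "linear \<Phi>"
      by (rule linearI) (metis \<Phi> linear_add[OF lin] linear_scale[OF lin])+
    show "bij \<Phi>" using bij by (simp add: \<Phi>_def bij_imp_bij_inv)
    show "pseudo_inner (\<Phi> p) (\<Phi> q) = pseudo_inner p q" for p q
      using iso[of "\<Phi> p" "\<Phi> q"] by (simp add: \<Phi>)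
    show "snd (\<Phi> (v, L v)) = 0" for v
    proof -
      obtain w where w: "A w = v" using A(2) by (metis bij_pointE)
      have "\<Psi> (w, 0) = (v, L v)" by (simp add: \<Psi>_def w linear_0[OF C(1)] linear_0[OF K(1)])
      then show ?thesis by (metis \<Phi>(1) snd_conv)
    qed
    show "snd p = L (fst p)" if "snd (\<Phi> p) = 0" for p
    proof -
      have "p = \<Psi> (fst (\<Phi> p), 0)" using that \<Phi>(2)[of p] by (metis prod.collapse)
      then have "p = (A (fst (\<Phi> p)), L (A (fst (\<Phi> p))))"
        by (simp add: \<Psi>_def linear_0[OF C(1)] linear_0[OF K(1)])
      then show ?thesis by (metis fst_conv snd_conv)
    qed
  qed
qed

section \<open>Jets of curves in a submanifold\<close>

text \<open>
  Velocity and acceleration at \<open>p\<close> of the curves in \<open>M\<close>. Velocities are the tangent vectors, and the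
  accelerations of the curves with velocity \<open>v\<close> form a coset of the tangent space whose common normal part is
  \<open>B(v,v)\<close>. Jets move with \<open>M\<close> under affine maps, so a statement in terms of jets is invariant under
  isometries, without any change of variables in \<open>M\<close>.
\<close>

definition jet :: "'p::real_normed_vector set \<Rightarrow> 'p \<Rightarrow> 'p \<Rightarrow> 'p \<Rightarrow> bool" where
  "jet M p v a \<longleftrightarrow> (\<exists>\<epsilon>>0. \<exists>\<gamma>. smooth_on {-\<epsilon><..<\<epsilon>} \<gamma> \<and> \<gamma> ` {-\<epsilon><..<\<epsilon>} \<subseteq> M \<and> \<gamma> 0 = p \<and>
      pd 1 \<gamma> (0::real) = v \<and> pd 1 (pd 1 \<gamma>) 0 = a)"

lemma jetE:
  assumes "jet M p v a"
  obtains \<epsilon> \<gamma> where "\<epsilon> > 0" "smooth_on {-\<epsilon><..<\<epsilon>} \<gamma>" "\<gamma> ` {-\<epsilon><..<\<epsilon>} \<subseteq> M" "\<gamma> 0 = p"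
    "pd 1 \<gamma> (0::real) = v" "pd 1 (pd 1 \<gamma>) 0 = a"
  using assms unfolding jet_def by (elim exE conjE) (rule that)

lemma has_vector_derivative_pd:
  "f differentiable (at (t::real)) \<Longrightarrow> (f has_vector_derivative pd 1 f t) (at t)"
  using line_derivative[of f 0 t 1] by simp

lemma pd_1_eq: "(f has_vector_derivative v) (at t) \<Longrightarrow> pd 1 f t = v"
  using pd_eq[of f "\<lambda>h. h *\<^sub>R v" t 1] by (simp add: has_vector_derivative_def)

lemma tangent_space_jet: "v \<in> tangent_space M p \<longleftrightarrow> (\<exists>a. jet M p v a)"
proof
  assume "v \<in> tangent_space M p"
  then show "\<exists>a. jet M p v a" unfolding tangent_space_def jet_def using pd_1_eq by blast
next
  assume "\<exists>a. jet M p v a"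
  then obtain a where "jet M p v a" ..
  then obtain \<epsilon> :: real and \<gamma> where "\<epsilon> > 0" "smooth_on {-\<epsilon><..<\<epsilon>} \<gamma>" "\<gamma> ` {-\<epsilon><..<\<epsilon>} \<subseteq> M" "\<gamma> 0 = p" "pd 1 \<gamma> 0 = v"
    by (rule jetE)
  moreover from this have "(\<gamma> has_vector_derivative v) (at 0)"
    using has_vector_derivative_pd[of \<gamma> 0] smooth_differentiable[of "{-\<epsilon><..<\<epsilon>}" \<gamma> 0] by auto
  ultimately show "v \<in> tangent_space M p" unfolding tangent_space_def by blast
qed

lemma jet_affine_image:
  fixes L :: "'p::real_normed_vector \<Rightarrow> 'q::real_normed_vector"
  assumes L: "bounded_linear L" and "jet M p v a"
  shows "jet ((\<lambda>x. L x + b) ` M) (L p + b) (L v) (L a)"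
proof -
  from assms(2) obtain \<epsilon> :: real and \<gamma> where e: "\<epsilon> > 0" and g: "smooth_on {-\<epsilon><..<\<epsilon>} \<gamma>" "\<gamma> ` {-\<epsilon><..<\<epsilon>} \<subseteq> M" "\<gamma> 0 = p"
    "pd 1 \<gamma> 0 = v" "pd 1 (pd 1 \<gamma>) 0 = a" by (rule jetE)
  let ?I = "{-\<epsilon><..<\<epsilon>}"
  have z: "0 \<in> ?I" using e by simp
  have *: "pd 1 (\<lambda>t. L (f t) + c) t = L (pd 1 f t)" if "smooth_on ?I f" "t \<in> ?I" for f t c
    by (rule pd_eq) (rule has_derivative_add_const[OF bounded_linear.has_derivative[OF L smooth_has_derivative[OF that]]])
  have "pd 1 (pd 1 (\<lambda>t. L (\<gamma> t) + b)) 0 = pd 1 (\<lambda>t. L (pd 1 \<gamma> t)) 0"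
    by (rule pd_cong_open(1)[OF open_greaterThanLessThan z]) (rule *[OF g(1)])
  also have "\<dots> = L a" using *[OF smooth_pd[OF g(1), of 1] z, of 0] g by simp
  finally have 2: "pd 1 (pd 1 (\<lambda>t. L (\<gamma> t) + b)) 0 = L a" .
  show ?thesis
    unfolding jet_def
  proof (intro exI conjI)
    show "0 < \<epsilon>" by fact
    show "smooth_on ?I (\<lambda>t. L (\<gamma> t) + b)"
      by (intro smooth_add smooth_linear_comp[OF L] smooth_const g(1)) auto
    show "(\<lambda>t. L (\<gamma> t) + b) ` ?I \<subseteq> (\<lambda>x. L x + b) ` M"
      using image_mono[OF g(2), of "\<lambda>x. L x + b"] by (simp add: image_image)
    show "L (\<gamma> 0) + b = L p + b" by (simp add: g)
    show "pd 1 (\<lambda>t. L (\<gamma> t) + b) 0 = L v" using *[OF g(1) z] g by simp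
  qed (rule 2)
qed

text \<open>
  Second-order chain rule: the direction of the derivative varies along with the base point.
\<close>

lemma pd_along:
  fixes u :: "'a::euclidean_space \<Rightarrow> 'b::euclidean_space" and \<xi> w :: "real \<Rightarrow> 'a"
  assumes B: "open B" and u: "smooth_on B u" and x: "\<xi> t \<in> B"
    and \<xi>: "(\<xi> has_vector_derivative \<xi>') (at t)" and w: "(w has_vector_derivative w') (at t)"
  shows "((\<lambda>s. pd (w s) u (\<xi> s)) has_vector_derivative pd w' u (\<xi> t) + pd \<xi>' (pd (w t) u) (\<xi> t)) (at t)"
proof -
  have cont: "isCont \<xi> t" using \<xi> has_vector_derivative_continuous by blast
  then have "eventually (\<lambda>s. \<xi> s \<in> B) (nhds t)"
    using B x by (simp add: continuous_at tendsto_at_iff_tendsto_nhds topological_tendstoD)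
  then obtain T where T: "open T" "t \<in> T" "\<And>s. s \<in> T \<Longrightarrow> \<xi> s \<in> B" unfolding eventually_nhds by blast
  have du: "u differentiable (at y)" if "y \<in> B" for y by (rule smooth_differentiable[OF u that])
  have d: "((\<lambda>s. pd b u (\<xi> s)) has_vector_derivative pd \<xi>' (pd b u) (\<xi> t)) (at t)" for b
  proof -
    have "((pd b u \<circ> \<xi>) has_derivative (\<lambda>v. pd v (pd b u) (\<xi> t)) \<circ> (\<lambda>h. h *\<^sub>R \<xi>')) (at t)"
      by (rule diff_chain_at) (use \<xi> smooth_has_derivative[OF smooth_pd[OF u] x] in \<open>auto simp: has_vector_derivative_def\<close>)
    then show ?thesis
      by (simp add: has_vector_derivative_def o_def pd_scale[OF smooth_differentiable[OF smooth_pd[OF u] x]])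
  qed
  have i: "((\<lambda>s. w s \<bullet> b) has_real_derivative w' \<bullet> b) (at t)" for b
    using bounded_linear.has_vector_derivative[OF bounded_linear_inner_left w]
    by (simp add: has_real_derivative_iff_has_vector_derivative)
  have "((\<lambda>s. \<Sum>b\<in>Basis. (w s \<bullet> b) *\<^sub>R pd b u (\<xi> s)) has_vector_derivative
      (\<Sum>b\<in>Basis. (w t \<bullet> b) *\<^sub>R pd \<xi>' (pd b u) (\<xi> t) + (w' \<bullet> b) *\<^sub>R pd b u (\<xi> t))) (at t)"
    by (intro has_vector_derivative_sum has_vector_derivative_scaleR i d)
  also have "(\<Sum>b\<in>Basis. (w t \<bullet> b) *\<^sub>R pd \<xi>' (pd b u) (\<xi> t) + (w' \<bullet> b) *\<^sub>R pd b u (\<xi> t))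
      = (\<Sum>b\<in>Basis. (w t \<bullet> b) *\<^sub>R pd b (pd \<xi>' u) (\<xi> t)) + pd w' u (\<xi> t)"
    by (simp add: sum.distrib pd_commute[OF B u x, of \<xi>'] pd_expand[OF du[OF x], of w'])
  also have "(\<Sum>b\<in>Basis. (w t \<bullet> b) *\<^sub>R pd b (pd \<xi>' u) (\<xi> t)) = pd \<xi>' (pd (w t) u) (\<xi> t)"
    by (simp add: pd_expand[OF smooth_differentiable[OF smooth_pd[OF u] x], of "w t" \<xi>', symmetric] pd_commute[OF B u x, of \<xi>'])
  finally have "((\<lambda>s. \<Sum>b\<in>Basis. (w s \<bullet> b) *\<^sub>R pd b u (\<xi> s)) has_vector_derivative
     pd \<xi>' (pd (w t) u) (\<xi> t) + pd w' u (\<xi> t)) (at t)" .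
  then have "((\<lambda>s. pd (w s) u (\<xi> s)) has_vector_derivative pd \<xi>' (pd (w t) u) (\<xi> t) + pd w' u (\<xi> t)) (at t)"
    by (rule has_vector_derivative_transform_within_open[OF _ T(1,2)])
       (rule pd_expand[OF du[OF T(3)], symmetric])
  then show ?thesis by (simp add: add.commute)
qed

lemma curve_derivatives:
  fixes u :: "'a::euclidean_space \<Rightarrow> 'b::euclidean_space" and \<xi> :: "real \<Rightarrow> 'a"
  assumes B: "open B" and u: "smooth_on B u" and I: "open I" and \<xi>: "smooth_on I \<xi>" and sub: "\<xi> ` I \<subseteq> B" and t: "t \<in> I"
  shows "pd 1 (\<lambda>s. u (\<xi> s)) t = pd (pd 1 \<xi> t) u (\<xi> t)"
    "pd 1 (pd 1 (\<lambda>s. u (\<xi> s))) t = pd (pd 1 \<xi> t) (pd (pd 1 \<xi> t) u) (\<xi> t) + pd (pd 1 (pd 1 \<xi>) t) u (\<xi> t)"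
proof -
  have 1: "pd 1 (\<lambda>s. u (\<xi> s)) s = pd (pd 1 \<xi> s) u (\<xi> s)" if "s \<in> I" for s
    by (rule pd_eq[OF pd_comp]) (use that sub in \<open>auto intro: smooth_differentiable[OF u] smooth_differentiable[OF \<xi>]\<close>)
  then show "pd 1 (\<lambda>s. u (\<xi> s)) t = pd (pd 1 \<xi> t) u (\<xi> t)" using t by blast
  have "pd 1 (pd 1 (\<lambda>s. u (\<xi> s))) t = pd 1 (\<lambda>s. pd (pd 1 \<xi> s) u (\<xi> s)) t"
    by (rule pd_cong_open(1)[OF I t]) (rule 1)
  also have "\<dots> = pd (pd 1 (pd 1 \<xi>) t) u (\<xi> t) + pd (pd 1 \<xi> t) (pd (pd 1 \<xi> t) u) (\<xi> t)"
    by (rule pd_1_eq, rule pd_along[OF B u])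
       (use t sub in \<open>auto intro!: has_vector_derivative_pd smooth_differentiable[OF \<xi>] smooth_differentiable[OF smooth_pd[OF \<xi>]]\<close>)
  finally show "pd 1 (pd 1 (\<lambda>s. u (\<xi> s))) t = pd (pd 1 \<xi> t) (pd (pd 1 \<xi> t) u) (\<xi> t) + pd (pd 1 (pd 1 \<xi>) t) u (\<xi> t)"
    by (simp add: add.commute)
qed

lemma pd_Pair:
  assumes "f differentiable (at x)" "g differentiable (at x)"
  shows "pd v (\<lambda>x. (f x, g x)) x = (pd v f x, pd v g x)"
  by (rule pd_eq) (intro has_derivative_Pair has_derivative_pd assms)

definition graph_over :: "'a set \<Rightarrow> ('a \<Rightarrow> 'b) \<Rightarrow> ('a \<times> 'b) set" where
  "graph_over B u = (\<lambda>x. (x, u x)) ` B"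

lemma pd_Pair2:
  assumes I: "open I" and f: "smooth_on I f" and g: "smooth_on I g" and t: "t \<in> I"
  shows "pd v (\<lambda>t. (f t, g t)) t = (pd v f t, pd v g t)"
    "pd v (pd v (\<lambda>t. (f t, g t))) t = (pd v (pd v f) t, pd v (pd v g) t)"
proof -
  have 1: "pd v (\<lambda>t. (f t, g t)) s = (pd v f s, pd v g s)" if "s \<in> I" for s
    by (rule pd_Pair[OF smooth_differentiable[OF f that] smooth_differentiable[OF g that]])
  then show "pd v (\<lambda>t. (f t, g t)) t = (pd v f t, pd v g t)" using t by blast
  have "pd v (pd v (\<lambda>t. (f t, g t))) t = pd v (\<lambda>t. (pd v f t, pd v g t)) t"
    by (rule pd_cong_open(1)[OF I t]) (rule 1)
  also have "\<dots> = (pd v (pd v f) t, pd v (pd v g) t)"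
    by (rule pd_Pair[OF smooth_differentiable[OF smooth_pd[OF f] t] smooth_differentiable[OF smooth_pd[OF g] t]])
  finally show "pd v (pd v (\<lambda>t. (f t, g t))) t = (pd v (pd v f) t, pd v (pd v g) t)" .
qed

lemma curve_in_open:
  fixes \<gamma> :: "real \<Rightarrow> 'p::real_normed_vector"
  assumes e: "\<epsilon> > 0" and g: "continuous_on {-\<epsilon><..<\<epsilon>} \<gamma>" and W: "open W" "\<gamma> 0 \<in> W"
  obtains \<delta> where "0 < \<delta>" "\<delta> \<le> \<epsilon>" "\<gamma> ` {-\<delta><..<\<delta>} \<subseteq> W"
proof -
  have "isCont \<gamma> 0" using g e by (simp add: continuous_on_eq_continuous_at)
  then have "eventually (\<lambda>t. \<gamma> t \<in> W) (nhds 0)"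
    using W by (simp add: continuous_at tendsto_at_iff_tendsto_nhds topological_tendstoD)
  then obtain d where d: "d > 0" "\<And>t. dist t 0 < d \<Longrightarrow> \<gamma> t \<in> W"
    unfolding eventually_nhds_metric by blast
  show ?thesis by (rule that[of "min d \<epsilon>"]) (use d e in auto)
qed

text \<open>
  The tangential part \<open>c\<close> of the acceleration is arbitrary: the curve \<open>x + t v + t\<^sup>2 c / 2\<close> realizes it.
\<close>

lemma jet_graph:
  fixes u :: "real^'m \<Rightarrow> real^'n"
  assumes B: "open B" and u: "smooth_on B u" and W: "open W" and M: "M \<inter> W = graph_over B u" and x: "x \<in> B"
  shows "jet M (x, u x) V A \<longleftrightarrow> (\<exists>v c. V = (v, pd v u x) \<and> A = (c, pd v (pd v u) x + pd c u x))"
proof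
  assume "jet M (x, u x) V A"
  then obtain \<epsilon> :: real and \<gamma> where e: "\<epsilon> > 0" and g: "smooth_on {-\<epsilon><..<\<epsilon>} \<gamma>" "\<gamma> ` {-\<epsilon><..<\<epsilon>} \<subseteq> M" "\<gamma> 0 = (x, u x)"
    "pd 1 \<gamma> 0 = V" "pd 1 (pd 1 \<gamma>) 0 = A" by (rule jetE)
  have "(x, u x) \<in> W" using M x by (auto simp: graph_over_def)
  then obtain \<delta> where \<delta>: "0 < \<delta>" "\<delta> \<le> \<epsilon>" "\<gamma> ` {-\<delta><..<\<delta>} \<subseteq> W"
    using curve_in_open[OF e smooth_continuous[OF g(1)] W] g(3) by metis
  let ?J = "{-\<delta><..<\<delta>}"
  define \<xi> where "\<xi> = (\<lambda>t. fst (\<gamma> t))"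
  have z: "0 \<in> ?J" using \<delta> by simp
  have gJ: "smooth_on ?J \<gamma>" by (rule smooth_subset[OF g(1)]) (use \<delta> in auto)
  have \<xi>: "smooth_on ?J \<xi>" unfolding \<xi>_def by (rule smooth_linear_comp[OF bounded_linear_fst _ gJ]) simp
  have inG: "\<gamma> t \<in> graph_over B u" if "t \<in> ?J" for t
    using that \<delta> g(2) M by (metis IntI greaterThanLessThan_iff imageI image_subset_iff le_less_trans less_le_trans minus_le_iff neg_le_iff_le order_less_le_trans)
  then have eq: "\<gamma> t = (\<xi> t, u (\<xi> t))" "\<xi> t \<in> B" if "t \<in> ?J" for t
    using that by (fastforce simp: graph_over_def \<xi>_def)+
  have sub: "\<xi> ` ?J \<subseteq> B" using eq(2) by auto
  have uxi: "smooth_on ?J (\<lambda>t. u (\<xi> t))" by (rule smooth_compose[OF _ B sub u \<xi>]) simp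
  have x0: "\<xi> 0 = x" using g(3) by (simp add: \<xi>_def)
  have p1: "pd 1 \<gamma> t = pd 1 (\<lambda>t. (\<xi> t, u (\<xi> t))) t" if "t \<in> ?J" for t
    by (rule pd_cong_open(1)[OF _ that]) (use eq in auto)
  have p2: "pd 1 (pd 1 \<gamma>) 0 = pd 1 (pd 1 (\<lambda>t. (\<xi> t, u (\<xi> t)))) 0"
    by (rule pd_cong_open(1)[OF _ z]) (use p1 in auto)
  have "V = (pd 1 \<xi> 0, pd (pd 1 \<xi> 0) u x)"
    using p1[OF z] pd_Pair2(1)[OF _ \<xi> uxi z, of 1] curve_derivatives(1)[OF B u _ \<xi> sub z] g(4) x0 by simp
  moreover have "A = (pd 1 (pd 1 \<xi>) 0, pd (pd 1 \<xi> 0) (pd (pd 1 \<xi> 0) u) x + pd (pd 1 (pd 1 \<xi>) 0) u x)"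
    using p2 pd_Pair2(2)[OF _ \<xi> uxi z, of 1] curve_derivatives(2)[OF B u _ \<xi> sub z] g(5) x0 by simp
  ultimately show "\<exists>v c. V = (v, pd v u x) \<and> A = (c, pd v (pd v u) x + pd c u x)" by blast
next
  assume "\<exists>v c. V = (v, pd v u x) \<and> A = (c, pd v (pd v u) x + pd c u x)"
  then obtain v c where VA: "V = (v, pd v u x)" "A = (c, pd v (pd v u) x + pd c u x)" by blast
  define \<xi> where "\<xi> t = x + t *\<^sub>R v + (t * t) *\<^sub>R ((1/2) *\<^sub>R c)" for t :: real
  have \<xi>s: "smooth_on UNIV \<xi>"
    unfolding \<xi>_def
    by (intro smooth_add smooth_bilinear[OF bounded_bilinear_scaleR] smooth_bilinear[OF bounded_bilinear_mult]
        smooth_const smooth_linear bounded_linear_ident) auto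
  have lin: "((\<lambda>t. t *\<^sub>R w) has_vector_derivative w) (at t)" for w :: "real^'m" and t :: real
    unfolding has_vector_derivative_def
    by (rule bounded_linear_imp_has_derivative) (rule bounded_linear_scaleR_left)
  have d1: "pd 1 \<xi> t = v + t *\<^sub>R c" for t
  proof (rule pd_1_eq)
    have sq: "((\<lambda>t. t * t) has_real_derivative t + t) (at t)"
      by (rule derivative_eq_intros refl | simp)+
    have "(\<xi> has_vector_derivative 0 + v + (t * t) *\<^sub>R 0 + (t + t) *\<^sub>R ((1/2) *\<^sub>R c)) (at t)"
      unfolding \<xi>_def add.assoc
      by (intro has_vector_derivative_add has_vector_derivative_scaleR lin sq has_vector_derivative_const)
    moreover have "(t + t) *\<^sub>R ((1/2) *\<^sub>R c) = t *\<^sub>R c" by simp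
    ultimately show "(\<xi> has_vector_derivative v + t *\<^sub>R c) (at t)" by simp
  qed
  have "pd 1 (\<lambda>t. v + t *\<^sub>R c) 0 = c"
    using has_vector_derivative_add[OF has_vector_derivative_const[of v] lin[of c 0]] by (intro pd_1_eq) simp
  moreover have "pd 1 \<xi> = (\<lambda>t. v + t *\<^sub>R c)" by (rule ext) (rule d1)
  ultimately have d2: "pd 1 (pd 1 \<xi>) 0 = c" by simp
  obtain \<delta> where \<delta>: "0 < \<delta>" "\<xi> ` {-\<delta><..<\<delta>} \<subseteq> B"
  proof (rule curve_in_open[of 1 \<xi> B])
    show "continuous_on {-1<..<1} \<xi>" by (rule smooth_continuous[OF smooth_subset[OF \<xi>s]]) simp
    show "\<xi> 0 \<in> B" using x by (simp add: \<xi>_def)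
  qed (use B in auto)
  let ?J = "{-\<delta><..<\<delta>}"
  have z: "0 \<in> ?J" using \<delta> by simp
  have \<xi>: "smooth_on ?J \<xi>" by (rule smooth_subset[OF \<xi>s]) simp
  have uxi: "smooth_on ?J (\<lambda>t. u (\<xi> t))" by (rule smooth_compose[OF _ B \<delta>(2) u \<xi>]) simp
  have x0: "\<xi> 0 = x" "pd 1 \<xi> 0 = v" by (simp add: \<xi>_def) (simp add: d1)
  show "jet M (x, u x) V A"
    unfolding jet_def
  proof (rule exI[of _ \<delta>], rule conjI, rule \<delta>(1), rule exI[of _ "\<lambda>t. (\<xi> t, u (\<xi> t))"], intro conjI)
    show "smooth_on ?J (\<lambda>t. (\<xi> t, u (\<xi> t)))" by (rule smooth_Pair[OF _ \<xi> uxi]) simp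
    have "(\<xi> t, u (\<xi> t)) \<in> graph_over B u" if "t \<in> ?J" for t
      unfolding graph_over_def by (rule imageI) (use \<delta>(2) that in blast)
    then show "(\<lambda>t. (\<xi> t, u (\<xi> t))) ` ?J \<subseteq> M" unfolding M[symmetric] by blast
    show "(\<xi> 0, u (\<xi> 0)) = (x, u x)" by (simp add: x0)
    show "pd 1 (\<lambda>t. (\<xi> t, u (\<xi> t))) 0 = V"
      unfolding pd_Pair2(1)[OF open_greaterThanLessThan \<xi> uxi z] VA(1)
        curve_derivatives(1)[OF B u open_greaterThanLessThan \<xi> \<delta>(2) z] x0 ..
    show "pd 1 (pd 1 (\<lambda>t. (\<xi> t, u (\<xi> t)))) 0 = A"
    proof -
      have "pd 1 (pd 1 (\<lambda>t. (\<xi> t, u (\<xi> t)))) 0 = (pd 1 (pd 1 \<xi>) 0, pd 1 (pd 1 (\<lambda>s. u (\<xi> s))) 0)"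
        by (rule pd_Pair2(2)[OF open_greaterThanLessThan \<xi> uxi z])
      also have "\<dots> = A"
        unfolding VA(2) curve_derivatives(2)[OF B u open_greaterThanLessThan \<xi> \<delta>(2) z] x0 d2 ..
      finally show ?thesis .
    qed
  qed
qed

section \<open>Isometries and local graphs\<close>

lemma tangent_space_graph:
  fixes u :: "real^'m \<Rightarrow> real^'n"
  assumes "open B" "smooth_on B u" "open W" "M \<inter> W = graph_over B u" "x \<in> B"
  shows "tangent_space M (x, u x) = range (\<lambda>v. (v, pd v u x))"
  using jet_graph[OF assms] by (auto simp: tangent_space_jet set_eq_iff)

lemma space_like_graph:
  fixes u :: "real^'m \<Rightarrow> real^'n"
  assumes "open B" "smooth_on B u" "open W" "M \<inter> W = graph_over B u" "x \<in> B"
    and sp: "space_like M" and v: "v \<noteq> 0"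
  shows "norm (pd v u x) < norm v"
proof -
  have "(x, u x) \<in> M" using assms(4,5) by (auto simp: graph_over_def)
  moreover have "(v, pd v u x) \<in> tangent_space M (x, u x)" by (simp add: tangent_space_graph[OF assms(1-5)])
  moreover have "(v, pd v u x) \<noteq> 0" using v by (simp add: prod_eq_iff)
  ultimately have "pseudo_inner (v, pd v u x) (v, pd v u x) > 0" using sp unfolding space_like_def by blast
  then have "(norm (pd v u x))\<^sup>2 < (norm v)\<^sup>2" by (simp add: pseudo_inner_eq power2_norm_eq_inner)
  then show ?thesis by (simp add: power2_less_imp_less)
qed

text \<open>
  The affine isometry \<open>\<Lambda>\<close> with linear part \<open>\<Phi>\<close>, and its inverse \<open>\<Lambda>'\<close> with linear part \<open>\<Phi>'\<close>.
\<close>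

locale pseudo_isometry =
  fixes \<Phi> :: "(real^'m) \<times> (real^'n) \<Rightarrow> (real^'m) \<times> (real^'n)" and b :: "(real^'m) \<times> (real^'n)"
  assumes lin: "linear \<Phi>" and bij: "bij \<Phi>" and iso: "\<And>p q. pseudo_inner (\<Phi> p) (\<Phi> q) = pseudo_inner p q"
begin

definition "\<Lambda> p = \<Phi> p + b"
definition "\<Phi>' = inv \<Phi>"
definition "\<Lambda>' q = \<Phi>' q + (- \<Phi>' b)"

lemma inv_simps [simp]: "\<Phi>' (\<Phi> p) = p" "\<Phi> (\<Phi>' p) = p"
  using bij by (simp_all add: \<Phi>'_def bij_is_inj bij_is_surj surj_f_inv_f)

lemma lin': "linear \<Phi>'"
  by (rule linearI) (metis inv_simps linear_add[OF lin] linear_scale[OF lin])+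

lemma bl: "bounded_linear \<Phi>" "bounded_linear \<Phi>'"
  using lin lin' by (simp_all add: linear_conv_bounded_linear)

lemma iso': "pseudo_inner (\<Phi>' p) (\<Phi>' q) = pseudo_inner p q"
  using iso[of "\<Phi>' p" "\<Phi>' q"] by simp

lemma \<Lambda>_simps [simp]: "\<Lambda>' (\<Lambda> p) = p" "\<Lambda> (\<Lambda>' p) = p"
  by (simp_all add: \<Lambda>_def \<Lambda>'_def linear_add[OF lin'] linear_add[OF lin] linear_neg[OF lin] linear_diff[OF lin])

lemma \<Lambda>_cont: "continuous_on S \<Lambda>" "continuous_on S \<Lambda>'"
  unfolding \<Lambda>_def[abs_def] \<Lambda>'_def[abs_def]
  by (intro continuous_on_add linear_continuous_on bl continuous_on_const)+

lemma \<Lambda>_smooth: "open S \<Longrightarrow> smooth_on S \<Lambda>" "open S \<Longrightarrow> smooth_on S \<Lambda>'"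
  unfolding \<Lambda>_def[abs_def] \<Lambda>'_def[abs_def]
  by (intro smooth_add smooth_linear bl smooth_const; assumption)+

lemma \<Lambda>_inj: "inj \<Lambda>" by (metis \<Lambda>_simps(1) injI)

lemma \<Lambda>_image: "\<Lambda> ` S = \<Lambda>' -` S" 
  by (auto simp: image_iff) (metis \<Lambda>_simps(2))

lemma image_back: "\<Lambda>' ` \<Lambda> ` S = S" by (simp add: image_image)

lemma jet_image_iff: "jet (\<Lambda> ` M) (\<Lambda> p) (\<Phi> v) (\<Phi> a) \<longleftrightarrow> jet M p v a"
proof
  assume "jet (\<Lambda> ` M) (\<Lambda> p) (\<Phi> v) (\<Phi> a)"
  from jet_affine_image[OF bl(2) this, of "- \<Phi>' b"] show "jet M p v a"
    using image_back[of M] \<Lambda>_simps(1)[of p] unfolding \<Lambda>'_def[abs_def] by simp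
next
  assume "jet M p v a"
  from jet_affine_image[OF bl(1) this, of b] show "jet (\<Lambda> ` M) (\<Lambda> p) (\<Phi> v) (\<Phi> a)"
    unfolding \<Lambda>_def[abs_def] .
qed

lemma jet_image_iff': "jet (\<Lambda> ` M) (\<Lambda> p) v a \<longleftrightarrow> jet M p (\<Phi>' v) (\<Phi>' a)"
  using jet_image_iff[of M p "\<Phi>' v" "\<Phi>' a"] by simp

lemma tangent_space_image: "v \<in> tangent_space (\<Lambda> ` M) (\<Lambda> p) \<longleftrightarrow> \<Phi>' v \<in> tangent_space M p"
  unfolding tangent_space_jet jet_image_iff' by (metis inv_simps(1))

lemma space_like_image: assumes "space_like M" shows "space_like (\<Lambda> ` M)"
  unfolding space_like_def
proof (intro ballI impI)
  fix p' v assume "p' \<in> \<Lambda> ` M" and v: "v \<in> tangent_space (\<Lambda> ` M) p'" "v \<noteq> 0"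
  then obtain p where p: "p \<in> M" "p' = \<Lambda> p" by blast
  have "\<Phi>' v \<noteq> 0" using v(2) linear_0[OF lin] by (metis inv_simps(2))
  then have "pseudo_inner (\<Phi>' v) (\<Phi>' v) > 0"
    using assms p v(1) unfolding space_like_def p(2) tangent_space_image by blast
  then show "pseudo_inner v v > 0" by (simp add: iso')
qed

lemma smooth_submanifold_image: assumes "smooth_submanifold M" shows "smooth_submanifold (\<Lambda> ` M)"
  unfolding smooth_submanifold_def
proof
  fix p' assume "p' \<in> \<Lambda> ` M"
  then obtain p where p: "p \<in> M" "p' = \<Lambda> p" by blast
  from assms[unfolded smooth_submanifold_def, rule_format, OF p(1)]
  obtain U V and \<phi> \<psi> :: "(real^'m) \<times> (real^'n) \<Rightarrow> (real^'m) \<times> (real^'n)" where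
    U: "open U" "p \<in> U" "open V" and hom: "homeomorphism U V \<phi> \<psi>" and
    sm: "smooth_on U \<phi>" "smooth_on V \<psi>" and sl: "\<phi> ` (M \<inter> U) = {z \<in> V. snd z = 0}"
    by (elim exE conjE)
  have oU: "open (\<Lambda> ` U)"
    unfolding \<Lambda>_image using U(1) \<Lambda>_cont(2)[of UNIV] by (simp add: open_vimage)
  show "\<exists>U V (\<phi> :: (real^'m) \<times> (real^'n) \<Rightarrow> (real^'m) \<times> (real^'n)) \<psi>.
        open U \<and> p' \<in> U \<and> open V \<and> homeomorphism U V \<phi> \<psi> \<and>
        smooth_on U \<phi> \<and> smooth_on V \<psi> \<and> \<phi> ` (\<Lambda> ` M \<inter> U) = {z \<in> V. snd z = 0}"
  proof (rule exI[of _ "\<Lambda> ` U"], rule exI[of _ V], rule exI[of _ "\<lambda>q. \<phi> (\<Lambda>' q)"], rule exI[of _ "\<lambda>z. \<Lambda> (\<psi> z)"], intro conjI)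
    show "open (\<Lambda> ` U)" by fact
    show "p' \<in> \<Lambda> ` U" using p U by simp
    show "open V" by fact
    have "homeomorphism (\<Lambda> ` U) U \<Lambda>' \<Lambda>"
      by (rule homeomorphismI) (auto intro: \<Lambda>_cont)
    from homeomorphism_compose[OF this hom] show "homeomorphism (\<Lambda> ` U) V (\<lambda>q. \<phi> (\<Lambda>' q)) (\<lambda>z. \<Lambda> (\<psi> z))"
      by (simp add: o_def)
    show "smooth_on (\<Lambda> ` U) (\<lambda>q. \<phi> (\<Lambda>' q))"
      by (rule smooth_compose[OF oU U(1) _ sm(1) \<Lambda>_smooth(2)[OF oU]]) (simp add: image_back)
    show "smooth_on V (\<lambda>z. \<Lambda> (\<psi> z))"
      by (rule smooth_compose[OF U(3) open_UNIV _ \<Lambda>_smooth(1)[OF open_UNIV] sm(2)]) simp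
    have "\<Lambda> ` M \<inter> \<Lambda> ` U = \<Lambda> ` (M \<inter> U)" by (rule image_Int[OF \<Lambda>_inj, symmetric])
    then show "(\<lambda>q. \<phi> (\<Lambda>' q)) ` (\<Lambda> ` M \<inter> \<Lambda> ` U) = {z \<in> V. snd z = 0}"
      using sl by (simp add: image_image)
  qed
qed

end

lemma jet_param:
  fixes Y :: "'a::euclidean_space \<Rightarrow> 'b::euclidean_space"
  assumes S: "open S" and Y: "smooth_on S Y" and sub: "Y ` S \<subseteq> M" and x: "x \<in> S"
  shows "\<exists>a. jet M (Y x) (pd v Y x) a"
proof -
  define \<xi> where "\<xi> t = x + t *\<^sub>R v" for t :: real
  have \<xi>s: "smooth_on UNIV \<xi>"
    unfolding \<xi>_def by (intro smooth_add smooth_const smooth_linear bounded_linear_scaleR_left open_UNIV)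
  have "((\<lambda>t. t *\<^sub>R v) has_vector_derivative v) (at 0)"
    unfolding has_vector_derivative_def
    by (rule bounded_linear_imp_has_derivative) (rule bounded_linear_scaleR_left)
  from has_vector_derivative_add[OF has_vector_derivative_const[of x] this]
  have d1: "pd 1 \<xi> 0 = v" unfolding \<xi>_def by (intro pd_1_eq) simp
  obtain \<delta> where \<delta>: "0 < \<delta>" "\<xi> ` {-\<delta><..<\<delta>} \<subseteq> S"
  proof (rule curve_in_open[of 1 \<xi> S])
    show "continuous_on {-1<..<1} \<xi>" by (rule smooth_continuous[OF smooth_subset[OF \<xi>s]]) simp
    show "\<xi> 0 \<in> S" using x by (simp add: \<xi>_def)
  qed (use S in auto)
  let ?J = "{-\<delta><..<\<delta>}"
  have z: "0 \<in> ?J" using \<delta> by simp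
  have \<xi>: "smooth_on ?J \<xi>" by (rule smooth_subset[OF \<xi>s]) simp
  have sm: "smooth_on ?J (\<lambda>t. Y (\<xi> t))"
    by (rule smooth_compose[OF open_greaterThanLessThan S \<delta>(2) Y \<xi>])
  have im: "(\<lambda>t. Y (\<xi> t)) ` ?J \<subseteq> M"
    using image_mono[OF \<delta>(2), of Y] sub by (simp add: image_image)
  have x0: "\<xi> 0 = x" by (simp add: \<xi>_def)
  have "pd 1 (\<lambda>t. Y (\<xi> t)) 0 = pd v Y x"
    unfolding curve_derivatives(1)[OF S Y open_greaterThanLessThan \<xi> \<delta>(2) z] d1 x0 ..
  then show ?thesis
    unfolding jet_def using \<delta>(1) sm im x0 by (intro exI[of _ \<delta>] exI conjI) auto
qed

text \<open>
  A nonzero tangent vector cannot be vertical, as it would be time-like or null. Hence the first component of the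
  parametrization \<open>Y\<close>, inverse to a slice chart, is a local diffeomorphism, and its inverse turns
  \<open>Y\<close> into a graph.
\<close>

lemma local_graph:
  fixes M :: "((real^'m) \<times> (real^'n)) set"
  assumes M: "smooth_submanifold M" and sp: "space_like M" and p: "p \<in> M"
  obtains W r u where "open W" "p \<in> W" "r > 0" "smooth_on (ball (fst p) r) u"
    "M \<inter> W = graph_over (ball (fst p) r) u"
proof -
  from M[unfolded smooth_submanifold_def, rule_format, OF p]
  obtain U V and \<phi> \<psi> :: "(real^'m) \<times> (real^'n) \<Rightarrow> (real^'m) \<times> (real^'n)" where
    U: "open U" "p \<in> U" "open V" and hom: "homeomorphism U V \<phi> \<psi>" and
    sm: "smooth_on U \<phi>" "smooth_on V \<psi>" and sl: "\<phi> ` (M \<inter> U) = {z \<in> V. snd z = 0}"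
    by (elim exE conjE)
  have inv: "\<And>q. q \<in> U \<Longrightarrow> \<psi> (\<phi> q) = q" "\<And>z. z \<in> V \<Longrightarrow> \<phi> (\<psi> z) = z" "\<And>q. q \<in> U \<Longrightarrow> \<phi> q \<in> V"
    using hom by (auto simp: homeomorphism_def)
  define V0 where "V0 = (\<lambda>\<zeta>::real^'m. (\<zeta>, 0::real^'n)) -` V"
  have bl0: "bounded_linear (\<lambda>\<zeta>::real^'m. (\<zeta>, 0::real^'n))"
    by (intro bounded_linear_Pair bounded_linear_ident bounded_linear_zero)
  have oV0: "open V0" unfolding V0_def by (intro open_vimage U(3) linear_continuous_on bl0)
  define Y where "Y \<zeta> = \<psi> (\<zeta>, 0)" for \<zeta>
  have Ysm: "smooth_on V0 Y"
    unfolding Y_def by (rule smooth_compose[OF oV0 U(3) _ sm(2) smooth_linear[OF bl0]]) (auto simp: V0_def)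
  have sl0: "snd (\<phi> q) = 0" if "q \<in> M" "q \<in> U" for q
  proof -
    have "\<phi> q \<in> {z \<in> V. snd z = 0}" unfolding sl[symmetric] using that by blast
    then show ?thesis by simp
  qed
  have Y1: "fst (\<phi> q) \<in> V0" "Y (fst (\<phi> q)) = q" if "q \<in> M" "q \<in> U" for q
  proof -
    have e: "(fst (\<phi> q), 0) = \<phi> q" using sl0[OF that] by (simp add: prod_eq_iff)
    show "fst (\<phi> q) \<in> V0" using inv(3)[OF that(2)] by (simp add: V0_def e)
    show "Y (fst (\<phi> q)) = q" using inv(1)[OF that(2)] by (simp add: Y_def e)
  qed
  have Y2: "Y \<zeta> \<in> M" "Y \<zeta> \<in> U" "\<phi> (Y \<zeta>) = (\<zeta>, 0)" if "\<zeta> \<in> V0" for \<zeta>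
  proof -
    have v: "(\<zeta>, 0) \<in> V" using that by (simp add: V0_def)
    then have "(\<zeta>, 0) \<in> \<phi> ` (M \<inter> U)" unfolding sl by simp
    then obtain q where q: "q \<in> M" "q \<in> U" "(\<zeta>, 0) = \<phi> q" by blast
    then have "Y \<zeta> = q" by (simp add: Y_def inv)
    with q show "Y \<zeta> \<in> M" "Y \<zeta> \<in> U" "\<phi> (Y \<zeta>) = (\<zeta>, 0)" by simp_all
  qed
  define \<zeta>0 where "\<zeta>0 = fst (\<phi> p)"
  have z0: "\<zeta>0 \<in> V0" "Y \<zeta>0 = p" using Y1[OF p U(2)] by (simp_all add: \<zeta>0_def)
  define f where "f \<zeta> = fst (Y \<zeta>)" for \<zeta>
  have fsm: "smooth_on V0 f" unfolding f_def by (rule smooth_linear_comp[OF bounded_linear_fst oV0 Ysm])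
  have "v = 0" if "pd v f \<zeta>0 = 0" for v
  proof -
    have dY: "(Y has_derivative (\<lambda>v. pd v Y \<zeta>0)) (at \<zeta>0)" by (rule smooth_has_derivative[OF Ysm z0(1)])
    have "pd v f \<zeta>0 = fst (pd v Y \<zeta>0)"
      unfolding f_def by (rule pd_eq) (rule bounded_linear.has_derivative[OF bounded_linear_fst dY])
    then have f0: "fst (pd v Y \<zeta>0) = 0" using that by simp
    have Ysub: "Y ` V0 \<subseteq> M" using Y2(1) by (rule image_subsetI)
    have "pd v Y \<zeta>0 \<in> tangent_space M p"
      using jet_param[OF oV0 Ysm Ysub z0(1), of v] by (simp add: tangent_space_jet z0(2))
    moreover have "pseudo_inner (pd v Y \<zeta>0) (pd v Y \<zeta>0) \<le> 0" using f0 by (simp add: pseudo_inner_eq)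
    ultimately have Y0: "pd v Y \<zeta>0 = 0" using sp p unfolding space_like_def by (meson not_le)
    have d\<phi>: "\<phi> differentiable (at (Y \<zeta>0))" by (rule smooth_differentiable[OF sm(1) Y2(2)[OF z0(1)]])
    have "(v, 0::real^'n) = pd v (\<lambda>\<zeta>. (\<zeta>, 0)) \<zeta>0"
      by (rule pd_eq[symmetric]) (rule bounded_linear_imp_has_derivative[OF bl0])
    also have "\<dots> = pd v (\<lambda>\<zeta>. \<phi> (Y \<zeta>)) \<zeta>0"
      by (rule pd_cong_open(1)[OF oV0 z0(1)]) (simp add: Y2)
    also have "\<dots> = pd (pd v Y \<zeta>0) \<phi> (Y \<zeta>0)"
      by (rule pd_eq) (rule pd_comp[OF smooth_differentiable[OF Ysm z0(1)] d\<phi>])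
    also have "\<dots> = 0" by (simp add: Y0 pd_zero[OF d\<phi>])
    finally show ?thesis by (simp add: prod_eq_iff)
  qed
  from smooth_inverse_function[OF oV0 fsm z0(1) this]
  obtain U1 V1 g where U1: "open U1" "U1 \<subseteq> V0" "\<zeta>0 \<in> U1" "open V1" "f \<zeta>0 \<in> V1"
    and homf: "homeomorphism U1 V1 f g" and gsm: "smooth_on V1 g" by metis
  have f0: "f \<zeta>0 = fst p" by (simp add: f_def z0)
  obtain r where r: "r > 0" "ball (fst p) r \<subseteq> V1" using U1(4,5) f0 open_contains_ball by metis
  let ?B = "ball (fst p) r"
  have g: "g x \<in> U1" "f (g x) = x" if "x \<in> V1" for x using homf that by (auto simp: homeomorphism_def)
  have gf: "g (f \<zeta>) = \<zeta>" "f \<zeta> \<in> V1" if "\<zeta> \<in> U1" for \<zeta> using homf that by (auto simp: homeomorphism_def)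
  define u where "u x = snd (Y (g x))" for x
  have gB: "g ` ?B \<subseteq> V0" using g(1) r(2) U1(2) by blast
  have gsmB: "smooth_on ?B g" by (rule smooth_subset[OF gsm r(2)])
  have usm: "smooth_on ?B u"
    unfolding u_def
    by (rule smooth_linear_comp[OF bounded_linear_snd open_ball smooth_compose[OF open_ball oV0 gB Ysm gsmB]])
  have ogB: "open (g ` ?B)"
  proof -
    have "g ` ?B = U1 \<inter> f -` ?B" using g gf r(2) by (auto simp: image_iff) (metis gf(1) mem_ball)
    moreover have "open (U1 \<inter> f -` ?B)"
      by (rule continuous_open_preimage[OF _ U1(1) open_ball]) (use homf in \<open>simp add: homeomorphism_def\<close>)
    ultimately show ?thesis by simp
  qed
  define W where "W = U \<inter> (\<lambda>q. fst (\<phi> q)) -` (g ` ?B)"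
  have oW: "open W"
    unfolding W_def
    by (rule continuous_open_preimage[OF _ U(1) ogB]) (intro continuous_on_fst smooth_continuous[OF sm(1)])
  have Yg: "Y (g x) = (x, u x)" if "x \<in> ?B" for x
    using g(2)[of x] that r(2) by (auto simp: prod_eq_iff u_def f_def)
  have "p \<in> W"
  proof -
    have "fst (\<phi> p) = g (fst p)" using gf(1)[OF U1(3)] f0 by (simp add: \<zeta>0_def)
    then show ?thesis using U(2) r(1) by (auto simp: W_def)
  qed
  moreover have "M \<inter> W = graph_over ?B u"
  proof (rule set_eqI, rule iffI)
    fix q assume q: "q \<in> M \<inter> W"
    then obtain x where x: "x \<in> ?B" "fst (\<phi> q) = g x" by (auto simp: W_def)
    have "q = Y (fst (\<phi> q))" using q Y1(2)[of q] by (simp add: W_def)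
    also have "\<dots> = (x, u x)" by (simp add: x(2) Yg[OF x(1)])
    finally show "q \<in> graph_over ?B u" using x(1) by (simp add: graph_over_def)
  next
    fix q assume "q \<in> graph_over ?B u"
    then obtain x where x: "x \<in> ?B" "q = (x, u x)" by (auto simp: graph_over_def)
    then have q: "q = Y (g x)" using Yg by simp
    have gx: "g x \<in> V0" using gB x(1) by blast
    have "fst (\<phi> q) = g x" using Y2(3)[OF gx] by (simp add: q)
    moreover have "g x \<in> g ` ?B" using x(1) by (rule imageI)
    ultimately show "q \<in> M \<inter> W" using Y2(1,2)[OF gx] by (simp add: W_def q[symmetric])
  qed
  ultimately show ?thesis using that[OF oW _ r(1) usm] by blast
qed

section \<open>The extremal equation in jet form\<close>

lemma pd_diff: "f differentiable (at x) \<Longrightarrow> pd (v - w) f x = pd v f x - pd w f x"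
  using linear_diff[OF pd_linear] by blast

text \<open>
  Since \<^const>\<open>normal_component\<close> is a definite description, existence and uniqueness have to be shown. After a
  boost that makes the space horizontal, the normal component is the vertical one.
\<close>

lemma normal_component_complement:
  fixes L :: "real^'m \<Rightarrow> real^'n"
  assumes L: "linear L" and contr: "\<And>v. v \<noteq> 0 \<Longrightarrow> norm (L v) < norm v"
  defines "T \<equiv> range (\<lambda>v. (v, L v))"
  shows "w - normal_component T w \<in> T"
proof -
  obtain \<Phi> :: "(real^'m) \<times> (real^'n) \<Rightarrow> (real^'m) \<times> (real^'n)" where \<Phi>: "linear \<Phi>" "bij \<Phi>" "\<And>p q. pseudo_inner (\<Phi> p) (\<Phi> q) = pseudo_inner p q"
    "\<And>v. snd (\<Phi> (v, L v)) = 0" "\<And>p. snd (\<Phi> p) = 0 \<Longrightarrow> snd p = L (fst p)"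
    by (rule boost_exists[OF L contr], assumption, rule that)
  have T_iff: "p \<in> T \<longleftrightarrow> snd (\<Phi> p) = 0" for p
  proof
    assume "snd (\<Phi> p) = 0"
    from \<Phi>(5)[OF this] have "p = (fst p, L (fst p))" by (metis prod.collapse)
    then show "p \<in> T" unfolding T_def by (rule range_eqI)
  qed (auto simp: T_def \<Phi>(4))
  obtain t where t: "\<Phi> t = (fst (\<Phi> w), 0)"
    using surjD[OF bij_is_surj[OF \<Phi>(2)], of "(fst (\<Phi> w), 0)"] by metis
  define n where "n = w - t"
  have n: "\<Phi> n = (0, snd (\<Phi> w))" by (simp add: n_def linear_diff[OF \<Phi>(1)] t prod_eq_iff)
  have P: "w - n \<in> T \<and> (\<forall>u\<in>T. pseudo_inner n u = 0)"
  proof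
    show "w - n \<in> T" by (simp add: n_def T_iff t)
    show "\<forall>u\<in>T. pseudo_inner n u = 0"
    proof
      fix u assume "u \<in> T"
      then have "pseudo_inner (\<Phi> n) (\<Phi> u) = 0" by (simp add: T_iff n pseudo_inner_eq)
      then show "pseudo_inner n u = 0" by (simp add: \<Phi>(3))
    qed
  qed
  have uniq: "n' = n" if n': "w - n' \<in> T \<and> (\<forall>u\<in>T. pseudo_inner n' u = 0)" for n'
  proof -
    have "snd (\<Phi> (n' - n)) = snd (\<Phi> ((w - n) - (w - n')))" by simp
    also have "\<dots> = 0" using P n' unfolding T_iff linear_diff[OF \<Phi>(1), of "w - n" "w - n'"] by simp
    finally have d: "n' - n \<in> T" "snd (\<Phi> (n' - n)) = 0" unfolding T_iff by simp_all
    have "pseudo_inner (n' - n) (n' - n) = pseudo_inner n' (n' - n) - pseudo_inner n (n' - n)"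
      by (simp only: pseudo_inner_bilinear)
    also have "\<dots> = 0" using P n' d(1) by simp
    finally have "pseudo_inner (\<Phi> (n' - n)) (\<Phi> (n' - n)) = 0" by (simp add: \<Phi>(3))
    then have "\<Phi> (n' - n) = \<Phi> 0" using d(2) by (simp add: pseudo_inner_eq prod_eq_iff linear_0[OF \<Phi>(1)])
    from injD[OF bij_is_inj[OF \<Phi>(2)] this] show ?thesis by simp
  qed
  have "normal_component T w = n" unfolding normal_component_def by (rule the_equality, rule P, rule uniq)
  then show ?thesis using P by simp
qed

text \<open>
  Vanishing mean curvature, in terms of jets: for curves with orthonormal velocities, the sum of the accelerations
  has no normal part.
\<close>

definition extremal_at :: "((real^'m) \<times> (real^'n)) set \<Rightarrow> (real^'m) \<times> (real^'n) \<Rightarrow> bool" where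
  "extremal_at M p \<longleftrightarrow> (\<exists>E :: 'm \<Rightarrow> (real^'m) \<times> (real^'n). (\<forall>i. E i \<in> tangent_space M p) \<and>
     (\<forall>i j. pseudo_inner (E i) (E j) = (if i = j then 1 else 0)) \<and>
     (\<forall>a. (\<forall>i. jet M p (E i) (a i)) \<longrightarrow> (\<Sum>i\<in>UNIV. a i) \<in> tangent_space M p))"

text \<open>
  The derivative of a tangent field along a curve and the acceleration of a curve with the same velocity differ
  by a tangent vector, because \<open>D\<^sup>2u\<close> enters both in the same way. So the second fundamental form, defined by
  fields, can be read off from jets.
\<close>

lemma frame_derivative_jet:
  fixes u :: "real^'m \<Rightarrow> real^'n"
  assumes B: "open B" "smooth_on B u" and W: "open W" "M \<inter> W = graph_over B u" and x: "x \<in> B"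
    and e: "open U" "smooth_on U e" "\<And>q. q \<in> M \<inter> U \<Longrightarrow> e q \<in> tangent_space M q" and pU: "(x, u x) \<in> U"
    and a: "jet M (x, u x) (e (x, u x)) a"
  shows "pd (e (x, u x)) e (x, u x) - a \<in> tangent_space M (x, u x)"
proof -
  let ?p = "(x, u x)"
  from a obtain \<epsilon> :: real and \<gamma> where e0: "\<epsilon> > 0" and g: "smooth_on {-\<epsilon><..<\<epsilon>} \<gamma>" "\<gamma> ` {-\<epsilon><..<\<epsilon>} \<subseteq> M"
    "\<gamma> 0 = ?p" "pd 1 \<gamma> 0 = e ?p" "pd 1 (pd 1 \<gamma>) 0 = a" by (rule jetE)
  have pW: "?p \<in> W" using W x by (auto simp: graph_over_def)
  obtain \<delta> where \<delta>: "0 < \<delta>" "\<delta> \<le> \<epsilon>" "\<gamma> ` {-\<delta><..<\<delta>} \<subseteq> W \<inter> U"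
    by (rule curve_in_open[OF e0 smooth_continuous[OF g(1)] open_Int[OF W(1) e(1)]]) (use g(3) pW pU in auto)
  let ?J = "{-\<delta><..<\<delta>}"
  have z: "0 \<in> ?J" "0 \<in> {-\<epsilon><..<\<epsilon>}" using \<delta> e0 by simp_all
  define \<xi> where "\<xi> t = fst (\<gamma> t)" for t
  define \<omega> where "\<omega> t = fst (e (\<gamma> t))" for t
  have gJ: "\<gamma> t \<in> M" "\<gamma> t \<in> W" "\<gamma> t \<in> U" if "t \<in> ?J" for t
    using that \<delta> g(2) by (auto simp: image_subset_iff)
  have eq: "\<gamma> t = (\<xi> t, u (\<xi> t)) \<and> \<xi> t \<in> B" if "t \<in> ?J" for t
  proof -
    have "\<gamma> t \<in> graph_over B u" unfolding W(2)[symmetric] using gJ[OF that] by simp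
    then show ?thesis by (auto simp: graph_over_def \<xi>_def)
  qed
  have ew: "snd (e (\<gamma> t)) = pd (\<omega> t) u (\<xi> t)" if "t \<in> ?J" for t
  proof -
    have "e (\<gamma> t) \<in> tangent_space M (\<gamma> t)" using e(3) gJ[OF that] by simp
    also have "tangent_space M (\<gamma> t) = range (\<lambda>v. (v, pd v u (\<xi> t)))"
      using eq[OF that] tangent_space_graph[OF B W, of "\<xi> t"] by simp
    finally show ?thesis by (auto simp: \<omega>_def)
  qed
  define D where "D = pd (e ?p) e ?p"
  have DD: "((\<lambda>t. e (\<gamma> t)) has_derivative (\<lambda>h. pd (pd h \<gamma> 0) e (\<gamma> 0))) (at 0)"
    by (rule pd_comp[OF smooth_differentiable[OF g(1) z(2)]]) (use g(3) pU in \<open>simp add: smooth_differentiable[OF e(2)]\<close>)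
  have "pd 1 (\<lambda>t. e (\<gamma> t)) 0 = D" using pd_eq[OF DD, of 1] by (simp add: g D_def)
  then have De: "((\<lambda>t. e (\<gamma> t)) has_vector_derivative D) (at 0)"
    using has_vector_derivative_pd[OF Derivative.differentiableI[OF DD]] by simp
  have d\<gamma>: "(\<gamma> has_vector_derivative e ?p) (at 0)"
    using has_vector_derivative_pd[OF smooth_differentiable[OF g(1) z(2)]] g(4) by simp
  have d\<xi>: "(\<xi> has_vector_derivative fst (e ?p)) (at 0)"
    unfolding \<xi>_def by (rule bounded_linear.has_vector_derivative[OF bounded_linear_fst d\<gamma>])
  have d\<omega>: "(\<omega> has_vector_derivative fst D) (at 0)"
    unfolding \<omega>_def by (rule bounded_linear.has_vector_derivative[OF bounded_linear_fst De])
  have x0: "\<xi> 0 = x" "\<omega> 0 = fst (e ?p)" by (simp_all add: \<xi>_def \<omega>_def g)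
  have xB: "\<xi> 0 \<in> B" using x by (simp add: x0)
  let ?v = "fst (e ?p)"
  have "((\<lambda>t. pd (\<omega> t) u (\<xi> t)) has_vector_derivative pd (fst D) u x + pd ?v (pd ?v u) x) (at 0)"
    using pd_along[OF B xB d\<xi> d\<omega>] by (simp add: x0)
  then have "((\<lambda>t. snd (e (\<gamma> t))) has_vector_derivative pd (fst D) u x + pd ?v (pd ?v u) x) (at 0)"
    by (rule has_vector_derivative_transform_within_open[OF _ open_greaterThanLessThan z(1)]) (rule ew[symmetric])
  moreover have "((\<lambda>t. snd (e (\<gamma> t))) has_vector_derivative snd D) (at 0)"
    by (rule bounded_linear.has_vector_derivative[OF bounded_linear_snd De])
  ultimately have sD: "snd D = pd (fst D) u x + pd ?v (pd ?v u) x" by (rule vector_derivative_unique_at[rotated])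
  from a obtain v c where vc: "e ?p = (v, pd v u x)" "a = (c, pd v (pd v u) x + pd c u x)"
    unfolding jet_graph[OF B W x] by blast
  have "D - a = (fst D - c, pd (fst D - c) u x)"
    using vc sD by (simp add: prod_eq_iff pd_diff[OF smooth_differentiable[OF B(2) x]])
  then show ?thesis unfolding tangent_space_graph[OF B W x] D_def[symmetric] by (rule range_eqI)
qed

lemma extremal_atI:
  fixes M :: "((real^'m) \<times> (real^'n)) set"
  assumes M: "smooth_submanifold M" "space_like M" and p: "p \<in> M" and H: "has_mean_curvature_vector M p 0"
  shows "extremal_at M p"
proof -
  obtain W r u where W: "open W" and pW: "p \<in> W" and r: "r > 0" and u: "smooth_on (ball (fst p) r) u"
    and G: "M \<inter> W = graph_over (ball (fst p) r) u" using local_graph[OF M p] by blast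
  let ?B = "ball (fst p) r"
  have "p \<in> graph_over ?B u" unfolding G[symmetric] using p pW by simp
  then obtain x where x: "x \<in> ?B" "p = (x, u x)" by (auto simp: graph_over_def)
  note T = tangent_space_graph[OF open_ball u W G x(1), folded x(2)]
  have dux: "u differentiable (at x)" by (rule smooth_differentiable[OF u x(1)])
  from H obtain U e where fr: "orthonormal_tangent_frame M U e" and pU: "p \<in> U"
    and sum0: "0 = (1 / real CARD('m)) *\<^sub>R (\<Sum>i\<in>UNIV. second_fundamental_form M (e i) (e i) p)"
    unfolding has_mean_curvature_vector_def by blast
  have U: "open U" and tf: "\<And>i. smooth_on U (e i)" "\<And>i q. q \<in> M \<inter> U \<Longrightarrow> e i q \<in> tangent_space M q"
    and on: "\<And>i j. pseudo_inner (e i p) (e j p) = (if i = j then 1 else 0)"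
    using fr p pU by (auto simp: orthonormal_tangent_frame_def tangent_field_def)
  define n where "n i = second_fundamental_form M (e i) (e i) p" for i
  define D where "D i = pd (e i p) (e i) p" for i
  have contr: "norm (pd v u x) < norm v" if "v \<noteq> 0" for v
    by (rule space_like_graph[OF open_ball u W G x(1) M(2) that])
  have nD: "D i - n i \<in> tangent_space M p" for i
    using normal_component_complement[OF pd_linear[OF dux] contr, of "D i"]
    by (simp add: n_def D_def second_fundamental_form_def flat_connection_def pd_def[symmetric] T)
  have sumn: "(\<Sum>i\<in>UNIV. n i) = 0" using sum0 by (simp add: n_def)
  have T_iff: "w \<in> tangent_space M p \<longleftrightarrow> snd w = pd (fst w) u x" for w
    unfolding T by (auto simp: prod_eq_iff)
  have sub: "subspace (tangent_space M p)"
    by (rule subspaceI) (simp_all add: T_iff pd_zero[OF dux] pd_plus[OF dux] pd_scale[OF dux])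
  show ?thesis
    unfolding extremal_at_def
  proof (intro exI[of _ "\<lambda>i. e i p"] conjI allI impI)
    fix i show "e i p \<in> tangent_space M p" using tf(2) p pU by blast
  next
    fix i j show "pseudo_inner (e i p) (e j p) = (if i = j then 1 else 0)" by (rule on)
  next
    fix a assume a: "\<forall>i. jet M p (e i p) (a i)"
    have Da: "D i - a i \<in> tangent_space M p" for i
      using frame_derivative_jet[OF open_ball u W G x(1) U tf(1) tf(2), of i "a i"] a pU
      by (simp add: x(2)[symmetric] D_def)
    have "(\<Sum>i\<in>UNIV. (D i - n i) - (D i - a i)) \<in> tangent_space M p"
      by (intro subspace_sum sub subspace_diff nD Da)
    moreover have "(\<Sum>i\<in>UNIV. (D i - n i) - (D i - a i)) = (\<Sum>i\<in>UNIV. a i)"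
      using sumn by (simp add: sum_subtractf)
    ultimately show "(\<Sum>i\<in>UNIV. a i) \<in> tangent_space M p" by simp
  qed
qed

lemma (in pseudo_isometry) extremal_at_image:
  assumes "extremal_at M p" shows "extremal_at (\<Lambda> ` M) (\<Lambda> p)"
proof -
  from assms obtain E :: "'m \<Rightarrow> _" where E: "\<And>i. E i \<in> tangent_space M p"
    "\<And>i j. pseudo_inner (E i) (E j) = (if i = j then 1 else 0)"
    "\<And>a. (\<And>i. jet M p (E i) (a i)) \<Longrightarrow> (\<Sum>i\<in>UNIV. a i) \<in> tangent_space M p"
    unfolding extremal_at_def by blast
  show ?thesis
    unfolding extremal_at_def
  proof (intro exI[of _ "\<lambda>i. \<Phi> (E i)"] conjI allI impI)
    show "\<Phi> (E i) \<in> tangent_space (\<Lambda> ` M) (\<Lambda> p)" for i by (simp add: tangent_space_image E)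
    show "pseudo_inner (\<Phi> (E i)) (\<Phi> (E j)) = (if i = j then 1 else 0)" for i j by (simp add: iso E)
    fix a :: "'m \<Rightarrow> _" assume "\<forall>i. jet (\<Lambda> ` M) (\<Lambda> p) (\<Phi> (E i)) (a i)"
    then have "\<And>i. jet M p (E i) (\<Phi>' (a i))" by (simp add: jet_image_iff')
    from E(3)[OF this] show "(\<Sum>i\<in>UNIV. a i) \<in> tangent_space (\<Lambda> ` M) (\<Lambda> p)"
      by (simp add: tangent_space_image linear_sum[OF lin'])
  qed
qed

text \<open>
  The choice \<open>c = 0\<close> of accelerations makes their sum vertical; being tangent to a graph, it vanishes. The
  outcome is the extremal equation \<open>g\<^sup>i\<^sup>j u\<^sub>i\<^sub>j = 0\<close>, since \<open>\<Sum>a\<^sub>i a\<^sub>i\<^sup>T\<close> is the inverse of the induced metric.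
\<close>

lemma extremal_graph_equation:
  fixes u :: "real^'m \<Rightarrow> real^'n"
  assumes B: "open B" "smooth_on B u" and W: "open W" "M \<inter> W = graph_over B u" and x: "x \<in> B"
    and ex: "extremal_at M (x, u x)"
  shows "\<exists>a :: 'm \<Rightarrow> real^'m. (\<forall>i j. a i \<bullet> a j - pd (a i) u x \<bullet> pd (a j) u x = (if i = j then 1 else 0)) \<and>
     (\<Sum>i\<in>UNIV. pd (a i) (pd (a i) u) x) = 0"
proof -
  note T = tangent_space_graph[OF B W x]
  have dux: "u differentiable (at x)" by (rule smooth_differentiable[OF B(2) x])
  from ex obtain E :: "'m \<Rightarrow> _" where E: "\<And>i. E i \<in> tangent_space M (x, u x)"
    "\<And>i j. pseudo_inner (E i) (E j) = (if i = j then 1 else 0)"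
    "\<And>a. (\<And>i. jet M (x, u x) (E i) (a i)) \<Longrightarrow> (\<Sum>i\<in>UNIV. a i) \<in> tangent_space M (x, u x)"
    unfolding extremal_at_def by blast
  define a where "a i = fst (E i)" for i
  have Ea: "E i = (a i, pd (a i) u x)" for i using E(1)[of i] by (auto simp: T a_def)
  have "jet M (x, u x) (E i) (0, pd (a i) (pd (a i) u) x)" for i
    unfolding jet_graph[OF B W x] using Ea[of i] pd_zero[OF dux]
    by (intro exI[of _ "a i"] exI[of _ 0]) simp
  from E(3)[OF this] have "(\<Sum>i\<in>UNIV. (0, pd (a i) (pd (a i) u) x)) \<in> tangent_space M (x, u x)" .
  moreover have "(\<Sum>i\<in>UNIV. (0 :: real^'m, pd (a i) (pd (a i) u) x)) = (0, \<Sum>i\<in>UNIV. pd (a i) (pd (a i) u) x)"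
    by (simp add: sum_prod)
  ultimately have "(0, \<Sum>i\<in>UNIV. pd (a i) (pd (a i) u) x) \<in> range (\<lambda>v. (v, pd v u x))" by (simp add: T)
  then have s: "(\<Sum>i\<in>UNIV. pd (a i) (pd (a i) u) x) = 0" using pd_zero[OF dux] by auto
  have "a i \<bullet> a j - pd (a i) u x \<bullet> pd (a j) u x = (if i = j then 1 else 0)" for i j
    using E(2)[of i j] by (simp add: Ea pseudo_inner_eq)
  with s show ?thesis by blast
qed

text \<open>
  An isometry moves \<open>p\<close> to \<open>0\<close> and its tangent space to \<open>real^'m \<times> {0}\<close>. Near \<open>0\<close> the image of \<open>M\<close> is the
  graph of a function \<open>u\<close> with \<open>u 0 = 0\<close> and \<open>Du 0 = 0\<close>, for which the induced metric is Euclidean up to second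
  order. The last conclusion matches the jets of \<open>M\<close> with those of the graph.
\<close>

theorem tangential_normal_form:
  fixes M :: "((real^'m) \<times> (real^'n)) set"
  assumes M: "smooth_submanifold M" "space_like M" "extremal M" and p: "p \<in> M"
  obtains \<Phi> :: "(real^'m) \<times> (real^'n) \<Rightarrow> (real^'m) \<times> (real^'n)" and r and u :: "real^'m \<Rightarrow> real^'n" where
    "linear \<Phi>" "bij \<Phi>" "\<And>p q. pseudo_inner (\<Phi> p) (\<Phi> q) = pseudo_inner p q"
    "r > 0" "smooth_on (ball 0 r) u" "u 0 = 0" "\<And>v. pd v u 0 = 0"
    "\<And>x. x \<in> ball 0 r \<Longrightarrow> \<exists>a :: 'm \<Rightarrow> real^'m.
       (\<forall>i j. a i \<bullet> a j - pd (a i) u x \<bullet> pd (a j) u x = (if i = j then 1 else 0)) \<and>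
       (\<Sum>i\<in>UNIV. pd (a i) (pd (a i) u) x) = 0"
    "\<And>x. x \<in> ball 0 r \<Longrightarrow> \<exists>q\<in>M. \<Phi> (q - p) = (x, u x) \<and>
       (\<forall>V A. jet M q V A \<longleftrightarrow> (\<exists>v c. \<Phi> V = (v, pd v u x) \<and> \<Phi> A = (c, pd v (pd v u) x + pd c u x)))"
proof -
  obtain W0 r0 u0 where W0: "open W0" and pW0: "p \<in> W0" and r0: "r0 > 0" and u0: "smooth_on (ball (fst p) r0) u0"
    and G0: "M \<inter> W0 = graph_over (ball (fst p) r0) u0" using local_graph[OF M(1,2) p] by blast
  have "p \<in> graph_over (ball (fst p) r0) u0" unfolding G0[symmetric] using p pW0 by simp
  then obtain x0 where x0: "x0 \<in> ball (fst p) r0" "p = (x0, u0 x0)" by (auto simp: graph_over_def)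
  have T0: "tangent_space M p = range (\<lambda>v. (v, pd v u0 x0))"
    using tangent_space_graph[OF open_ball u0 W0 G0 x0(1)] by (simp add: x0(2))
  obtain \<Phi> :: "(real^'m) \<times> (real^'n) \<Rightarrow> (real^'m) \<times> (real^'n)" where \<Phi>: "linear \<Phi>" "bij \<Phi>" "\<And>p q. pseudo_inner (\<Phi> p) (\<Phi> q) = pseudo_inner p q"
    "\<And>v. snd (\<Phi> (v, pd v u0 x0)) = 0" "\<And>p. snd (\<Phi> p) = 0 \<Longrightarrow> snd p = pd (fst p) u0 x0"
    by (rule boost_exists[OF pd_linear[OF smooth_differentiable[OF u0 x0(1)]]
        space_like_graph[OF open_ball u0 W0 G0 x0(1) M(2)]], assumption, rule that)
  interpret pseudo_isometry \<Phi> "- \<Phi> p" by (rule pseudo_isometry.intro[OF \<Phi>(1-3)])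
  have \<Lambda>: "\<Lambda> q = \<Phi> (q - p)" for q by (simp add: \<Lambda>_def linear_diff[OF \<Phi>(1)])
  have \<Lambda>p: "\<Lambda> p = 0" by (simp add: \<Lambda> linear_0[OF \<Phi>(1)])
  have M': "smooth_submanifold (\<Lambda> ` M)" "space_like (\<Lambda> ` M)" "0 \<in> \<Lambda> ` M"
    using smooth_submanifold_image[OF M(1)] space_like_image[OF M(2)] p \<Lambda>p by force+
  obtain W r u where W: "open W" and zW: "0 \<in> W" and r: "r > 0" and u: "smooth_on (ball 0 r) u"
    and G: "\<Lambda> ` M \<inter> W = graph_over (ball 0 r) u"
    using local_graph[OF M'] unfolding fst_zero by blast
  let ?B = "ball (0 :: real^'m) r"
  have zB: "0 \<in> ?B" using r by simp
  have "0 \<in> graph_over ?B u" unfolding G[symmetric] using M'(3) zW by simp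
  then have u00: "u 0 = 0" by (auto simp: graph_over_def zero_prod_def)
  have du: "pd v u 0 = 0" for v
  proof -
    have "(v, pd v u 0) \<in> tangent_space (\<Lambda> ` M) (\<Lambda> p)"
      using tangent_space_graph[OF open_ball u W G zB] by (simp add: \<Lambda>p u00 zero_prod_def)
    then have "\<Phi>' (v, pd v u 0) \<in> tangent_space M p" by (simp add: tangent_space_image)
    then obtain w where "\<Phi>' (v, pd v u 0) = (w, pd w u0 x0)" unfolding T0 by blast
    then have "(v, pd v u 0) = \<Phi> (w, pd w u0 x0)" by (metis inv_simps(2))
    then show ?thesis using \<Phi>(4)[of w] by (metis snd_conv)
  qed
  have q: "\<exists>q\<in>M. \<Lambda> q = (x, u x)" if "x \<in> ?B" for x
  proof -
    have "(x, u x) \<in> graph_over ?B u" using that by (simp add: graph_over_def)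
    then have "(x, u x) \<in> \<Lambda> ` M" unfolding G[symmetric] by simp
    then show ?thesis by (metis imageE)
  qed
  show ?thesis
  proof (rule that[OF \<Phi>(1-3) r u u00 du])
    fix x :: "real^'m" assume x: "x \<in> ball 0 r"
    from q[OF x] obtain q where q: "q \<in> M" "\<Lambda> q = (x, u x)" by blast
    have "extremal_at M q"
      by (rule extremal_atI[OF M(1,2) q(1)]) (use M(3) q(1) in \<open>simp add: extremal_def\<close>)
    from extremal_at_image[OF this] have "extremal_at (\<Lambda> ` M) (x, u x)" by (simp add: q(2))
    from extremal_graph_equation[OF open_ball u W G x this]
    show "\<exists>a :: 'm \<Rightarrow> real^'m.
       (\<forall>i j. a i \<bullet> a j - pd (a i) u x \<bullet> pd (a j) u x = (if i = j then 1 else 0)) \<and>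
       (\<Sum>i\<in>UNIV. pd (a i) (pd (a i) u) x) = 0" .
    have "jet M q V A \<longleftrightarrow> jet (\<Lambda> ` M) (x, u x) (\<Phi> V) (\<Phi> A)" for V A
      using jet_image_iff[of M q V A] by (simp add: q(2))
    then show "\<exists>q\<in>M. \<Phi> (q - p) = (x, u x) \<and>
       (\<forall>V A. jet M q V A \<longleftrightarrow> (\<exists>v c. \<Phi> V = (v, pd v u x) \<and> \<Phi> A = (c, pd v (pd v u) x + pd c u x)))"
      using q \<Lambda>[of q] by (intro bexI[of _ q]) (simp_all add: jet_graph[OF open_ball u W G x])
  qed
qed

section \<open>Second-order Taylor data in one variable\<close>

text \<open>
  \<open>a\<close>, \<open>b\<close>, \<open>c\<close> are the values at \<open>0\<close> of \<open>f\<close> and its first two derivatives. The rules that follow differentiate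
  composite expressions twice, at \<open>0\<close> only.
\<close>

definition jet2 :: "(real \<Rightarrow> 'a::real_normed_vector) \<Rightarrow> 'a \<Rightarrow> 'a \<Rightarrow> 'a \<Rightarrow> bool" where
  "jet2 f a b c \<longleftrightarrow> f 0 = a \<and> (\<exists>f'. (\<forall>\<^sub>F t in nhds 0. (f has_vector_derivative f' t) (at t)) \<and>
     f' 0 = b \<and> (f' has_vector_derivative c) (at 0))"

lemma jet2I:
  assumes "f 0 = a" "\<forall>\<^sub>F t in nhds 0. (f has_vector_derivative f' t) (at t)" "f' 0 = b"
    "(f' has_vector_derivative c) (at 0)"
  shows "jet2 f a b c"
  using assms unfolding jet2_def by blast

lemma jet2E:
  assumes "jet2 f a b c"
  obtains f' where "f 0 = a" "\<forall>\<^sub>F t in nhds 0. (f has_vector_derivative f' t) (at t)" "f' 0 = b"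
    "(f' has_vector_derivative c) (at 0)" "(f has_vector_derivative b) (at 0)"
proof -
  from assms obtain f' where f': "f 0 = a" "\<forall>\<^sub>F t in nhds 0. (f has_vector_derivative f' t) (at t)" "f' 0 = b"
    "(f' has_vector_derivative c) (at 0)" unfolding jet2_def by blast
  have "(f has_vector_derivative f' 0) (at 0)" by (rule eventually_nhds_x_imp_x[OF f'(2)])
  with f' show ?thesis using that by simp
qed

lemma jet2_const: "jet2 (\<lambda>t. c) c 0 0"
  by (rule jet2I[where f' = "\<lambda>t. 0"]) auto

lemma jet2_id: "jet2 (\<lambda>t. t) 0 1 0"
  by (rule jet2I[where f' = "\<lambda>t. 1"]) (auto intro!: always_eventually)

lemma jet2_add:
  assumes "jet2 f a b c" "jet2 g a' b' c'"
  shows "jet2 (\<lambda>t. f t + g t) (a + a') (b + b') (c + c')"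
proof -
  obtain f' where f: "f 0 = a" "\<forall>\<^sub>F t in nhds 0. (f has_vector_derivative f' t) (at t)" "f' 0 = b"
    "(f' has_vector_derivative c) (at 0)" using assms(1) by (rule jet2E)
  obtain g' where g: "g 0 = a'" "\<forall>\<^sub>F t in nhds 0. (g has_vector_derivative g' t) (at t)" "g' 0 = b'"
    "(g' has_vector_derivative c') (at 0)" using assms(2) by (rule jet2E)
  show ?thesis
  proof (rule jet2I)
    show "\<forall>\<^sub>F t in nhds 0. ((\<lambda>t. f t + g t) has_vector_derivative f' t + g' t) (at t)"
      using f(2) g(2) by eventually_elim (rule has_vector_derivative_add)
  qed (use f g in \<open>auto intro: has_vector_derivative_add\<close>)
qed

lemma jet2_bilinear:
  assumes p: "bounded_bilinear p" and "jet2 f a b c" "jet2 g a' b' c'"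
  shows "jet2 (\<lambda>t. p (f t) (g t)) (p a a') (p a b' + p b a') (p a c' + 2 *\<^sub>R p b b' + p c a')"
proof -
  obtain f' where f: "f 0 = a" "\<forall>\<^sub>F t in nhds 0. (f has_vector_derivative f' t) (at t)" "f' 0 = b"
    "(f' has_vector_derivative c) (at 0)" "(f has_vector_derivative b) (at 0)" using assms(2) by (rule jet2E)
  obtain g' where g: "g 0 = a'" "\<forall>\<^sub>F t in nhds 0. (g has_vector_derivative g' t) (at t)" "g' 0 = b'"
    "(g' has_vector_derivative c') (at 0)" "(g has_vector_derivative b') (at 0)" using assms(3) by (rule jet2E)
  note pr = bounded_bilinear.has_vector_derivative[OF p]
  show ?thesis
  proof (rule jet2I)
    show "\<forall>\<^sub>F t in nhds 0. ((\<lambda>t. p (f t) (g t)) has_vector_derivative p (f t) (g' t) + p (f' t) (g t)) (at t)"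
      using f(2) g(2) by eventually_elim (rule pr)
    have "((\<lambda>t. p (f t) (g' t) + p (f' t) (g t)) has_vector_derivative
       (p (f 0) c' + p b (g' 0)) + (p (f' 0) b' + p c (g 0))) (at 0)"
      by (intro has_vector_derivative_add pr f g)
    then show "((\<lambda>t. p (f t) (g' t) + p (f' t) (g t)) has_vector_derivative p a c' + 2 *\<^sub>R p b b' + p c a') (at 0)"
      by (simp add: f g scaleR_2 algebra_simps)
  qed (simp_all add: f g)
qed

lemma jet2_eq: "jet2 f a b c \<Longrightarrow> a = a' \<Longrightarrow> b = b' \<Longrightarrow> c = c' \<Longrightarrow> jet2 f a' b' c'" by simp

lemma jet2_scaleR: "jet2 f a b c \<Longrightarrow> jet2 (\<lambda>t. k *\<^sub>R f t) (k *\<^sub>R a) (k *\<^sub>R b) (k *\<^sub>R c)"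
  by (rule jet2_eq[OF jet2_bilinear[OF bounded_bilinear_scaleR jet2_const]]) auto

lemma jet2_mult: "jet2 f a b c \<Longrightarrow> jet2 g a' b' c' \<Longrightarrow>
    jet2 (\<lambda>t. f t * g t :: real) (a * a') (a * b' + b * a') (a * c' + 2 * (b * b') + c * a')"
  by (rule jet2_eq[OF jet2_bilinear[OF bounded_bilinear_mult]]) auto

lemma jet2_cmult: "jet2 f a b c \<Longrightarrow> jet2 (\<lambda>t. k * f t :: real) (k * a) (k * b) (k * c)"
  using jet2_scaleR[of f a b c k] by simp

lemma jet2_diff: "jet2 f a b c \<Longrightarrow> jet2 g a' b' c' \<Longrightarrow> jet2 (\<lambda>t. f t - g t) (a - a') (b - b') (c - c')"
  using jet2_add[of f a b c "\<lambda>t. (-1) *\<^sub>R g t" "(-1) *\<^sub>R a'" "(-1) *\<^sub>R b'" "(-1) *\<^sub>R c'"] jet2_scaleR[of g a' b' c' "-1"]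
  by simp

lemma jet2_times_id: "jet2 f a b c \<Longrightarrow> jet2 (\<lambda>t. t *\<^sub>R f t) 0 a (2 *\<^sub>R b)"
  by (rule jet2_eq[OF jet2_bilinear[OF bounded_bilinear_scaleR jet2_id]]) auto

lemma jet2_inner: "jet2 f a b c \<Longrightarrow> jet2 g a' b' c' \<Longrightarrow>
    jet2 (\<lambda>t. f t \<bullet> g t) (a \<bullet> a') (a \<bullet> b' + b \<bullet> a') (a \<bullet> c' + 2 * (b \<bullet> b') + c \<bullet> a')"
  by (rule jet2_eq[OF jet2_bilinear[OF bounded_bilinear_inner]]) auto

lemma jet2_norm2: "jet2 f a b c \<Longrightarrow> jet2 (\<lambda>t. (norm (f t))\<^sup>2) ((norm a)\<^sup>2) (2 * (a \<bullet> b)) (2 * (norm b)\<^sup>2 + 2 * (a \<bullet> c))"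
  unfolding power2_norm_eq_inner
  by (rule jet2_eq[OF jet2_inner]) (auto simp: inner_commute)

lemma jet2_sum: "finite I \<Longrightarrow> (\<And>i. i \<in> I \<Longrightarrow> jet2 (f i) (a i) (b i) (c i)) \<Longrightarrow>
   jet2 (\<lambda>t. \<Sum>i\<in>I. f i t) (\<Sum>i\<in>I. a i) (\<Sum>i\<in>I. b i) (\<Sum>i\<in>I. c i)"
  by (induction I rule: finite_induct) (auto simp: jet2_const intro!: jet2_add)

lemma jet2_line:
  assumes S: "open S" "0 \<in> S" and f: "smooth_on S f"
  shows "jet2 (\<lambda>t. f (t *\<^sub>R v)) (f 0) (pd v f 0) (pd v (pd v f) 0)"
proof (rule jet2I)
  have "isCont (\<lambda>t. t *\<^sub>R v) (0::real)" by simp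
  then have "((\<lambda>t. t *\<^sub>R v) \<longlongrightarrow> 0 *\<^sub>R v) (nhds (0::real))"
    using tendsto_at_iff_tendsto_nhds[of "\<lambda>t. t *\<^sub>R v" "0::real"] by (simp only: isCont_def)
  then have "\<forall>\<^sub>F t in nhds 0. t *\<^sub>R v \<in> S" using S by (simp add: topological_tendstoD)
  then show "\<forall>\<^sub>F t in nhds 0. ((\<lambda>t. f (t *\<^sub>R v)) has_vector_derivative pd v f (t *\<^sub>R v)) (at t)"
  proof eventually_elim
    fix t :: real assume "t *\<^sub>R v \<in> S"
    then show "((\<lambda>t. f (t *\<^sub>R v)) has_vector_derivative pd v f (t *\<^sub>R v)) (at t)"
      using line_derivative[of f 0 t v] smooth_differentiable[OF f] by simp
  qed
  show "((\<lambda>t. pd v f (t *\<^sub>R v)) has_vector_derivative pd v (pd v f) 0) (at 0)"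
    using line_derivative[of "pd v f" 0 0 v] smooth_differentiable[OF smooth_pd[OF f] S(2)] by simp
qed simp_all

text \<open>
  Two derivatives of the barrier \<open>(k - z)\<^sup>-\<^sup>n\<close>.
\<close>

lemma jet2_inverse_power:
  fixes z :: "real \<Rightarrow> real"
  assumes z: "jet2 z z0 z1 z2" and pos: "k - z0 > 0"
  shows "jet2 (\<lambda>t. inverse ((k - z t) ^ n)) (inverse ((k - z0) ^ n))
     (inverse ((k - z0) ^ n) * (real n * z1 / (k - z0)))
     (inverse ((k - z0) ^ n) * (real n * z2 / (k - z0) + real n * (real n + 1) * z1\<^sup>2 / (k - z0)\<^sup>2))"
proof -
  obtain z' where f: "z 0 = z0" "\<forall>\<^sub>F t in nhds 0. (z has_vector_derivative z' t) (at t)" "z' 0 = z1"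
    "(z' has_vector_derivative z2) (at 0)" "(z has_vector_derivative z1) (at 0)" using z by (rule jet2E)
  have "isCont z 0" using f(5) has_vector_derivative_continuous by blast
  then have "(z \<longlongrightarrow> z0) (nhds 0)"
    using tendsto_at_iff_tendsto_nhds[of z 0] by (simp add: isCont_def f(1))
  then have ev: "\<forall>\<^sub>F t in nhds 0. z t < k" using pos by (simp add: order_tendstoD(2))
  define G where "G j s = inverse ((k - s) ^ j)" for j :: nat and s
  have G: "(G j has_real_derivative real j * G (Suc j) s) (at s)" if "s < k" for j s
  proof -
    have "(G j has_real_derivative - (inverse ((k - s) ^ j) * (real j * (k - s) ^ (j - 1) * (0 - 1)) * inverse ((k - s) ^ j))) (at s)"
      unfolding G_def using that by (intro DERIV_inverse' DERIV_power_Suc derivative_eq_intros refl) auto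
    moreover have "- (inverse ((k - s) ^ j) * (real j * (k - s) ^ (j - 1) * (0 - 1)) * inverse ((k - s) ^ j)) = real j * G (Suc j) s"
    proof -
      have "- (inverse (w ^ j) * (real j * w ^ (j - 1) * (0 - 1)) * inverse (w ^ j)) = real j * inverse (w ^ Suc j)"
        if "w > 0" for w :: real
        by (cases j) (use that in \<open>simp_all add: field_simps\<close>)
      from this[of "k - s"] that show ?thesis unfolding G_def by simp
    qed
    ultimately show ?thesis by metis
  qed
  have GS: "G (Suc n) z0 = G n z0 / (k - z0)" "G (Suc (Suc n)) z0 = G n z0 / (k - z0)\<^sup>2"
    using pos by (simp_all add: G_def field_simps power2_eq_square)
  show ?thesis
    unfolding G_def[symmetric]
  proof (rule jet2I)
    show "\<forall>\<^sub>F t in nhds 0. ((\<lambda>t. G n (z t)) has_vector_derivative real n * G (Suc n) (z t) * z' t) (at t)"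
      using f(2) ev
    proof eventually_elim
      case (elim t)
      from DERIV_chain2[OF G[OF elim(2)] elim(1)[folded has_real_derivative_iff_has_vector_derivative]]
      show ?case by (simp add: has_real_derivative_iff_has_vector_derivative)
    qed
    show "real n * G (Suc n) (z 0) * z' 0 = G n z0 * (real n * z1 / (k - z0))"
      by (simp add: f GS)
    have a: "((\<lambda>t. G (Suc n) (z t)) has_real_derivative real (Suc n) * G (Suc (Suc n)) z0 * z1) (at 0)"
      using DERIV_chain2[OF G[of "z 0" "Suc n"] f(5)[folded has_real_derivative_iff_has_vector_derivative]] pos f(1) by simp
    have "((\<lambda>t. real n * G (Suc n) (z t) * z' t) has_real_derivative
        (real n * (real (Suc n) * G (Suc (Suc n)) z0 * z1)) * z' 0 + z2 * (real n * G (Suc n) (z 0))) (at 0)"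
      by (intro DERIV_mult DERIV_cmult a f(4)[folded has_real_derivative_iff_has_vector_derivative])
    moreover have "(real n * (real (Suc n) * G (Suc (Suc n)) z0 * z1)) * z' 0 + z2 * (real n * G (Suc n) (z 0)) =
       G n z0 * (real n * z2 / (k - z0) + real n * (real n + 1) * z1\<^sup>2 / (k - z0)\<^sup>2)"
      by (simp add: f GS power2_eq_square field_simps)
    ultimately show "((\<lambda>t. real n * G (Suc n) (z t) * z' t) has_vector_derivative
       G n z0 * (real n * z2 / (k - z0) + real n * (real n + 1) * z1\<^sup>2 / (k - z0)\<^sup>2)) (at 0)"
      unfolding has_real_derivative_iff_has_vector_derivative[symmetric] by metis
  qed (simp add: f)
qed

lemma jet2_max:
  fixes f :: "real \<Rightarrow> real"
  assumes f: "jet2 f a b c" and max: "\<forall>\<^sub>F t in nhds 0. f t \<le> a"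
  shows "b = 0" "c \<le> 0"
proof -
  obtain f' where f': "f 0 = a" "\<forall>\<^sub>F t in nhds 0. (f has_vector_derivative f' t) (at t)" "f' 0 = b"
    "(f' has_vector_derivative c) (at 0)" "(f has_vector_derivative b) (at 0)" using f by (rule jet2E)
  from eventually_conj[OF f'(2) max] obtain d where d: "d > 0"
    "\<And>t. dist t 0 < d \<Longrightarrow> (f has_vector_derivative f' t) (at t) \<and> f t \<le> a"
    unfolding eventually_nhds_metric by blast
  have D: "(f has_real_derivative f' t) (at t)" "f t \<le> f 0" if "\<bar>t\<bar> < d" for t
    using d(2)[of t] that f'(1) by (simp_all add: has_real_derivative_iff_has_vector_derivative)
  show b: "b = 0"
    by (rule DERIV_local_max[of f b 0 d]) (use D d f'(3) in force)+
  show "c \<le> 0"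
  proof (rule ccontr)
    assume "\<not> c \<le> 0"
    then have "c > 0" by simp
    from DERIV_pos_inc_right[OF f'(4)[folded has_real_derivative_iff_has_vector_derivative] this]
    obtain e where e: "e > 0" "\<And>h. 0 < h \<Longrightarrow> h < e \<Longrightarrow> f' 0 < f' (0 + h)" by blast
    define h where "h = min d e / 2"
    have h: "0 < h" "h < d" "h < e" using d(1) e(1) by (auto simp: h_def)
    have "\<exists>t>0. t < h \<and> f h - f 0 = (h - 0) * f' t"
      by (rule MVT2[OF h(1)]) (use D(1) h in auto)
    then obtain t where t: "0 < t" "t < h" "f h - f 0 = h * f' t" by auto
    have "f' t > 0" using e(2)[of t] t h b f'(3) by simp
    then have "f h > f 0" using t(3) h(1) by (smt (verit) mult_pos_pos)
    then show False using D(2)[of h] h by simp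
  qed
qed

text \<open>
  The maximum principle applied to \<open>f t \<bullet> e - C |e| t\<^sup>4\<close> and all \<open>e\<close>: subtracting \<open>t\<^sup>4\<close> does not change the
  derivatives up to order two.
\<close>

lemma jet2_flat:
  fixes f :: "real \<Rightarrow> 'a::euclidean_space"
  assumes f: "jet2 f a b c" and flat: "\<forall>\<^sub>F t in nhds 0. norm (f t) \<le> C * t ^ 4"
  shows "a = 0" "b = 0" "c = 0"
proof -
  have "norm (f 0) \<le> C * 0 ^ 4" by (rule eventually_nhds_x_imp_x[OF flat])
  moreover have "f 0 = a" using f by (rule jet2E)
  ultimately show a: "a = 0" by simp
  have t4: "jet2 (\<lambda>t. t ^ 4 :: real) 0 0 0"
    using jet2_mult[OF jet2_mult[OF jet2_id jet2_id] jet2_mult[OF jet2_id jet2_id]]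
    by (simp add: power4_eq_xxxx mult.assoc)
  have *: "b \<bullet> e = 0" "c \<bullet> e \<le> 0" for e
  proof -
    have "jet2 (\<lambda>t. f t \<bullet> e - (C * norm e) * t ^ 4) (a \<bullet> e - (C * norm e) * 0)
       (a \<bullet> 0 + b \<bullet> e - (C * norm e) * 0) (a \<bullet> 0 + 2 * (b \<bullet> 0) + c \<bullet> e - (C * norm e) * 0)"
      by (intro jet2_diff jet2_cmult t4 jet2_inner f jet2_const)
    then have j: "jet2 (\<lambda>t. f t \<bullet> e - (C * norm e) * t ^ 4) 0 (b \<bullet> e) (c \<bullet> e)" by (simp add: a)
    have "\<forall>\<^sub>F t in nhds 0. f t \<bullet> e - (C * norm e) * t ^ 4 \<le> 0"
      using flat
    proof eventually_elim
      case (elim t)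
      have "f t \<bullet> e \<le> norm (f t) * norm e" by (rule norm_cauchy_schwarz)
      also have "\<dots> \<le> (C * t ^ 4) * norm e" using elim by (rule mult_right_mono) simp
      finally show ?case by (simp add: mult_ac)
    qed
    from jet2_max[OF j this] show "b \<bullet> e = 0" "c \<bullet> e \<le> 0" by simp_all
  qed
  from *(1)[of b] show "b = 0" by simp
  from *(2)[of c] show "c = 0" by (metis inner_ge_zero inner_eq_zero_iff order_antisym)
qed

section \<open>The extremal equation at a horizontal point\<close>

lemma pd_axis:
  fixes f :: "real^'m \<Rightarrow> 'b::real_normed_vector"
  assumes "f differentiable (at x)"
  shows "pd v f x = (\<Sum>r\<in>UNIV. v $ r *\<^sub>R pd (axis r 1) f x)"
proof -
  have "pd v f x = pd (\<Sum>r\<in>UNIV. v $ r *\<^sub>R axis r 1) f x"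
    by (metis (no_types, lifting) basis_expansion scalar_mult_eq_scaleR sum.cong)
  also have "\<dots> = (\<Sum>r\<in>UNIV. v $ r *\<^sub>R pd (axis r 1) f x)"
    by (simp add: pd_sum[OF assms] pd_scale[OF assms])
  finally show ?thesis .
qed

text \<open>
  Let \<open>E\<close> be the matrix of the \<open>l r \<bullet> l s\<close>, so that \<open>1 - E\<close> is the induced metric, and let \<open>A\<close> have the columns
  \<open>a i\<close>. The frame condition says that \<open>G = A A\<^sup>T\<close> inverts \<open>1 - E\<close>; thus \<open>G = 1 + E + G E\<^sup>2\<close>. With \<open>G\<close> bounded and \<open>E\<close>
  quadratic in the \<open>l r\<close>, the trace of \<open>Q\<close> with \<open>1 + E\<close> differs from that with \<open>G\<close>, which is zero, by a term of
  order four.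
\<close>

lemma frame_trace_estimate:
  fixes a :: "'m::finite \<Rightarrow> real^'m" and l :: "'m \<Rightarrow> 'b::real_inner" and Q :: "'m \<Rightarrow> 'm \<Rightarrow> 'b"
  defines "N \<equiv> \<Sum>r\<in>UNIV. norm (l r)"
  defines "T \<equiv> \<lambda>v. \<Sum>r\<in>UNIV. v $ r *\<^sub>R l r"
  assumes N: "N \<le> 1/2"
    and frame: "\<And>i j. a i \<bullet> a j - T (a i) \<bullet> T (a j) = (if i = j then 1 else 0)"
    and tr: "(\<Sum>i\<in>UNIV. \<Sum>r\<in>UNIV. \<Sum>s\<in>UNIV. (a i $ r * a i $ s) *\<^sub>R Q r s) = 0"
  shows "norm ((\<Sum>r\<in>UNIV. Q r r) + (\<Sum>r\<in>UNIV. \<Sum>s\<in>UNIV. (l r \<bullet> l s) *\<^sub>R Q r s))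
     \<le> 2 * real CARD('m) ^ 3 * N ^ 4 * (\<Sum>r\<in>UNIV. \<Sum>s\<in>UNIV. norm (Q r s))"
proof -
  define E :: "real^'m^'m" where "E = (\<chi> r s. l r \<bullet> l s)"
  define A :: "real^'m^'m" where "A = (\<chi> r i. a i $ r)"
  define G where "G = A ** transpose A"
  have N0: "N \<ge> 0" unfolding N_def by (intro sum_nonneg) simp
  have lN: "norm (l r) \<le> N" for r
    unfolding N_def by (rule member_le_sum) auto
  have TT: "T v \<bullet> T w = v \<bullet> (E *v w)" for v w
    by (simp add: T_def E_def inner_vec_def matrix_vector_mult_def inner_sum_left inner_sum_right
        sum_distrib_left mult_ac) (rule sum.swap)
  have "transpose A ** (mat 1 - E) ** A = mat 1"
  proof -
    have c: "(transpose A ** (mat 1 - E) ** A) $ i $ j = a i \<bullet> ((mat 1 - E) *v a j)" for i j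
      by (simp add: matrix_matrix_mult_def transpose_def A_def inner_vec_def matrix_vector_mult_def
         matrix_mul_assoc[symmetric] sum_distrib_left sum_distrib_right mult_ac) (rule sum.swap)
    have "a i \<bullet> ((mat 1 - E) *v a j) = (if i = j then 1 else 0)" for i j
      using frame[of i j] by (simp add: TT matrix_vector_mult_diff_rdistrib inner_diff_right)
    with c show ?thesis by (simp add: vec_eq_iff mat_def)
  qed
  then have "A ** (transpose A ** (mat 1 - E)) = mat 1"
    using matrix_left_right_inverse by blast
  then have "G ** (mat 1 - E) = mat 1" by (simp add: G_def matrix_mul_assoc)
  then have GE: "G = mat 1 + G ** E" using matrix_add_ldistrib[of G "mat 1 - E" E] by simp
  then have "G = mat 1 + (mat 1 + G ** E) ** E" by metis
  moreover have "(mat 1 + G ** E) ** E = E + G ** E ** E"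
    by (simp add: vec_eq_iff matrix_matrix_mult_def mat_def sum.distrib distrib_right if_distrib[of "\<lambda>x. x * _"] cong: if_cong)
  ultimately have GEE: "G = mat 1 + E + G ** E ** E" by (simp add: add.assoc)
  have "(\<Sum>r\<in>UNIV. \<Sum>s\<in>UNIV. G $ r $ s *\<^sub>R Q r s) = 0"
  proof -
    have "G $ r $ s = (\<Sum>i\<in>UNIV. a i $ r * a i $ s)" for r s
      by (simp add: G_def A_def matrix_matrix_mult_def transpose_def)
    then have "(\<Sum>r\<in>UNIV. \<Sum>s\<in>UNIV. G $ r $ s *\<^sub>R Q r s)
      = (\<Sum>r\<in>UNIV. \<Sum>s\<in>UNIV. \<Sum>i\<in>UNIV. (a i $ r * a i $ s) *\<^sub>R Q r s)"
      by (simp add: scaleR_sum_left)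
    also have "\<dots> = (\<Sum>r\<in>UNIV. \<Sum>i\<in>UNIV. \<Sum>s\<in>UNIV. (a i $ r * a i $ s) *\<^sub>R Q r s)"
      by (intro sum.cong refl sum.swap)
    also have "\<dots> = (\<Sum>i\<in>UNIV. \<Sum>r\<in>UNIV. \<Sum>s\<in>UNIV. (a i $ r * a i $ s) *\<^sub>R Q r s)"
      by (rule sum.swap)
    finally show ?thesis using tr by simp
  qed
  moreover have "G $ r $ s *\<^sub>R Q r s = (if r = s then Q r s else 0) + (l r \<bullet> l s) *\<^sub>R Q r s
      + (G ** E ** E) $ r $ s *\<^sub>R Q r s" for r s
    by (subst GEE) (simp add: E_def mat_def scaleR_add_left)
  ultimately have "(\<Sum>r\<in>UNIV. Q r r) + (\<Sum>r\<in>UNIV. \<Sum>s\<in>UNIV. (l r \<bullet> l s) *\<^sub>R Q r s)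
      = - (\<Sum>r\<in>UNIV. \<Sum>s\<in>UNIV. (G ** E ** E) $ r $ s *\<^sub>R Q r s)"
    by (simp add: sum.distrib eq_neg_iff_add_eq_0 sum.delta)
  moreover have "norm (\<Sum>r\<in>UNIV. \<Sum>s\<in>UNIV. (G ** E ** E) $ r $ s *\<^sub>R Q r s)
     \<le> (\<Sum>r\<in>UNIV. \<Sum>s\<in>UNIV. (2 * real CARD('m) ^ 3 * N ^ 4) * norm (Q r s))"
  proof (intro sum_norm_le)
    fix r s :: 'm
    have Tn: "norm (T v) \<le> norm v / 2" for v
    proof -
      have "norm (T v) \<le> (\<Sum>r\<in>UNIV. norm v * norm (l r))"
        unfolding T_def by (intro sum_norm_le) (simp add: mult_right_mono component_le_norm_cart)
      also have "\<dots> = norm v * N" by (simp add: N_def sum_distrib_left)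
      also have "\<dots> \<le> norm v * (1/2)" using N by (intro mult_left_mono) auto
      finally show ?thesis by simp
    qed
    have an: "\<bar>a i $ r\<bar> * \<bar>a i $ p\<bar> \<le> 2" for i r p
    proof -
      have "(norm (a i))\<^sup>2 - (norm (T (a i)))\<^sup>2 = 1" using frame[of i i] by (simp add: power2_norm_eq_inner)
      moreover have "(norm (T (a i)))\<^sup>2 \<le> (norm (a i) / 2)\<^sup>2" using Tn[of "a i"] by (intro power_mono) auto
      ultimately have "(norm (a i))\<^sup>2 \<le> 2" by (simp add: power_divide)
      moreover have "\<bar>a i $ r\<bar> * \<bar>a i $ p\<bar> \<le> norm (a i) * norm (a i)"
        by (intro mult_mono component_le_norm_cart) auto
      ultimately show ?thesis by (simp add: power2_eq_square)
    qed
    have G: "\<bar>G $ r $ p\<bar> \<le> 2 * real CARD('m)" for r p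
    proof -
      have "\<bar>G $ r $ p\<bar> \<le> (\<Sum>i\<in>UNIV. \<bar>a i $ r * a i $ p\<bar>)"
        by (simp add: G_def A_def matrix_matrix_mult_def transpose_def sum_abs)
      also have "\<dots> \<le> (\<Sum>i\<in>(UNIV::'m set). 2)" using an by (intro sum_mono) (simp add: abs_mult)
      finally show ?thesis by simp
    qed
    have E: "\<bar>E $ r $ s\<bar> \<le> N\<^sup>2" for r s
    proof -
      have "\<bar>l r \<bullet> l s\<bar> \<le> norm (l r) * norm (l s)" by (rule Cauchy_Schwarz_ineq2)
      also have "\<dots> \<le> N * N" by (intro mult_mono lN N0) auto
      finally show ?thesis by (simp add: E_def power2_eq_square)
    qed
    have "\<bar>(G ** E ** E) $ r $ s\<bar> \<le> (\<Sum>q\<in>(UNIV::'m set). \<Sum>p\<in>(UNIV::'m set). 2 * real CARD('m) * N ^ 4)"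
    proof -
      have "(G ** E ** E) $ r $ s = (\<Sum>q\<in>UNIV. \<Sum>p\<in>UNIV. G $ r $ p * E $ p $ q * E $ q $ s)"
        by (simp add: matrix_matrix_mult_def sum_distrib_right)
      also have "\<bar>\<dots>\<bar> \<le> (\<Sum>q\<in>UNIV. \<Sum>p\<in>UNIV. \<bar>G $ r $ p * E $ p $ q * E $ q $ s\<bar>)"
        by (intro order_trans[OF sum_abs] sum_mono sum_abs)
      also have "\<dots> \<le> (\<Sum>q\<in>(UNIV::'m set). \<Sum>p\<in>(UNIV::'m set). 2 * real CARD('m) * N ^ 4)"
      proof (intro sum_mono)
        fix q p :: 'm
        have "\<bar>G $ r $ p\<bar> * \<bar>E $ p $ q\<bar> * \<bar>E $ q $ s\<bar> \<le> (2 * real CARD('m)) * N\<^sup>2 * N\<^sup>2"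
          by (intro mult_mono G E) auto
        then show "\<bar>G $ r $ p * E $ p $ q * E $ q $ s\<bar> \<le> 2 * real CARD('m) * N ^ 4"
          by (simp add: abs_mult power4_eq_xxxx power2_eq_square mult_ac)
      qed
      finally show ?thesis .
    qed
    also have "\<dots> = 2 * real CARD('m) ^ 3 * N ^ 4" by (simp add: power3_eq_cube)
    finally have "\<bar>(G ** E ** E) $ r $ s\<bar> \<le> 2 * real CARD('m) ^ 3 * N ^ 4" .
    then show "norm ((G ** E ** E) $ r $ s *\<^sub>R Q r s) \<le> (2 * real CARD('m) ^ 3 * N ^ 4) * norm (Q r s)"
      by (simp add: mult_right_mono)
  qed
  ultimately show ?thesis by (simp add: sum_distrib_left)
qed

lemma jet2_bounded_linear_growth:
  assumes "jet2 f 0 b c"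
  shows "\<exists>K\<ge>0. \<forall>\<^sub>F t in nhds 0. norm (f t) \<le> K * \<bar>t\<bar>"
proof -
  obtain f' where f: "f 0 = 0" "(f has_vector_derivative b) (at 0)" using assms by (rule jet2E)
  from f(2) have "\<forall>\<^sub>F t in at 0. norm (f t - f 0 - (t - 0) *\<^sub>R b) \<le> 1 * norm (t - 0)"
    unfolding has_vector_derivative_def has_derivative_within_alt2 by (auto dest: spec[of _ 1])
  then have "\<forall>\<^sub>F t in at 0. norm (f t) \<le> (norm b + 1) * \<bar>t\<bar>"
  proof eventually_elim
    case (elim t)
    have "norm (f t) \<le> norm (f t - t *\<^sub>R b) + norm (t *\<^sub>R b)"
      using norm_triangle_ineq[of "f t - t *\<^sub>R b" "t *\<^sub>R b"] by simp
    with elim f(1) show ?case by (simp add: algebra_simps)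
  qed
  then have "\<forall>\<^sub>F t in nhds 0. norm (f t) \<le> (norm b + 1) * \<bar>t\<bar>"
    by (simp add: eventually_nhds_conv_at f(1))
  then show ?thesis by (intro exI[of _ "norm b + 1"]) auto
qed

lemma jet2_continuous: "jet2 f a b c \<Longrightarrow> (f \<longlongrightarrow> a) (nhds 0)"
proof -
  assume "jet2 f a b c"
  then obtain f' where f: "f 0 = a" "(f has_vector_derivative b) (at 0)" by (rule jet2E)
  have "isCont f 0" using f(2) has_vector_derivative_continuous by blast
  then show ?thesis using tendsto_at_iff_tendsto_nhds[of f 0] by (simp add: isCont_def f(1))
qed

text \<open>
  The graph that \<open>tangential_normal_form\<close> provides; its tangent space at the origin is horizontal.
\<close>

locale tangential_graph =
  fixes u :: "real^'m \<Rightarrow> real^'n" and r :: real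
  assumes r: "r > 0" and u: "smooth_on (ball 0 r) u" and u0: "u 0 = 0" and du0: "\<And>v. pd v u 0 = 0"
    and equation: "\<And>x. x \<in> ball 0 r \<Longrightarrow> \<exists>a :: 'm \<Rightarrow> real^'m.
       (\<forall>i j. a i \<bullet> a j - pd (a i) u x \<bullet> pd (a j) u x = (if i = j then 1 else 0)) \<and>
       (\<Sum>i\<in>UNIV. pd (a i) (pd (a i) u) x) = 0"
begin

abbreviation "e i \<equiv> axis i (1::real)"

lemma ball_r: "open (ball (0::real^'m) r)" "(0::real^'m) \<in> ball 0 r" using r by auto

lemma line:
  fixes f :: "real^'m \<Rightarrow> 'b::real_normed_vector"
  shows "smooth_on (ball 0 r) f \<Longrightarrow> jet2 (\<lambda>t. f (t *\<^sub>R v)) (f 0) (pd v f 0) (pd v (pd v f) 0)"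
  by (rule jet2_line[OF ball_r])

lemma line_in_ball: "\<forall>\<^sub>F t in nhds (0::real). t *\<^sub>R v \<in> ball (0::real^'m) r"
proof -
  have "isCont (\<lambda>t. t *\<^sub>R v) (0::real)" by simp
  then have "((\<lambda>t. t *\<^sub>R v) \<longlongrightarrow> 0 *\<^sub>R v) (nhds (0::real))"
    using tendsto_at_iff_tendsto_nhds[of "\<lambda>t. t *\<^sub>R v" "0::real"] by (simp only: isCont_def)
  from topological_tendstoD[OF this ball_r(1)] show ?thesis using r by simp
qed

lemma commute2: "pd v (pd w u) 0 = pd w (pd v u) 0"
  by (rule pd_commute[OF ball_r(1) u ball_r(2)])

lemma commute3: "pd v (pd w (pd z u)) 0 = pd w (pd z (pd v u)) 0"
proof -
  have "pd v (pd w (pd z u)) 0 = pd w (pd v (pd z u)) 0" by (rule pd_commute[OF ball_r(1) smooth_pd[OF u] ball_r(2)])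
  also have "\<dots> = pd w (pd z (pd v u)) 0"
    by (rule pd_cong_open(1)[OF ball_r]) (rule pd_commute[OF ball_r(1) u])
  finally show ?thesis .
qed

lemma commute4: "pd v (pd v (pd w (pd w u))) 0 = pd w (pd w (pd v (pd v u))) 0"
proof -
  have a: "pd v (pd w (pd z u)) x = pd w (pd z (pd v u)) x" if x: "x \<in> ball 0 r" for v w z x
  proof -
    have "pd v (pd w (pd z u)) x = pd w (pd v (pd z u)) x" by (rule pd_commute[OF ball_r(1) smooth_pd[OF u] x])
    also have "\<dots> = pd w (pd z (pd v u)) x"
      by (rule pd_cong_open(1)[OF ball_r(1) x]) (rule pd_commute[OF ball_r(1) u])
    finally show ?thesis .
  qed
  have "pd v (pd v (pd w (pd w u))) 0 = pd v (pd w (pd w (pd v u))) 0"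
    by (rule pd_cong_open(1)[OF ball_r]) (rule a)
  also have "\<dots> = pd w (pd v (pd w (pd v u))) 0"
    by (rule pd_commute[OF ball_r(1) smooth_pd[OF smooth_pd[OF u]] ball_r(2)])
  also have "\<dots> = pd w (pd w (pd v (pd v u))) 0"
    by (rule pd_cong_open(1)[OF ball_r]) (rule pd_commute[OF ball_r(1) smooth_pd[OF u]])
  finally show ?thesis .
qed

lemma trace_expansion_flat:
  "\<exists>C. \<forall>\<^sub>F t in nhds 0. norm ((\<Sum>i\<in>UNIV. pd (e i) (pd (e i) u) (t *\<^sub>R v)) +
     (\<Sum>i\<in>UNIV. \<Sum>j\<in>UNIV. (pd (e i) u (t *\<^sub>R v) \<bullet> pd (e j) u (t *\<^sub>R v)) *\<^sub>R pd (e i) (pd (e j) u) (t *\<^sub>R v)))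
     \<le> C * t ^ 4"
proof -
  define N where "N t = (\<Sum>i\<in>UNIV. norm (pd (e i) u (t *\<^sub>R v)))" for t
  define Qn where "Qn t = (\<Sum>i\<in>UNIV. \<Sum>j\<in>UNIV. norm (pd (e i) (pd (e j) u) (t *\<^sub>R v)))" for t
  have "\<exists>K\<ge>0. \<forall>\<^sub>F t in nhds 0. norm (pd (e i) u (t *\<^sub>R v)) \<le> K * \<bar>t\<bar>" for i
    using jet2_bounded_linear_growth line[OF smooth_pd[OF u], of "e i" v] unfolding du0 by blast
  then obtain K where K: "\<And>i. K i \<ge> 0" "\<And>i. \<forall>\<^sub>F t in nhds 0. norm (pd (e i) u (t *\<^sub>R v)) \<le> K i * \<bar>t\<bar>" by metis
  define K0 where "K0 = (\<Sum>i\<in>UNIV. K i)"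
  have K0: "K0 \<ge> 0" unfolding K0_def by (intro sum_nonneg K(1))
  have "\<forall>\<^sub>F t in nhds 0. \<forall>i. norm (pd (e i) u (t *\<^sub>R v)) \<le> K i * \<bar>t\<bar>"
    by (rule eventually_all_finite) (rule K(2))
  then have Nt: "\<forall>\<^sub>F t in nhds 0. N t \<le> K0 * \<bar>t\<bar>"
    by eventually_elim (auto simp: N_def K0_def sum_distrib_right intro!: sum_mono)
  have "((\<lambda>t. K0 * \<bar>t\<bar>) \<longlongrightarrow> K0 * \<bar>0\<bar>) (nhds 0)"
    by (intro tendsto_mult tendsto_const tendsto_rabs filterlim_ident)
  then have small: "\<forall>\<^sub>F t in nhds 0. K0 * \<bar>t\<bar> < 1/2" by (rule order_tendstoD(2)) simp
  have "(Qn \<longlongrightarrow> (\<Sum>i\<in>UNIV. \<Sum>j\<in>UNIV. norm (pd (e i) (pd (e j) u) 0))) (nhds 0)"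
    unfolding Qn_def
    by (intro tendsto_sum tendsto_norm jet2_continuous[OF line[OF smooth_pd[OF smooth_pd[OF u]]]])
  then obtain Kq where Qt: "\<forall>\<^sub>F t in nhds 0. Qn t < Kq" by (metis order_tendstoD(2) lt_ex less_add_one)
  show ?thesis
  proof (rule exI)
    show "\<forall>\<^sub>F t in nhds 0. norm ((\<Sum>i\<in>UNIV. pd (e i) (pd (e i) u) (t *\<^sub>R v)) +
     (\<Sum>i\<in>UNIV. \<Sum>j\<in>UNIV. (pd (e i) u (t *\<^sub>R v) \<bullet> pd (e j) u (t *\<^sub>R v)) *\<^sub>R pd (e i) (pd (e j) u) (t *\<^sub>R v)))
     \<le> (2 * real CARD('m) ^ 3 * K0 ^ 4 * \<bar>Kq\<bar>) * t ^ 4"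
      using Nt small Qt line_in_ball[of v]
    proof eventually_elim
      case (elim t)
      let ?x = "t *\<^sub>R v"
      have du: "u differentiable (at ?x)" "pd w u differentiable (at ?x)" for w
        using smooth_differentiable[OF u elim(4)] smooth_differentiable[OF smooth_pd[OF u] elim(4)] by auto
      from equation[OF elim(4)] obtain a :: "'m \<Rightarrow> real^'m" where
        a: "\<And>i j. a i \<bullet> a j - pd (a i) u ?x \<bullet> pd (a j) u ?x = (if i = j then 1 else 0)"
        and tr: "(\<Sum>i\<in>UNIV. pd (a i) (pd (a i) u) ?x) = 0" by blast
      have second: "pd w (pd w u) ?x = (\<Sum>i\<in>UNIV. \<Sum>j\<in>UNIV. (w $ i * w $ j) *\<^sub>R pd (e i) (pd (e j) u) ?x)" for w
      proof -
        have "pd w (pd w u) ?x = (\<Sum>i\<in>UNIV. w $ i *\<^sub>R pd (e i) (pd w u) ?x)" by (rule pd_axis[OF du(2)])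
        also have "\<dots> = (\<Sum>i\<in>UNIV. w $ i *\<^sub>R (\<Sum>j\<in>UNIV. w $ j *\<^sub>R pd (e i) (pd (e j) u) ?x))"
        proof (rule sum.cong[OF refl])
          fix i :: 'm
          have "pd (e i) (pd w u) ?x = pd w (pd (e i) u) ?x" by (rule pd_commute[OF ball_r(1) u elim(4)])
          also have "\<dots> = (\<Sum>j\<in>UNIV. w $ j *\<^sub>R pd (e j) (pd (e i) u) ?x)" by (rule pd_axis[OF du(2)])
          also have "\<dots> = (\<Sum>j\<in>UNIV. w $ j *\<^sub>R pd (e i) (pd (e j) u) ?x)"
            by (intro sum.cong refl arg_cong2[where f = scaleR] pd_commute[OF ball_r(1) u elim(4)])
          finally show "w $ i *\<^sub>R pd (e i) (pd w u) ?x = w $ i *\<^sub>R (\<Sum>j\<in>UNIV. w $ j *\<^sub>R pd (e i) (pd (e j) u) ?x)"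
            by (rule arg_cong)
        qed
        finally show ?thesis by (simp add: scaleR_sum_right)
      qed
      have N2: "(\<Sum>i\<in>UNIV. norm (pd (e i) u ?x)) \<le> 1/2" using elim(1,2) unfolding N_def by linarith
      have fr: "a i \<bullet> a j - (\<Sum>k\<in>UNIV. a i $ k *\<^sub>R pd (e k) u ?x) \<bullet> (\<Sum>k\<in>UNIV. a j $ k *\<^sub>R pd (e k) u ?x)
          = (if i = j then 1 else 0)" for i j
        using a[of i j] unfolding pd_axis[OF du(1), of "a i"] pd_axis[OF du(1), of "a j"] .
      have "norm ((\<Sum>i\<in>UNIV. pd (e i) (pd (e i) u) ?x) +
         (\<Sum>i\<in>UNIV. \<Sum>j\<in>UNIV. (pd (e i) u ?x \<bullet> pd (e j) u ?x) *\<^sub>R pd (e i) (pd (e j) u) ?x))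
         \<le> 2 * real CARD('m) ^ 3 * N t ^ 4 * Qn t"
        unfolding N_def Qn_def
        by (rule frame_trace_estimate[OF N2 fr]) (use tr in \<open>simp add: second\<close>)
      also have "\<dots> \<le> 2 * real CARD('m) ^ 3 * (K0 * \<bar>t\<bar>) ^ 4 * \<bar>Kq\<bar>"
      proof -
        have "N t \<ge> 0" unfolding N_def by (intro sum_nonneg) simp
        moreover have "Qn t \<ge> 0" unfolding Qn_def by (intro sum_nonneg) simp
        ultimately show ?thesis using elim by (intro mult_mono power_mono) auto
      qed
      also have "\<dots> = (2 * real CARD('m) ^ 3 * K0 ^ 4 * \<bar>Kq\<bar>) * t ^ 4"
        by (simp add: power_mult_distrib)
      finally show ?case .
    qed
  qed
qed

text \<open>
  The extremal equation, differentiated up to twice at the origin. The expansion of the inverse metric is exact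
  up to fourth order there, so the inverse need not be differentiated. The last identity is the source of the quartic
  terms in Simons' inequality.
\<close>

lemma equation_derivatives:
  "(\<Sum>i\<in>UNIV. pd (e i) (pd (e i) u) 0) = 0"
  "(\<Sum>i\<in>UNIV. pd v (pd (e i) (pd (e i) u)) 0) = 0"
  "(\<Sum>i\<in>UNIV. pd v (pd v (pd (e i) (pd (e i) u))) 0) +
     (\<Sum>i\<in>UNIV. \<Sum>j\<in>UNIV. (2 * (pd v (pd (e i) u) 0 \<bullet> pd v (pd (e j) u) 0)) *\<^sub>R pd (e i) (pd (e j) u) 0) = 0"
proof -
  have q: "jet2 (\<lambda>t. pd (e i) (pd (e j) u) (t *\<^sub>R v)) (pd (e i) (pd (e j) u) 0) (pd v (pd (e i) (pd (e j) u)) 0)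
       (pd v (pd v (pd (e i) (pd (e j) u))) 0)" for i j
    by (rule line[OF smooth_pd[OF smooth_pd[OF u]]])
  have l: "jet2 (\<lambda>t. pd (e i) u (t *\<^sub>R v)) 0 (pd v (pd (e i) u) 0) (pd v (pd v (pd (e i) u)) 0)" for i
    using line[OF smooth_pd[OF u], of "e i" v] by (simp add: du0)
  have p: "jet2 (\<lambda>t. (pd (e i) u (t *\<^sub>R v) \<bullet> pd (e j) u (t *\<^sub>R v)) *\<^sub>R pd (e i) (pd (e j) u) (t *\<^sub>R v)) 0 0
     ((2 * (pd v (pd (e i) u) 0 \<bullet> pd v (pd (e j) u) 0)) *\<^sub>R pd (e i) (pd (e j) u) 0)" for i j
    by (rule jet2_eq[OF jet2_bilinear[OF bounded_bilinear_scaleR jet2_inner[OF l[of i] l[of j]] q]]) simp_all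
  have J: "jet2 (\<lambda>t. (\<Sum>i\<in>UNIV. pd (e i) (pd (e i) u) (t *\<^sub>R v)) +
     (\<Sum>i\<in>UNIV. \<Sum>j\<in>UNIV. (pd (e i) u (t *\<^sub>R v) \<bullet> pd (e j) u (t *\<^sub>R v)) *\<^sub>R pd (e i) (pd (e j) u) (t *\<^sub>R v)))
     ((\<Sum>i\<in>UNIV. pd (e i) (pd (e i) u) 0) + (\<Sum>i\<in>(UNIV::'m set). \<Sum>j\<in>(UNIV::'m set). 0))
     ((\<Sum>i\<in>UNIV. pd v (pd (e i) (pd (e i) u)) 0) + (\<Sum>i\<in>(UNIV::'m set). \<Sum>j\<in>(UNIV::'m set). 0))
     ((\<Sum>i\<in>UNIV. pd v (pd v (pd (e i) (pd (e i) u))) 0) +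
     (\<Sum>i\<in>UNIV. \<Sum>j\<in>UNIV. (2 * (pd v (pd (e i) u) 0 \<bullet> pd v (pd (e j) u) 0)) *\<^sub>R pd (e i) (pd (e j) u) 0))"
    by (intro jet2_add jet2_sum q p finite)
  obtain C where C: "\<forall>\<^sub>F t in nhds 0. norm ((\<Sum>i\<in>UNIV. pd (e i) (pd (e i) u) (t *\<^sub>R v)) +
     (\<Sum>i\<in>UNIV. \<Sum>j\<in>UNIV. (pd (e i) u (t *\<^sub>R v) \<bullet> pd (e j) u (t *\<^sub>R v)) *\<^sub>R pd (e i) (pd (e j) u) (t *\<^sub>R v)))
     \<le> C * t ^ 4" using trace_expansion_flat by blast
  from jet2_flat[OF J C]
  show "(\<Sum>i\<in>UNIV. pd (e i) (pd (e i) u) 0) = 0"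
    "(\<Sum>i\<in>UNIV. pd v (pd (e i) (pd (e i) u)) 0) = 0"
    "(\<Sum>i\<in>UNIV. pd v (pd v (pd (e i) (pd (e i) u))) 0) +
     (\<Sum>i\<in>UNIV. \<Sum>j\<in>UNIV. (2 * (pd v (pd (e i) u) 0 \<bullet> pd v (pd (e j) u) 0)) *\<^sub>R pd (e i) (pd (e j) u) 0) = 0"
    by simp_all
qed

end

section \<open>Two maximum principles\<close>

text \<open>
  Here \<open>P = |y|\<^sup>2\<close> and \<open>X = z0 + P\<close>. After division by common factors, the term \<open>n P\<close> stands on both sides, and the
  bound for \<open>P\<close> is due to the summand \<open>1 / m\<close>. This comes from the fact that a trace-free symmetric form with
  eigenvalue \<open>\<mu>\<close> has squared norm at least \<open>(1 + 1 / m) \<mu>\<^sup>2\<close>. With the exponent \<open>n = 4 m\<close> its contribution \<open>n P / m\<close> exceeds the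
  remaining \<open>2 P\<close>.
\<close>

lemma maximum_arithmetic:
  fixes m n \<kappa> z0 P X \<mu> s S1 :: real
  assumes m: "m \<ge> 1" and n: "n = 4 * m" and \<kappa>: "\<kappa> > 0" and z0: "z0 \<ge> 0" and P: "P > 0" and X: "X = z0 + P"
    and \<mu>: "\<mu> = P * n / \<kappa>" and s: "s = \<mu> * (1 + 1 / m)" and S1: "S1 \<ge> \<mu>\<^sup>2 * X / P"
    and ineq: "2 * S1 + 4 * s * \<mu> - 2 * s\<^sup>2 * (1 - 1 / m) \<le> P * (n * (2 * m) / \<kappa> + n * (n + 1) * (4 * X) / \<kappa>\<^sup>2)"
  shows "P \<le> (2 * m + 1) * (z0 + \<kappa>)"
proof -
  define q where "q = 1 / m"
  have q: "q > 0" "q * m = 1" using m by (simp_all add: q_def)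
  have n0: "n > 0" using m n by simp
  have "4 * s * \<mu> - 2 * s\<^sup>2 * (1 - 1 / m) - 2 * \<mu>\<^sup>2 * (1 + q) = 2 * \<mu>\<^sup>2 * ((1 + q) * q\<^sup>2)"
    by (simp add: s q_def[symmetric] power2_eq_square algebra_simps)
  moreover have "2 * \<mu>\<^sup>2 * ((1 + q) * q\<^sup>2) \<ge> 0" using q by simp
  ultimately have "2 * (\<mu>\<^sup>2 * X / P) + 2 * \<mu>\<^sup>2 * (1 + q) \<le> P * (n * (2 * m) / \<kappa> + n * (n + 1) * (4 * X) / \<kappa>\<^sup>2)"
    using S1 ineq by linarith
  then have "(2 * (\<mu>\<^sup>2 * X / P) + 2 * \<mu>\<^sup>2 * (1 + q)) * \<kappa>\<^sup>2 \<le> (P * (n * (2 * m) / \<kappa> + n * (n + 1) * (4 * X) / \<kappa>\<^sup>2)) * \<kappa>\<^sup>2"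
    by (intro mult_right_mono) auto
  moreover have "(2 * (\<mu>\<^sup>2 * X / P) + 2 * \<mu>\<^sup>2 * (1 + q)) * \<kappa>\<^sup>2 = (2 * n * P) * (n * X + n * P * (1 + q))"
    using P \<kappa> by (simp add: \<mu> power2_eq_square field_simps)
  moreover have "(P * (n * (2 * m) / \<kappa> + n * (n + 1) * (4 * X) / \<kappa>\<^sup>2)) * \<kappa>\<^sup>2 = (2 * n * P) * (m * \<kappa> + 2 * (n + 1) * X)"
    using \<kappa> by (simp add: power2_eq_square field_simps)
  ultimately have "n * X + n * P * (1 + q) \<le> m * \<kappa> + 2 * (n + 1) * X"
    using n0 P by (simp add: mult_le_cancel_left_pos)
  moreover have "n * P * (1 + q) = n * P + 4 * P"
  proof -
    have "n * P * (1 + q) = n * P + 4 * P * (q * m)" by (simp add: n algebra_simps)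
    then show ?thesis by (simp add: q(2))
  qed
  ultimately have "n * X + (n * P + 4 * P) \<le> m * \<kappa> + 2 * (n + 1) * X" by simp
  then have "2 * P \<le> m * \<kappa> + (4 * m + 2) * z0"
    by (simp add: X n algebra_simps)
  also have "\<dots> \<le> (4 * m + 2) * \<kappa> + (4 * m + 2) * z0"
    using m \<kappa> by (intro add_right_mono mult_right_mono) auto
  finally show ?thesis by (simp add: algebra_simps)
qed

context tangential_graph
begin

text \<open>
  The squared pseudo-distance from the point \<open>(xq, y)\<close> to the point of the graph over \<open>x\<close>.
\<close>

definition "sep xq y x = (norm (x - xq))\<^sup>2 - (norm (u x - y))\<^sup>2"

lemma differentiable_at_0: "u differentiable (at 0)" "pd w u differentiable (at 0)"
  using smooth_differentiable[OF u ball_r(2)] smooth_differentiable[OF smooth_pd[OF u] ball_r(2)] by auto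

lemma sep_0: "sep xq y 0 = (norm xq)\<^sup>2 - (norm y)\<^sup>2"
  by (simp add: sep_def u0)

lemma sep_jet: "jet2 (\<lambda>t. sep xq y (t *\<^sub>R e i)) (sep xq y 0) (- 2 * (xq \<bullet> e i)) (2 + 2 * (y \<bullet> pd (e i) (pd (e i) u) 0))"
proof -
  have a: "jet2 (\<lambda>t. t *\<^sub>R e i - xq) (0 - xq) (e i - 0) (2 *\<^sub>R 0 - 0)"
    by (rule jet2_diff[OF jet2_times_id[OF jet2_const] jet2_const])
  have b: "jet2 (\<lambda>t. u (t *\<^sub>R e i) - y) (u 0 - y) (pd (e i) u 0 - 0) (pd (e i) (pd (e i) u) 0 - 0)"
    by (intro jet2_diff line u jet2_const)
  have "jet2 (\<lambda>t. (norm (t *\<^sub>R e i - xq))\<^sup>2 - (norm (u (t *\<^sub>R e i) - y))\<^sup>2)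
     ((norm (0 - xq))\<^sup>2 - (norm (u 0 - y))\<^sup>2) (2 * ((0 - xq) \<bullet> (e i - 0)) - 2 * ((u 0 - y) \<bullet> (pd (e i) u 0 - 0)))
     ((2 * (norm (e i - 0))\<^sup>2 + 2 * ((0 - xq) \<bullet> (2 *\<^sub>R 0 - 0))) -
      (2 * (norm (pd (e i) u 0 - 0))\<^sup>2 + 2 * ((u 0 - y) \<bullet> (pd (e i) (pd (e i) u) 0 - 0))))"
    by (rule jet2_diff[OF jet2_norm2[OF a] jet2_norm2[OF b]])
  then show ?thesis unfolding sep_def by (rule jet2_eq) (simp_all add: u0 du0)
qed

text \<open>
  On an extremal submanifold the squared distance has Laplacian \<open>2 m\<close>; its gradient has squared length four times that of the tangential part of the position vector.
\<close>

lemma sep_sums: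
  "(\<Sum>i\<in>UNIV. 2 + 2 * (y \<bullet> pd (e i) (pd (e i) u) 0)) = 2 * real CARD('m)"
  "(\<Sum>i\<in>UNIV. (- 2 * (xq \<bullet> e i))\<^sup>2) = 4 * (norm xq)\<^sup>2"
proof -
  have "(\<Sum>i\<in>UNIV. y \<bullet> pd (e i) (pd (e i) u) 0) = 0"
    using equation_derivatives(1) by (simp add: inner_sum_right[symmetric])
  then show "(\<Sum>i\<in>UNIV. 2 + 2 * (y \<bullet> pd (e i) (pd (e i) u) 0)) = 2 * real CARD('m)"
    by (simp add: sum.distrib sum_distrib_left[symmetric])
  have "(norm xq)\<^sup>2 = (\<Sum>i\<in>UNIV. (xq $ i)\<^sup>2)"
    unfolding power2_norm_eq_inner inner_vec_def by (simp add: power2_eq_square)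
  then show "(\<Sum>i\<in>UNIV. (- 2 * (xq \<bullet> e i))\<^sup>2) = 4 * (norm xq)\<^sup>2"
    by (simp add: inner_axis power_mult_distrib sum_distrib_left)
qed

lemma sep_eventually:
  assumes "sep xq y 0 < k"
  shows "\<forall>\<^sub>F t in nhds 0. sep xq y (t *\<^sub>R e i) < k \<and> t *\<^sub>R e i \<in> ball 0 r"
  using order_tendstoD(2)[OF jet2_continuous[OF sep_jet[of xq y i]] assms] line_in_ball[of "e i"]
  by eventually_elim simp

text \<open>
  Relative to the point \<open>(xq, y)\<close>, the position vector of the origin has normal part \<open>- y\<close> and tangential part \<open>\<xi> = - xq\<close>.
  For a tangent vector \<open>c\<close> at \<open>x\<close>, the bracket in the hypothesis is at most the squared length of the normal part of
  the position vector at \<open>x\<close>, with equality for one \<open>c\<close>. The hypothesis thus says that this squared length, weighted by a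
  power of \<open>k - sep\<close>, is maximal at the origin.

  Let \<open>H\<^sub>i\<^sub>j = y \<bullet> u\<^sub>i\<^sub>j\<close>. Second-order variation along the coordinate lines yields the Laplacian of the squared length
  through Bochner's formula: \<open>2 |H|\<^sup>2\<close> plus twice the Ricci curvature in the direction \<open>\<xi>\<close>, which is nonnegative.
  First-order variation says that \<open>\<xi>\<close> is an eigenvector of \<open>H\<close> with eigenvalue \<open>\<mu>\<close>, which bounds both terms from below.
\<close>

lemma normal_part_bound:
  fixes xq :: "real^'m" and y :: "real^'n"
  assumes z0: "0 \<le> sep xq y 0" "sep xq y 0 < k" and y0: "y \<noteq> 0"
    and max: "\<And>x c. x \<in> ball 0 r \<Longrightarrow> sep xq y x < k \<Longrightarrow>
      (k - sep xq y x) ^ (4 * CARD('m)) * ((norm (u x - y - pd c u x))\<^sup>2 - (norm (x - xq - c))\<^sup>2)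
      \<le> (k - sep xq y 0) ^ (4 * CARD('m)) * (norm y)\<^sup>2"
  shows "(norm y)\<^sup>2 \<le> (2 * real CARD('m) + 1) * k"
proof -
  define \<xi> where "\<xi> = - xq"
  define m where "m = real CARD('m)"
  define n where "n = 4 * CARD('m)"
  define P where "P = (norm y)\<^sup>2"
  define \<kappa> where "\<kappa> = k - sep xq y 0"
  define X where "X = (norm \<xi>)\<^sup>2"
  define \<mu> where "\<mu> = P * real n / \<kappa>"
  define s where "s = \<mu> * (1 + 1 / m)"
  have m1: "m \<ge> 1" unfolding m_def using zero_less_card_finite[where 'a='m] by linarith
  have P0: "P > 0" using y0 by (simp add: P_def)
  have \<kappa>0: "\<kappa> > 0" using z0 by (simp add: \<kappa>_def)
  have X_eq: "X = sep xq y 0 + P" by (simp add: sep_0 X_def P_def \<xi>_def)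
  have X0: "X > 0" using X_eq z0 P0 by simp
  \<comment> \<open>the variation of the tangential vector \<open>c\<close> is the trace-free multiple of \<open>\<xi> \<xi>\<^sup>T\<close> that best detects the eigenvalue \<open>\<mu>\<close> of \<open>H\<close>\<close>
  define d where "d i = (s / m) *\<^sub>R e i - (s * \<xi> $ i / X) *\<^sub>R \<xi>" for i
  define Z1 where "Z1 i = - 2 * (xq \<bullet> e i)" for i
  define Z2 where "Z2 i = 2 + 2 * (y \<bullet> pd (e i) (pd (e i) u) 0)" for i
  have Z1: "Z1 i = 2 * \<xi> $ i" for i by (simp add: Z1_def \<xi>_def inner_axis)
  have second_order:
    "y \<bullet> pd (e i) (pd \<xi> u) 0 = \<mu> * \<xi> $ i"
    "2 * (norm (pd (e i) (pd \<xi> u) 0))\<^sup>2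
      - 2 * (y \<bullet> (pd (e i) (pd (e i) u) 0 - pd (e i) (pd (e i) (pd \<xi> u)) 0 - 2 *\<^sub>R pd (e i) (pd (e i - d i) u) 0))
      - 2 * (norm (d i))\<^sup>2
     \<le> P * (real n * Z2 i / \<kappa> + real n * (real n + 1) * (Z1 i)\<^sup>2 / \<kappa>\<^sup>2)" for i
  proof -
    define w where "w t = u (t *\<^sub>R e i) - y - (pd \<xi> u (t *\<^sub>R e i) + t *\<^sub>R pd (e i - d i) u (t *\<^sub>R e i))" for t
    have "jet2 w (u 0 - y - (pd \<xi> u 0 + 0)) (pd (e i) u 0 - 0 - (pd (e i) (pd \<xi> u) 0 + pd (e i - d i) u 0))
       (pd (e i) (pd (e i) u) 0 - 0 - (pd (e i) (pd (e i) (pd \<xi> u)) 0 + 2 *\<^sub>R pd (e i) (pd (e i - d i) u) 0))"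
      unfolding w_def
      by (intro jet2_diff jet2_add jet2_times_id[OF line[OF smooth_pd[OF u]]] jet2_const line u smooth_pd)
    then have w: "jet2 w (- y) (- pd (e i) (pd \<xi> u) 0)
       (pd (e i) (pd (e i) u) 0 - pd (e i) (pd (e i) (pd \<xi> u)) 0 - 2 *\<^sub>R pd (e i) (pd (e i - d i) u) 0)"
      by (rule jet2_eq) (simp_all add: u0 du0)
    have td: "jet2 (\<lambda>t. t *\<^sub>R d i) 0 (d i) (2 *\<^sub>R 0)" by (rule jet2_times_id[OF jet2_const])
    define R where "R t = (\<kappa> ^ n * P) * inverse ((k - sep xq y (t *\<^sub>R e i)) ^ n)" for t
    have R: "jet2 R ((\<kappa> ^ n * P) * inverse (\<kappa> ^ n)) ((\<kappa> ^ n * P) * (inverse (\<kappa> ^ n) * (real n * Z1 i / \<kappa>)))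
       ((\<kappa> ^ n * P) * (inverse (\<kappa> ^ n) * (real n * Z2 i / \<kappa> + real n * (real n + 1) * (Z1 i)\<^sup>2 / \<kappa>\<^sup>2)))"
      unfolding R_def \<kappa>_def Z1_def Z2_def
      by (intro jet2_cmult jet2_inverse_power sep_jet) (use z0 in simp)
    have \<phi>: "jet2 (\<lambda>t. ((norm (w t))\<^sup>2 - (norm (t *\<^sub>R d i))\<^sup>2) - R t) 0
       (2 * (y \<bullet> pd (e i) (pd \<xi> u) 0) - P * (real n * Z1 i / \<kappa>))
       (2 * (norm (pd (e i) (pd \<xi> u) 0))\<^sup>2
        - 2 * (y \<bullet> (pd (e i) (pd (e i) u) 0 - pd (e i) (pd (e i) (pd \<xi> u)) 0 - 2 *\<^sub>R pd (e i) (pd (e i - d i) u) 0))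
        - 2 * (norm (d i))\<^sup>2 - P * (real n * Z2 i / \<kappa> + real n * (real n + 1) * (Z1 i)\<^sup>2 / \<kappa>\<^sup>2))"
      by (rule jet2_eq[OF jet2_diff[OF jet2_diff[OF jet2_norm2[OF w] jet2_norm2[OF td]] R]])
         (use \<kappa>0 in \<open>simp_all add: P_def\<close>)
    have "\<forall>\<^sub>F t in nhds 0. ((norm (w t))\<^sup>2 - (norm (t *\<^sub>R d i))\<^sup>2) - R t \<le> 0"
      using sep_eventually[OF z0(2), of i]
    proof eventually_elim
      case (elim t)
      let ?x = "t *\<^sub>R e i" and ?c = "\<xi> + t *\<^sub>R (e i - d i)"
      have du: "u differentiable (at ?x)" using elim by (intro smooth_differentiable[OF u]) simp
      have "w t = u ?x - y - pd ?c u ?x" by (simp add: w_def pd_plus[OF du] pd_scale[OF du])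
      moreover have "?x - xq - ?c = t *\<^sub>R d i" by (simp add: \<xi>_def algebra_simps)
      ultimately have "(k - sep xq y ?x) ^ n * ((norm (w t))\<^sup>2 - (norm (t *\<^sub>R d i))\<^sup>2) \<le> \<kappa> ^ n * P"
        using max[of ?x ?c] elim by (simp only: n_def \<kappa>_def P_def)
      moreover have "(k - sep xq y ?x) ^ n > 0" using elim by simp
      ultimately have "(norm (w t))\<^sup>2 - (norm (t *\<^sub>R d i))\<^sup>2 \<le> (\<kappa> ^ n * P) / (k - sep xq y ?x) ^ n"
        by (simp only: pos_le_divide_eq mult.commute)
      then show ?case by (simp only: R_def divide_inverse diff_le_0_iff_le)
    qed
    note mx = jet2_max[OF \<phi> this]
    have "P * (real n * Z1 i / \<kappa>) = 2 * (\<mu> * \<xi> $ i)" by (simp add: Z1 \<mu>_def)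
    with mx(1) show "y \<bullet> pd (e i) (pd \<xi> u) 0 = \<mu> * \<xi> $ i" by linarith
    from mx(2) show "2 * (norm (pd (e i) (pd \<xi> u) 0))\<^sup>2
      - 2 * (y \<bullet> (pd (e i) (pd (e i) u) 0 - pd (e i) (pd (e i) (pd \<xi> u)) 0 - 2 *\<^sub>R pd (e i) (pd (e i - d i) u) 0))
      - 2 * (norm (d i))\<^sup>2
     \<le> P * (real n * Z2 i / \<kappa> + real n * (real n + 1) * (Z1 i)\<^sup>2 / \<kappa>\<^sup>2)"
      by linarith
  qed
  define S1 where "S1 = (\<Sum>i\<in>UNIV. (norm (pd (e i) (pd \<xi> u) 0))\<^sup>2)"
  have sq: "(\<Sum>i\<in>UNIV. (\<xi> $ i)\<^sup>2) = X"
    unfolding X_def power2_norm_eq_inner inner_vec_def by (simp add: power2_eq_square)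
  have S1: "S1 \<ge> \<mu>\<^sup>2 * X / P"
  proof -
    have "\<mu>\<^sup>2 * (\<xi> $ i)\<^sup>2 \<le> P * (norm (pd (e i) (pd \<xi> u) 0))\<^sup>2" for i
    proof -
      have "(y \<bullet> pd (e i) (pd \<xi> u) 0)\<^sup>2 \<le> (y \<bullet> y) * (pd (e i) (pd \<xi> u) 0 \<bullet> pd (e i) (pd \<xi> u) 0)"
        by (rule Cauchy_Schwarz_ineq)
      then show ?thesis by (simp add: second_order(1) power_mult_distrib P_def power2_norm_eq_inner)
    qed
    then have "(\<Sum>i\<in>UNIV. \<mu>\<^sup>2 * (\<xi> $ i)\<^sup>2) \<le> P * S1"
      unfolding S1_def sum_distrib_left by (intro sum_mono)
    then show ?thesis using P0 by (simp add: sum_distrib_left[symmetric] sq field_simps)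
  qed
  have yg: "y \<bullet> pd (e i) (pd (e i - d i) u) 0 = (1 - s / m) * (y \<bullet> pd (e i) (pd (e i) u) 0) + (s * \<mu> / X) * (\<xi> $ i)\<^sup>2" for i
  proof -
    have "pd (e i) (pd (e i - d i) u) 0 = pd (e i - d i) (pd (e i) u) 0" by (rule commute2)
    also have "\<dots> = pd (e i) (pd (e i) u) 0 - ((s / m) *\<^sub>R pd (e i) (pd (e i) u) 0 - (s * \<xi> $ i / X) *\<^sub>R pd \<xi> (pd (e i) u) 0)"
      unfolding d_def by (simp only: pd_diff[OF differentiable_at_0(2)] pd_scale[OF differentiable_at_0(2)])
    also have "pd \<xi> (pd (e i) u) 0 = pd (e i) (pd \<xi> u) 0" by (rule commute2)
    finally have "y \<bullet> pd (e i) (pd (e i - d i) u) 0 = y \<bullet> pd (e i) (pd (e i) u) 0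
        - ((s / m) * (y \<bullet> pd (e i) (pd (e i) u) 0) - (s * \<xi> $ i / X) * (\<mu> * \<xi> $ i))"
      by (simp only: inner_diff_right inner_scaleR_right second_order(1))
    then show ?thesis by (simp add: power2_eq_square algebra_simps)
  qed
  have t1: "(\<Sum>i\<in>UNIV. y \<bullet> pd (e i) (pd (e i) u) 0) = 0"
    using equation_derivatives(1) by (simp add: inner_sum_right[symmetric])
  have t2: "(\<Sum>i\<in>UNIV. y \<bullet> pd (e i) (pd (e i) (pd \<xi> u)) 0) = 0"
    using equation_derivatives(2)[of \<xi>] by (simp add: inner_sum_right[symmetric] commute3[of \<xi>])
  have t3: "(\<Sum>i\<in>UNIV. y \<bullet> pd (e i) (pd (e i - d i) u) 0) = s * \<mu>"
  proof -
    have "(\<Sum>i\<in>UNIV. y \<bullet> pd (e i) (pd (e i - d i) u) 0)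
       = (1 - s / m) * (\<Sum>i\<in>UNIV. y \<bullet> pd (e i) (pd (e i) u) 0) + (s * \<mu> / X) * (\<Sum>i\<in>UNIV. (\<xi> $ i)\<^sup>2)"
      by (simp only: yg sum.distrib sum_distrib_left)
    then show ?thesis using X0 by (simp add: t1 sq)
  qed
  have t4: "(\<Sum>i\<in>UNIV. (norm (d i))\<^sup>2) = s\<^sup>2 * (1 - 1 / m)"
  proof -
    have "(norm (d i))\<^sup>2 = (s / m)\<^sup>2 + (s\<^sup>2 / X - 2 * (s\<^sup>2 / (m * X))) * (\<xi> $ i)\<^sup>2" for i
    proof -
      have "(norm (d i))\<^sup>2 = (s / m)\<^sup>2 * (e i \<bullet> e i) - 2 * ((s / m) * (s * \<xi> $ i / X)) * (e i \<bullet> \<xi>) + (s * \<xi> $ i / X)\<^sup>2 * (\<xi> \<bullet> \<xi>)"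
        unfolding d_def power2_norm_eq_inner
        by (simp add: inner_diff_left inner_diff_right inner_commute power2_eq_square algebra_simps)
      also have "e i \<bullet> e i = 1" by (simp add: inner_axis_axis)
      also have "e i \<bullet> \<xi> = \<xi> $ i" by (simp add: inner_axis')
      also have "\<xi> \<bullet> \<xi> = X" by (simp add: X_def power2_norm_eq_inner)
      also have "(s / m)\<^sup>2 * 1 - 2 * ((s / m) * (s * \<xi> $ i / X)) * \<xi> $ i + (s * \<xi> $ i / X)\<^sup>2 * X =
         (s / m)\<^sup>2 + (s\<^sup>2 / X - 2 * (s\<^sup>2 / (m * X))) * (\<xi> $ i)\<^sup>2"
        using X0 m1 by (simp add: power2_eq_square field_simps)
      finally show ?thesis .
    qed
    then have "(\<Sum>i\<in>UNIV. (norm (d i))\<^sup>2) = m * (s / m)\<^sup>2 + (s\<^sup>2 / X - 2 * (s\<^sup>2 / (m * X))) * X"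
      by (simp add: sum.distrib sum_distrib_left[symmetric] sq m_def)
    also have "\<dots> = s\<^sup>2 * (1 - 1 / m)" using X0 m1 by (simp add: power2_eq_square field_simps)
    finally show ?thesis .
  qed
  have "(\<Sum>i\<in>UNIV. 2 * (norm (pd (e i) (pd \<xi> u) 0))\<^sup>2
      - 2 * (y \<bullet> (pd (e i) (pd (e i) u) 0 - pd (e i) (pd (e i) (pd \<xi> u)) 0 - 2 *\<^sub>R pd (e i) (pd (e i - d i) u) 0))
      - 2 * (norm (d i))\<^sup>2)
     \<le> (\<Sum>i\<in>UNIV. P * (real n * Z2 i / \<kappa> + real n * (real n + 1) * (Z1 i)\<^sup>2 / \<kappa>\<^sup>2))"
    by (intro sum_mono second_order(2))
  moreover have "(\<Sum>i\<in>UNIV. 2 * (norm (pd (e i) (pd \<xi> u) 0))\<^sup>2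
      - 2 * (y \<bullet> (pd (e i) (pd (e i) u) 0 - pd (e i) (pd (e i) (pd \<xi> u)) 0 - 2 *\<^sub>R pd (e i) (pd (e i - d i) u) 0))
      - 2 * (norm (d i))\<^sup>2) = 2 * S1 + 4 * s * \<mu> - 2 * s\<^sup>2 * (1 - 1 / m)"
    by (simp add: inner_diff_right sum_subtractf sum_distrib_left[symmetric] t1 t2 t3 t4 S1_def right_diff_distrib)
  moreover have "(\<Sum>i\<in>UNIV. P * (real n * Z2 i / \<kappa> + real n * (real n + 1) * (Z1 i)\<^sup>2 / \<kappa>\<^sup>2))
     = P * (real n * (2 * m) / \<kappa> + real n * (real n + 1) * (4 * X) / \<kappa>\<^sup>2)"
    using sep_sums(1)[of y] sep_sums(2)[of xq]
    by (simp add: sum.distrib sum_distrib_left[symmetric] sum_divide_distrib[symmetric] Z1_def Z2_def m_def X_def \<xi>_def)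
  ultimately have "2 * S1 + 4 * s * \<mu> - 2 * s\<^sup>2 * (1 - 1 / m)
     \<le> P * (real n * (2 * m) / \<kappa> + real n * (real n + 1) * (4 * X) / \<kappa>\<^sup>2)" by simp
  from maximum_arithmetic[OF m1 _ \<kappa>0 z0(1) P0 X_eq \<mu>_def s_def S1 this]
  show ?thesis by (simp add: n_def m_def P_def \<kappa>_def)
qed


lemma second_expand: "pd w (pd w u) 0 = (\<Sum>i\<in>UNIV. \<Sum>j\<in>UNIV. (w $ i * w $ j) *\<^sub>R pd (e i) (pd (e j) u) 0)"
proof -
  have "pd w (pd w u) 0 = (\<Sum>i\<in>UNIV. w $ i *\<^sub>R pd (e i) (pd w u) 0)" by (rule pd_axis[OF differentiable_at_0(2)])
  also have "\<dots> = (\<Sum>i\<in>UNIV. w $ i *\<^sub>R (\<Sum>j\<in>UNIV. w $ j *\<^sub>R pd (e i) (pd (e j) u) 0))"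
  proof (rule sum.cong[OF refl])
    fix i :: 'm
    have "pd (e i) (pd w u) 0 = pd w (pd (e i) u) 0" by (rule commute2)
    also have "\<dots> = (\<Sum>j\<in>UNIV. w $ j *\<^sub>R pd (e j) (pd (e i) u) 0)" by (rule pd_axis[OF differentiable_at_0(2)])
    also have "\<dots> = (\<Sum>j\<in>UNIV. w $ j *\<^sub>R pd (e i) (pd (e j) u) 0)"
      by (intro sum.cong refl arg_cong2[where f = scaleR] commute2)
    finally show "w $ i *\<^sub>R pd (e i) (pd w u) 0 = w $ i *\<^sub>R (\<Sum>j\<in>UNIV. w $ j *\<^sub>R pd (e i) (pd (e j) u) 0)"
      by (rule arg_cong)
  qed
  finally show ?thesis by (simp add: scaleR_sum_right)
qed

text \<open>
  For a curve with velocity \<open>w\<close> and horizontal acceleration \<open>c\<close>, the bracket in the hypothesis is minus the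
  pseudo-Euclidean square of the acceleration, and is at most \<open>|B(w,w)|\<^sup>2\<close>. So \<open>|B(w,w)|\<^sup>2 / \<langle>w,w\<rangle>\<^sup>2\<close>, weighted by \<open>(k - sep)\<^sup>2\<close>, is
  maximal at the origin in the direction \<open>v\<close>.

  Let \<open>V = u\<^sub>v\<^sub>v\<close> and let \<open>A\<^sub>i\<^sub>j = V \<bullet> u\<^sub>i\<^sub>j\<close>, the rows of which are the vectors \<open>a i\<close>. Second-order variation along the
  coordinate lines gives Simons' identity for \<open>|B(v,v)|\<^sup>2\<close>. Its term \<open>2 V \<bullet> \<Delta>u\<^sub>v\<^sub>v\<close> is, by the twice differentiated
  equation, \<open>- 4 \<Sum>(u\<^sub>v\<^sub>i \<bullet> u\<^sub>v\<^sub>j) A\<^sub>i\<^sub>j\<close>. Since \<open>v\<close> is the maximal direction, \<open>A \<le> |V|\<^sup>2\<close>, so that this is outweighed by the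
  contribution \<open>4 |V|\<^sup>2 \<Sum>|u\<^sub>v\<^sub>i|\<^sup>2\<close> of \<open>\<langle>w,w\<rangle>\<^sup>2\<close>. What is left is \<open>2 |A|\<^sup>2 \<ge> 2 |V|\<^sup>4\<close>.
\<close>

lemma second_derivative_bound:
  fixes xq v :: "real^'m" and y :: "real^'n"
  assumes z0: "sep xq y 0 < k" and v: "norm v = 1" and V0: "pd v (pd v u) 0 \<noteq> 0"
    and max: "\<And>x w c. x \<in> ball 0 r \<Longrightarrow> sep xq y x < k \<Longrightarrow>
      (k - sep xq y x)\<^sup>2 * ((norm (pd w (pd w u) x + pd c u x))\<^sup>2 - (norm c)\<^sup>2)
      \<le> ((k - sep xq y 0)\<^sup>2 * (norm (pd v (pd v u) 0))\<^sup>2) * ((norm w)\<^sup>2 - (norm (pd w u x))\<^sup>2)\<^sup>2"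
  shows "(k - sep xq y 0)\<^sup>2 * (norm (pd v (pd v u) 0))\<^sup>2 \<le> 2 * real CARD('m) * (k - sep xq y 0) + 12 * (norm xq)\<^sup>2"
proof -
  define m where "m = real CARD('m)"
  define \<kappa> where "\<kappa> = k - sep xq y 0"
  define X where "X = (norm xq)\<^sup>2"
  define V where "V = pd v (pd v u) 0"
  define K where "K = (norm V)\<^sup>2"
  have \<kappa>0: "\<kappa> > 0" using z0 by (simp add: \<kappa>_def)
  have K0: "K > 0" using V0 by (simp add: K_def V_def)
  \<comment> \<open>letting the horizontal acceleration grow as \<open>t a i\<close> along the \<open>i\<close>-th line produces the term \<open>2 |A|\<^sup>2\<close>\<close>
  define a :: "'m \<Rightarrow> real^'m" where "a i = (\<chi> j. V \<bullet> pd (e j) (pd (e i) u) 0)" for i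
  define Z1 where "Z1 i = - 2 * (xq \<bullet> e i)" for i
  define Z2 where "Z2 i = 2 + 2 * (y \<bullet> pd (e i) (pd (e i) u) 0)" for i
  have Va: "V \<bullet> pd (e i) (pd (a i) u) 0 = (norm (a i))\<^sup>2" for i
  proof -
    have "V \<bullet> pd (e i) (pd (a i) u) 0 = V \<bullet> pd (a i) (pd (e i) u) 0" by (simp add: commute2)
    also have "\<dots> = (\<Sum>j\<in>UNIV. a i $ j * (V \<bullet> pd (e j) (pd (e i) u) 0))"
      by (simp add: pd_axis[OF differentiable_at_0(2), of "a i"] inner_sum_right)
    also have "\<dots> = (\<Sum>j\<in>UNIV. a i $ j * a i $ j)" by (simp add: a_def)
    also have "\<dots> = (norm (a i))\<^sup>2" unfolding power2_norm_eq_inner by (simp add: inner_vec_def)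
    finally show ?thesis .
  qed
  have second_order:
    "2 * (norm (pd (e i) (pd v (pd v u)) 0))\<^sup>2 + 2 * (V \<bullet> pd (e i) (pd (e i) (pd v (pd v u))) 0) + 2 * (norm (a i))\<^sup>2
     \<le> K * (2 * Z2 i / \<kappa> + 6 * (Z1 i)\<^sup>2 / \<kappa>\<^sup>2) - 4 * K * (norm (pd (e i) (pd v u) 0))\<^sup>2" for i
  proof -
    define w where "w t = pd v (pd v u) (t *\<^sub>R e i) + t *\<^sub>R pd (a i) u (t *\<^sub>R e i)" for t
    have w: "jet2 w (V + 0) (pd (e i) (pd v (pd v u)) 0 + pd (a i) u 0)
       (pd (e i) (pd (e i) (pd v (pd v u))) 0 + 2 *\<^sub>R pd (e i) (pd (a i) u) 0)"
      unfolding w_def V_def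
      by (intro jet2_add jet2_times_id[OF line[OF smooth_pd[OF u]]] line u smooth_pd)
    have ta: "jet2 (\<lambda>t. t *\<^sub>R a i) 0 (a i) (2 *\<^sub>R 0)" by (rule jet2_times_id[OF jet2_const])
    define g where "g t = 1 - (norm (pd v u (t *\<^sub>R e i)))\<^sup>2" for t
    have "jet2 g (1 - (norm (pd v u 0))\<^sup>2) (0 - 2 * (pd v u 0 \<bullet> pd (e i) (pd v u) 0))
       (0 - (2 * (norm (pd (e i) (pd v u) 0))\<^sup>2 + 2 * (pd v u 0 \<bullet> pd (e i) (pd (e i) (pd v u)) 0)))"
      unfolding g_def by (intro jet2_diff jet2_const jet2_norm2 line smooth_pd u)
    then have g: "jet2 g 1 0 (- 2 * (norm (pd (e i) (pd v u) 0))\<^sup>2)" by (rule jet2_eq) (simp_all add: du0)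
    define R where "R t = (\<kappa>\<^sup>2 * K) * ((g t * g t) * inverse ((k - sep xq y (t *\<^sub>R e i)) ^ 2))" for t
    have "jet2 R ((\<kappa>\<^sup>2 * K) * ((1 * 1) * inverse (\<kappa>\<^sup>2)))
      ((\<kappa>\<^sup>2 * K) * ((1 * 1) * (inverse (\<kappa>\<^sup>2) * (real 2 * Z1 i / \<kappa>)) + (1 * 0 + 0 * 1) * inverse (\<kappa>\<^sup>2)))
      ((\<kappa>\<^sup>2 * K) * ((1 * 1) * (inverse (\<kappa>\<^sup>2) * (real 2 * Z2 i / \<kappa> + real 2 * (real 2 + 1) * (Z1 i)\<^sup>2 / \<kappa>\<^sup>2))
         + 2 * ((1 * 0 + 0 * 1) * (inverse (\<kappa>\<^sup>2) * (real 2 * Z1 i / \<kappa>)))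
         + (1 * (- 2 * (norm (pd (e i) (pd v u) 0))\<^sup>2) + 2 * (0 * 0) + (- 2 * (norm (pd (e i) (pd v u) 0))\<^sup>2) * 1) * inverse (\<kappa>\<^sup>2)))"
      unfolding R_def \<kappa>_def Z1_def Z2_def
      by (intro jet2_cmult jet2_mult[OF jet2_mult[OF g g]] jet2_inverse_power sep_jet) (use z0 in simp)
    then have R: "jet2 R K (K * (2 * Z1 i / \<kappa>))
       (K * (2 * Z2 i / \<kappa> + 6 * (Z1 i)\<^sup>2 / \<kappa>\<^sup>2) - 4 * K * (norm (pd (e i) (pd v u) 0))\<^sup>2)"
      by (rule jet2_eq) (use \<kappa>0 in \<open>simp_all add: field_simps power2_eq_square\<close>)
    have \<phi>: "jet2 (\<lambda>t. ((norm (w t))\<^sup>2 - (norm (t *\<^sub>R a i))\<^sup>2) - R t) 0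
       (2 * (V \<bullet> pd (e i) (pd v (pd v u)) 0) - K * (2 * Z1 i / \<kappa>))
       (2 * (norm (pd (e i) (pd v (pd v u)) 0))\<^sup>2 + 2 * (V \<bullet> pd (e i) (pd (e i) (pd v (pd v u))) 0) + 2 * (norm (a i))\<^sup>2
        - (K * (2 * Z2 i / \<kappa> + 6 * (Z1 i)\<^sup>2 / \<kappa>\<^sup>2) - 4 * K * (norm (pd (e i) (pd v u) 0))\<^sup>2))"
      by (rule jet2_eq[OF jet2_diff[OF jet2_diff[OF jet2_norm2[OF w] jet2_norm2[OF ta]] R]])
         (simp_all add: K_def du0 inner_add_right Va)
    have "\<forall>\<^sub>F t in nhds 0. ((norm (w t))\<^sup>2 - (norm (t *\<^sub>R a i))\<^sup>2) - R t \<le> 0"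
      using sep_eventually[OF z0, of i]
    proof eventually_elim
      case (elim t)
      let ?x = "t *\<^sub>R e i"
      have du: "u differentiable (at ?x)" using elim by (intro smooth_differentiable[OF u]) simp
      have "w t = pd v (pd v u) ?x + pd (t *\<^sub>R a i) u ?x" by (simp add: w_def pd_scale[OF du])
      then have "(k - sep xq y ?x)\<^sup>2 * ((norm (w t))\<^sup>2 - (norm (t *\<^sub>R a i))\<^sup>2) \<le> (\<kappa>\<^sup>2 * K) * (g t * g t)"
        using max[of ?x v "t *\<^sub>R a i"] elim
        by (simp only: \<kappa>_def K_def V_def g_def v power_one power2_eq_square[of "1 - _"])
      moreover have "(k - sep xq y ?x)\<^sup>2 > 0" using elim by simp
      ultimately have "(norm (w t))\<^sup>2 - (norm (t *\<^sub>R a i))\<^sup>2 \<le> ((\<kappa>\<^sup>2 * K) * (g t * g t)) / (k - sep xq y ?x)\<^sup>2"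
        by (simp only: pos_le_divide_eq mult.commute)
      then show ?case by (simp only: R_def divide_inverse diff_le_0_iff_le mult.assoc)
    qed
    from jet2_max(2)[OF \<phi> this] show ?thesis by simp
  qed
  define S3 where "S3 = (\<Sum>i\<in>UNIV. (norm (pd (e i) (pd v u) 0))\<^sup>2)"
  \<comment> \<open>maximality among the directions at the origin\<close>
  have Vw: "V \<bullet> pd w (pd w u) 0 \<le> K * (norm w)\<^sup>2" for w
  proof -
    have "\<kappa>\<^sup>2 * (norm (pd w (pd w u) 0))\<^sup>2 \<le> \<kappa>\<^sup>2 * (norm V * (norm w)\<^sup>2)\<^sup>2"
      using max[OF ball_r(2) z0, of w 0] by (simp add: du0 \<kappa>_def V_def power_mult_distrib power2_eq_square mult_ac)
    then have "(norm (pd w (pd w u) 0))\<^sup>2 \<le> (norm V * (norm w)\<^sup>2)\<^sup>2"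
      using \<kappa>0 by (simp add: mult_le_cancel_left_pos)
    then have "norm (pd w (pd w u) 0) \<le> norm V * (norm w)\<^sup>2" by (rule power2_le_imp_le) simp
    then have "norm V * norm (pd w (pd w u) 0) \<le> norm V * (norm V * (norm w)\<^sup>2)" by (intro mult_left_mono) auto
    with norm_cauchy_schwarz[of V "pd w (pd w u) 0"] show ?thesis by (simp add: K_def power2_eq_square mult_ac)
  qed
  have quartic: "(\<Sum>i\<in>UNIV. V \<bullet> pd (e i) (pd (e i) (pd v (pd v u))) 0) \<ge> - 2 * K * S3"
  proof -
    define W where "W i = pd v (pd (e i) u) 0" for i
    have "(\<Sum>i\<in>UNIV. pd (e i) (pd (e i) (pd v (pd v u))) 0)
        = - (\<Sum>i\<in>UNIV. \<Sum>j\<in>UNIV. (2 * (W i \<bullet> W j)) *\<^sub>R pd (e i) (pd (e j) u) 0)"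
      using equation_derivatives(3)[of v] by (simp add: commute4[of v] W_def eq_neg_iff_add_eq_0)
    then have "(\<Sum>i\<in>UNIV. V \<bullet> pd (e i) (pd (e i) (pd v (pd v u))) 0)
        = - 2 * (\<Sum>i\<in>UNIV. \<Sum>j\<in>UNIV. (W i \<bullet> W j) * (V \<bullet> pd (e i) (pd (e j) u) 0))"
      by (simp add: inner_sum_right[symmetric] inner_minus_right)
         (simp add: inner_sum_right sum_distrib_left mult_ac)
    moreover have "(\<Sum>i\<in>UNIV. \<Sum>j\<in>UNIV. (W i \<bullet> W j) * (V \<bullet> pd (e i) (pd (e j) u) 0)) \<le> K * S3"
    proof -
      define w where "w \<alpha> = (\<chi> i. W i $ \<alpha>)" for \<alpha> :: 'n
      have "(\<Sum>i\<in>UNIV. \<Sum>j\<in>UNIV. (W i \<bullet> W j) * (V \<bullet> pd (e i) (pd (e j) u) 0))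
         = (\<Sum>i\<in>UNIV. \<Sum>j\<in>UNIV. \<Sum>\<alpha>\<in>UNIV. (w \<alpha> $ i * w \<alpha> $ j) * (V \<bullet> pd (e i) (pd (e j) u) 0))"
        by (simp add: inner_vec_def w_def sum_distrib_right)
      also have "\<dots> = (\<Sum>i\<in>UNIV. \<Sum>\<alpha>\<in>UNIV. \<Sum>j\<in>UNIV. (w \<alpha> $ i * w \<alpha> $ j) * (V \<bullet> pd (e i) (pd (e j) u) 0))"
        by (intro sum.cong refl sum.swap)
      also have "\<dots> = (\<Sum>\<alpha>\<in>UNIV. \<Sum>i\<in>UNIV. \<Sum>j\<in>UNIV. (w \<alpha> $ i * w \<alpha> $ j) * (V \<bullet> pd (e i) (pd (e j) u) 0))"
        by (rule sum.swap)
      also have "\<dots> = (\<Sum>\<alpha>\<in>UNIV. V \<bullet> pd (w \<alpha>) (pd (w \<alpha>) u) 0)"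
        by (simp add: second_expand inner_sum_right)
      also have "\<dots> \<le> (\<Sum>\<alpha>\<in>UNIV. K * (norm (w \<alpha>))\<^sup>2)" by (intro sum_mono Vw)
      also have "\<dots> = K * (\<Sum>\<alpha>\<in>UNIV. \<Sum>i\<in>UNIV. (W i $ \<alpha>)\<^sup>2)"
        unfolding power2_norm_eq_inner by (simp add: sum_distrib_left inner_vec_def w_def power2_eq_square)
      also have "(\<Sum>\<alpha>\<in>UNIV. \<Sum>i\<in>UNIV. (W i $ \<alpha>)\<^sup>2) = (\<Sum>i\<in>UNIV. \<Sum>\<alpha>\<in>UNIV. (W i $ \<alpha>)\<^sup>2)" by (rule sum.swap)
      also have "\<dots> = S3"
        unfolding S3_def power2_norm_eq_inner inner_vec_def by (simp add: W_def commute2[of v] power2_eq_square)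
      finally show ?thesis .
    qed
    ultimately show ?thesis by simp
  qed
  have aK: "K\<^sup>2 \<le> (\<Sum>i\<in>UNIV. (norm (a i))\<^sup>2)"
  proof -
    define g where "g = (\<chi> i. v \<bullet> a i)"
    have "K = V \<bullet> pd v (pd v u) 0" by (simp add: K_def V_def power2_norm_eq_inner)
    also have "\<dots> = (\<Sum>i\<in>UNIV. \<Sum>j\<in>UNIV. (v $ i * v $ j) * (V \<bullet> pd (e i) (pd (e j) u) 0))"
      by (simp add: second_expand inner_sum_right)
    also have "\<dots> = v \<bullet> g"
      by (simp add: g_def a_def inner_vec_def sum_distrib_left commute2[of "e _" "e _"] mult_ac)
    also have "\<dots> \<le> norm v * norm g" by (rule norm_cauchy_schwarz)
    finally have "K\<^sup>2 \<le> (norm g)\<^sup>2" using K0 v by (intro power_mono) auto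
    also have "(norm g)\<^sup>2 = (\<Sum>i\<in>UNIV. (v \<bullet> a i)\<^sup>2)"
      unfolding power2_norm_eq_inner inner_vec_def by (simp add: g_def inner_vec_def power2_eq_square)
    also have "\<dots> \<le> (\<Sum>i\<in>UNIV. (norm (a i))\<^sup>2)"
    proof (rule sum_mono)
      fix i show "(v \<bullet> a i)\<^sup>2 \<le> (norm (a i))\<^sup>2"
        using Cauchy_Schwarz_ineq[of v "a i"] v by (simp add: power2_norm_eq_inner[symmetric])
    qed
    finally show ?thesis .
  qed
  have "(\<Sum>i\<in>UNIV. 2 * (norm (pd (e i) (pd v (pd v u)) 0))\<^sup>2 + 2 * (V \<bullet> pd (e i) (pd (e i) (pd v (pd v u))) 0) + 2 * (norm (a i))\<^sup>2)
     \<le> (\<Sum>i\<in>UNIV. K * (2 * Z2 i / \<kappa> + 6 * (Z1 i)\<^sup>2 / \<kappa>\<^sup>2) - 4 * K * (norm (pd (e i) (pd v u) 0))\<^sup>2)"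
    by (intro sum_mono second_order)
  moreover have "(\<Sum>i\<in>UNIV. K * (2 * Z2 i / \<kappa> + 6 * (Z1 i)\<^sup>2 / \<kappa>\<^sup>2) - 4 * K * (norm (pd (e i) (pd v u) 0))\<^sup>2)
     = K * (2 * (2 * m) / \<kappa> + 6 * (4 * X) / \<kappa>\<^sup>2) - 4 * K * S3"
    using sep_sums(1)[of y] sep_sums(2)[of xq]
    by (simp add: sum_subtractf sum.distrib sum_distrib_left[symmetric] sum_divide_distrib[symmetric] Z1_def Z2_def m_def X_def S3_def)
  moreover have "(\<Sum>i\<in>UNIV. 2 * (norm (pd (e i) (pd v (pd v u)) 0))\<^sup>2 + 2 * (V \<bullet> pd (e i) (pd (e i) (pd v (pd v u))) 0) + 2 * (norm (a i))\<^sup>2)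
     = 2 * (\<Sum>i\<in>UNIV. (norm (pd (e i) (pd v (pd v u)) 0))\<^sup>2) + 2 * (\<Sum>i\<in>UNIV. V \<bullet> pd (e i) (pd (e i) (pd v (pd v u))) 0)
       + 2 * (\<Sum>i\<in>UNIV. (norm (a i))\<^sup>2)"
    by (simp add: sum.distrib sum_distrib_left)
  moreover have "(\<Sum>i\<in>UNIV. (norm (pd (e i) (pd v (pd v u)) 0))\<^sup>2) \<ge> 0" by (intro sum_nonneg) simp
  ultimately have "2 * K\<^sup>2 \<le> K * (2 * (2 * m) / \<kappa> + 6 * (4 * X) / \<kappa>\<^sup>2)"
    using quartic aK by linarith
  then have "K * (2 * K) \<le> K * (2 * (2 * m) / \<kappa> + 6 * (4 * X) / \<kappa>\<^sup>2)" by (simp add: power2_eq_square)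
  then have "2 * K \<le> 2 * (2 * m) / \<kappa> + 6 * (4 * X) / \<kappa>\<^sup>2" using K0 by (simp only: mult_le_cancel_left_pos)
  then have "2 * K * \<kappa>\<^sup>2 \<le> (2 * (2 * m) / \<kappa> + 6 * (4 * X) / \<kappa>\<^sup>2) * \<kappa>\<^sup>2" by (intro mult_right_mono) auto
  also have "\<dots> = 4 * m * \<kappa> + 24 * X" using \<kappa>0 by (simp add: field_simps power2_eq_square)
  finally show ?thesis by (simp add: m_def \<kappa>_def X_def K_def V_def mult.commute)
qed

end

section \<open>Closed space-like submanifolds are entire graphs\<close>

text \<open>
  The mean value inequality holds with the derivative at one intermediate point, which keeps it strict.
\<close>

lemma strict_contraction:
  fixes u :: "'a::euclidean_space \<Rightarrow> 'b::euclidean_space"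
  assumes C: "convex C" and u: "\<And>x. x \<in> C \<Longrightarrow> u differentiable (at x)"
    and contr: "\<And>x v. x \<in> C \<Longrightarrow> v \<noteq> 0 \<Longrightarrow> norm (pd v u x) < norm v"
    and xy: "x \<in> C" "y \<in> C" "x \<noteq> y"
  shows "norm (u y - u x) < norm (y - x)"
proof -
  define g where "g t = u (x + t *\<^sub>R (y - x))" for t :: real
  have inC: "x + t *\<^sub>R (y - x) \<in> C" if "0 \<le> t" "t \<le> 1" for t
  proof -
    have "(1 - t) *\<^sub>R x + t *\<^sub>R y \<in> C" using C xy that by (intro convexD_alt) auto
    then show ?thesis by (simp add: algebra_simps)
  qed
  have dg: "(g has_vector_derivative pd (y - x) u (x + t *\<^sub>R (y - x))) (at t)" if "0 \<le> t" "t \<le> 1" for t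
    unfolding g_def by (rule line_derivative[OF u[OF inC[OF that]]])
  have "continuous_on {0..1} g"
  proof (rule continuous_at_imp_continuous_on, rule ballI)
    fix t :: real assume "t \<in> {0..1}"
    then show "isCont g t" using has_vector_derivative_continuous[OF dg[of t]] by simp
  qed
  then have "\<exists>t\<in>{0<..<1}. norm (g 1 - g 0) \<le> norm ((1 - 0) *\<^sub>R pd (y - x) u (x + t *\<^sub>R (y - x)))"
    by (rule mvt_general[OF zero_less_one]) (use dg in \<open>simp add: has_vector_derivative_def\<close>)
  then obtain t where t: "t \<in> {0<..<1}" "norm (g 1 - g 0) \<le> norm ((1 - 0) *\<^sub>R pd (y - x) u (x + t *\<^sub>R (y - x)))"
    by blast
  note t(2)
  also have "\<dots> < norm (y - x)" using contr[OF inC[of t], of "y - x"] t(1) xy(3) by simp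
  finally show ?thesis by (simp add: g_def)
qed

locale space_like_submanifold =
  fixes M :: "((real^'m) \<times> (real^'n)) set"
  assumes smooth: "smooth_submanifold M" and space_like: "space_like M"
begin

text \<open>
  Continuous sections of the projection of \<open>M\<close> to the space of the \<open>x\<close>.
\<close>

definition lift_on :: "(real^'m) set \<Rightarrow> (real^'m \<Rightarrow> real^'n) \<Rightarrow> bool" where
  "lift_on C u \<longleftrightarrow> continuous_on C u \<and> (\<forall>x\<in>C. (x, u x) \<in> M)"

lemma lift_on_subset: "lift_on C u \<Longrightarrow> C' \<subseteq> C \<Longrightarrow> lift_on C' u"
  unfolding lift_on_def using continuous_on_subset by blast

lemma lift_local:
  assumes u: "lift_on C u" and x: "x \<in> C"
    and W: "open W" "(x, u x) \<in> W" "M \<inter> W = graph_over B w"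
  obtains \<delta> where "\<delta> > 0" "\<And>x'. x' \<in> C \<Longrightarrow> dist x' x < \<delta> \<Longrightarrow> u x' = w x' \<and> x' \<in> B"
proof -
  have "continuous_on C (\<lambda>x. (x, u x))"
    using u by (intro continuous_on_Pair continuous_on_id) (simp add: lift_on_def)
  from continuous_on_topological[THEN iffD1, OF this, rule_format, OF x W(1,2)]
  obtain T where T: "open T" "x \<in> T" and TW: "\<forall>x'\<in>C. x' \<in> T \<longrightarrow> (x', u x') \<in> W" by blast
  from T obtain \<delta> where \<delta>: "\<delta> > 0" "ball x \<delta> \<subseteq> T" by (rule openE)
  show ?thesis
  proof (rule that[OF \<delta>(1)])
    fix x' assume x': "x' \<in> C" "dist x' x < \<delta>"
    then have "x' \<in> ball x \<delta>" by (simp add: dist_commute)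
    then have "x' \<in> T" using \<delta>(2) by blast
    then have "(x', u x') \<in> W" using TW x' by blast
    moreover have "(x', u x') \<in> M" using u x' by (simp add: lift_on_def)
    ultimately have "(x', u x') \<in> graph_over B w" unfolding W(3)[symmetric] by simp
    then show "u x' = w x' \<and> x' \<in> B" by (auto simp: graph_over_def)
  qed
qed

lemma local_graph_at:
  assumes "(x, y) \<in> M"
  obtains W r w where "open W" "(x, y) \<in> W" "r > 0" "smooth_on (ball x r) w" "M \<inter> W = graph_over (ball x r) w"
    "lift_on (ball x r) w" "w x = y"
proof -
  obtain W r w where W: "open W" "(x, y) \<in> W" "r > 0" "smooth_on (ball x r) w" "M \<inter> W = graph_over (ball x r) w"
    using local_graph[OF smooth space_like assms] unfolding fst_conv by blast
  have "(x', w x') \<in> M" if "x' \<in> ball x r" for x'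
  proof -
    have "(x', w x') \<in> graph_over (ball x r) w" using that by (simp add: graph_over_def)
    then show ?thesis unfolding W(5)[symmetric] by simp
  qed
  then have l: "lift_on (ball x r) w" unfolding lift_on_def using smooth_continuous[OF W(4)] by blast
  have "(x, y) \<in> graph_over (ball x r) w" unfolding W(5)[symmetric] using assms W(2) by simp
  then have "w x = y" by (auto simp: graph_over_def)
  with W l show ?thesis using that by blast
qed

text \<open>
  Near a point of \<open>M\<close> the projection is injective, so the set where two lifts agree is open.
\<close>

lemma lift_unique:
  assumes u: "lift_on C u1" "lift_on C u2" and C: "connected C" and x: "x \<in> C" "u1 x = u2 x" and y: "y \<in> C"
  shows "u1 y = u2 y"
proof -
  define E where "E = {x \<in> C. u1 x = u2 x}"
  have "closedin (top_of_set C) E"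
  proof -
    have "continuous_on C (\<lambda>x. u1 x - u2 x)" using u by (intro continuous_on_diff) (simp_all add: lift_on_def)
    from continuous_closedin_preimage_constant[OF this, of 0] show ?thesis by (simp add: E_def)
  qed
  moreover have "openin (top_of_set C) E"
    unfolding openin_contains_ball
  proof (intro conjI ballI)
    show "E \<subseteq> C" by (auto simp: E_def)
    fix x assume "x \<in> E"
    then have x: "x \<in> C" "u1 x = u2 x" by (simp_all add: E_def)
    then have "(x, u1 x) \<in> M" using u(1) unfolding lift_on_def by blast
    then obtain W r w where W: "open W" "(x, u1 x) \<in> W" "M \<inter> W = graph_over (ball x r) w"
      by (rule local_graph_at)
    obtain d1 where d1: "d1 > 0" "\<And>x'. x' \<in> C \<Longrightarrow> dist x' x < d1 \<Longrightarrow> u1 x' = w x' \<and> x' \<in> ball x r"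
      using lift_local[OF u(1) x(1) W] by blast
    obtain d2 where d2: "d2 > 0" "\<And>x'. x' \<in> C \<Longrightarrow> dist x' x < d2 \<Longrightarrow> u2 x' = w x' \<and> x' \<in> ball x r"
      using lift_local[OF u(2) x(1) W(1) _ W(3)] W(2) x(2) by metis
    show "\<exists>e>0. ball x e \<inter> C \<subseteq> E"
      by (rule exI[of _ "min d1 d2"]) (use d1 d2 in \<open>auto simp: E_def dist_commute\<close>)
  qed
  ultimately have "E = C" using C x connected_clopen[of C] by (auto simp: E_def)
  then show ?thesis using y by (auto simp: E_def)
qed

lemma lift_smooth:
  assumes u: "lift_on C u" and C: "open C"
  shows "smooth_on C u" "x \<in> C \<Longrightarrow> v \<noteq> 0 \<Longrightarrow> norm (pd v u x) < norm v"
proof -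
  have loc: "\<exists>T. open T \<and> x \<in> T \<and> smooth_on T u \<and> (\<forall>v. v \<noteq> 0 \<longrightarrow> norm (pd v u x) < norm v)" if x: "x \<in> C" for x
  proof -
    have "(x, u x) \<in> M" using u x by (simp add: lift_on_def)
    then obtain W r w where W: "open W" "(x, u x) \<in> W" "r > 0" "smooth_on (ball x r) w" "M \<inter> W = graph_over (ball x r) w"
      by (rule local_graph_at)
    obtain \<delta> where \<delta>: "\<delta> > 0" "\<And>x'. x' \<in> C \<Longrightarrow> dist x' x < \<delta> \<Longrightarrow> u x' = w x' \<and> x' \<in> ball x r"
      using lift_local[OF u x W(1,2,5)] by blast
    define T where "T = C \<inter> ball x \<delta>"
    have T: "open T" "x \<in> T" using C x \<delta>(1) by (auto simp: T_def)
    have Tw: "u x' = w x'" "x' \<in> ball x r" if "x' \<in> T" for x'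
      using \<delta>(2)[of x'] that by (auto simp: T_def dist_commute)
    have "smooth_on T w" by (rule smooth_subset[OF W(4)]) (use Tw in blast)
    then have "smooth_on T u" using smooth_cong[OF T(1), of u w] Tw(1) by blast
    moreover have "norm (pd v u x) < norm v" if "v \<noteq> 0" for v
    proof -
      have "pd v u x = pd v w x" by (rule pd_cong_open(1)[OF T]) (rule Tw(1))
      then show ?thesis
        using space_like_graph[OF open_ball W(4,1,5) _ space_like that, of x] W(3) by simp
    qed
    ultimately show ?thesis using T by blast
  qed
  show "smooth_on C u" by (rule smooth_local) (use loc in blast)
  show "norm (pd v u x) < norm v" if "x \<in> C" "v \<noteq> 0" using loc[OF that(1)] that(2) by blast
qed

lemma lift_contraction:
  assumes "lift_on C u" "open C" "convex C" "x \<in> C" "y \<in> C"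
  shows "norm (u y - u x) \<le> norm (y - x)"
proof (cases "x = y")
  case False
  have "u differentiable (at z)" if "z \<in> C" for z
    by (rule smooth_differentiable[OF lift_smooth(1)[OF assms(1,2)] that])
  from strict_contraction[OF assms(3) this lift_smooth(2)[OF assms(1,2)] assms(4,5) False]
  show ?thesis by simp
qed simp

lemma lift_glue:
  assumes u: "lift_on A u" "open A" "convex A" and w: "lift_on B w" "open B" "convex B"
    and x: "x \<in> A" "x \<in> B" "u x = w x"
  shows "lift_on (A \<union> B) (\<lambda>x. if x \<in> A then u x else w x)"
proof -
  let ?g = "\<lambda>x. if x \<in> A then u x else w x"
  have conn: "connected (A \<inter> B)" using u(3) w(3) by (intro convex_connected convex_Int)
  have agree: "u y = w y" if "y \<in> A \<inter> B" for y
    using lift_unique[OF lift_on_subset[OF u(1)] lift_on_subset[OF w(1)] conn _ x(3) that] x by blast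
  have "continuous_on A ?g"
    using u(1) by (simp add: lift_on_def cong: continuous_on_cong)
  moreover have "continuous_on B ?g"
  proof -
    have "continuous_on B w" using w(1) by (simp add: lift_on_def)
    then show ?thesis by (rule continuous_on_eq) (use agree in auto)
  qed
  ultimately have "continuous_on (A \<union> B) ?g" by (intro continuous_on_open_Un u(2) w(2))
  then show ?thesis using u(1) w(1) by (auto simp: lift_on_def)
qed

text \<open>
  Convexity of these neighbourhoods of a segment makes lifts over two of them agree on the intersection as soon as they agree at one point.
\<close>

definition tube :: "real^'m \<Rightarrow> real^'m \<Rightarrow> real \<Rightarrow> (real^'m) set" where
  "tube x0 x \<epsilon> = {a + b | a b. a \<in> closed_segment x0 x \<and> b \<in> ball 0 \<epsilon>}"

lemma tube: "open (tube x0 x \<epsilon>)" "convex (tube x0 x \<epsilon>)"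
  "\<epsilon> > 0 \<Longrightarrow> a \<in> closed_segment x0 x \<Longrightarrow> a \<in> tube x0 x \<epsilon>"
proof -
  have eq: "tube x0 x \<epsilon> = (\<Union>a\<in>closed_segment x0 x. \<Union>b\<in>ball 0 \<epsilon>. {a + b})"
    unfolding tube_def by blast
  show "open (tube x0 x \<epsilon>)" unfolding eq by (rule open_sums) simp
  show "convex (tube x0 x \<epsilon>)" unfolding eq by (intro convex_sums convex_closed_segment convex_ball)
  show "a \<in> tube x0 x \<epsilon>" if "\<epsilon> > 0" "a \<in> closed_segment x0 x"
    using that unfolding tube_def by (intro CollectI exI[of _ a] exI[of _ 0]) auto
qed

lemma tube_perturb:
  assumes "dist x' x < \<epsilon> / 2" shows "tube x0 x' (\<epsilon> / 2) \<subseteq> tube x0 x \<epsilon>"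
proof
  fix y assume "y \<in> tube x0 x' (\<epsilon> / 2)"
  then obtain a b where y: "y = a + b" "a \<in> closed_segment x0 x'" "norm b < \<epsilon> / 2" by (auto simp: tube_def)
  then obtain s where s: "0 \<le> s" "s \<le> 1" "a = (1 - s) *\<^sub>R x0 + s *\<^sub>R x'" by (auto simp: in_segment)
  define a' where "a' = (1 - s) *\<^sub>R x0 + s *\<^sub>R x"
  have "norm (s *\<^sub>R (x' - x) + b) \<le> norm (s *\<^sub>R (x' - x)) + norm b" by (rule norm_triangle_ineq)
  also have "norm (s *\<^sub>R (x' - x)) \<le> 1 * norm (x' - x)" using s by (simp add: mult_left_le_one_le)
  finally have "norm (s *\<^sub>R (x' - x) + b) < \<epsilon>" using assms y(3) by (simp add: dist_norm)
  moreover have "y = a' + (s *\<^sub>R (x' - x) + b)" by (simp add: y s a'_def algebra_simps)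
  moreover have "a' \<in> closed_segment x0 x" using s by (auto simp: a'_def in_segment)
  ultimately show "y \<in> tube x0 x \<epsilon>" unfolding tube_def by (intro CollectI exI[of _ a'] exI[of _ "s *\<^sub>R (x' - x) + b"]) auto
qed

text \<open>
  Let \<open>D\<close> be the set of the \<open>x\<close> such that a lift through \<open>(x0, y0)\<close> exists over some tube around the segment from \<open>x0\<close> to \<open>x\<close>.
  By uniqueness these lifts fit together to a lift over \<open>D\<close>, and \<open>D\<close> is open. On a segment that leaves \<open>D\<close>, consider the first
  point outside of \<open>D\<close>. Lifts are contractions, so the lift converges there; the limit lies in the closed set \<open>M\<close>, and a
  local graph around it continues the lift, a contradiction.
\<close>

lemma entire_lift:
  assumes closed: "closed M" and p: "(x0, y0) \<in> M"
  obtains s where "lift_on UNIV s" "s x0 = y0"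
proof -
  define L where "L x \<epsilon> u \<longleftrightarrow> \<epsilon> > 0 \<and> lift_on (tube x0 x \<epsilon>) u \<and> u x0 = y0" for x \<epsilon> u
  define D where "D = {x. \<exists>\<epsilon> u. L x \<epsilon> u}"
  have ends: "x0 \<in> tube x0 x \<epsilon>" "x \<in> tube x0 x \<epsilon>" if "\<epsilon> > 0" for x \<epsilon>
    using tube(3)[OF that] by auto
  have agree: "u y = u' y" if "L x \<epsilon> u" "L x' \<epsilon>' u'" "y \<in> tube x0 x \<epsilon>" "y \<in> tube x0 x' \<epsilon>'" for x x' \<epsilon> \<epsilon>' u u' y
  proof -
    have conn: "connected (tube x0 x \<epsilon> \<inter> tube x0 x' \<epsilon>')" by (intro convex_connected convex_Int tube(2))
    have l: "lift_on (tube x0 x \<epsilon> \<inter> tube x0 x' \<epsilon>') u" "lift_on (tube x0 x \<epsilon> \<inter> tube x0 x' \<epsilon>') u'"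
      using that(1,2) lift_on_subset by (auto simp: L_def)
    show ?thesis
      by (rule lift_unique[OF l conn, of x0]) (use that ends in \<open>auto simp: L_def\<close>)
  qed
  \<comment> \<open>the choice is immaterial, as all lifts over tubes agree\<close>
  define s where "s x = (SOME y. \<exists>\<epsilon> u. L x \<epsilon> u \<and> y = u x)" for x
  have s: "s x = u x" if "L x \<epsilon> u" for x \<epsilon> u
  proof -
    have "\<exists>\<epsilon> u'. L x \<epsilon> u' \<and> s x = u' x" unfolding s_def by (rule someI_ex) (use that in blast)
    then obtain \<epsilon>' u' where *: "L x \<epsilon>' u'" "s x = u' x" by blast
    then show ?thesis using agree[OF *(1) that] ends that by (simp add: L_def)
  qed
  have near: "L x' (\<epsilon> / 2) u" if "L x \<epsilon> u" "dist x' x < \<epsilon> / 2" for x x' \<epsilon> u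
    using that tube_perturb[OF that(2)] lift_on_subset by (auto simp: L_def)
  have oD: "open D"
    unfolding open_dist
  proof
    fix x assume "x \<in> D"
    then obtain \<epsilon> u where L: "L x \<epsilon> u" by (auto simp: D_def)
    have "y \<in> D" if "dist y x < \<epsilon> / 2" for y
      using near[OF L that] unfolding D_def by blast
    moreover have "\<epsilon> / 2 > 0" using L by (simp add: L_def)
    ultimately show "\<exists>e>0. \<forall>y. dist y x < e \<longrightarrow> y \<in> D" by blast
  qed
  have "x \<in> D" for x
  proof (rule ccontr)
    assume xD: "x \<notin> D"
    define pt where "pt t = x0 + t *\<^sub>R (x - x0)" for t :: real
    have cont_pt: "continuous_on S pt" for S unfolding pt_def by (intro continuous_intros)
    define I where "I = {t \<in> {0..1}. pt t \<in> - D}"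
    have "compact I"
    proof -
      have "closed ({0..1} \<inter> pt -` (- D))"
        by (rule continuous_closed_preimage[OF cont_pt]) (use oD in auto)
      moreover have "I = {0..1} \<inter> pt -` (- D)" by (auto simp: I_def)
      ultimately have "closed I" by simp
      moreover have "bounded I" by (rule bounded_subset[of "{0..1}"]) (auto simp: I_def)
      ultimately show ?thesis by (simp add: compact_eq_bounded_closed)
    qed
    moreover have "1 \<in> I" using xD by (simp add: I_def pt_def)
    ultimately obtain \<tau> where \<tau>: "\<tau> \<in> I" "\<And>t. t \<in> I \<Longrightarrow> \<tau> \<le> t" using compact_attains_inf[of I] by blast
    have before: "pt t \<in> D" if "0 \<le> t" "t < \<tau>" for t
    proof (rule ccontr)
      assume "pt t \<notin> D"
      then have "t \<in> I" using that \<tau>(1) by (auto simp: I_def)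
      then show False using \<tau>(2) that by force
    qed
    have "x0 \<in> D"
    proof -
      obtain W r w where "r > 0" "lift_on (ball x0 r) w" "w x0 = y0" using local_graph_at[OF p] by metis
      moreover have "tube x0 x0 r = ball x0 r"
      proof -
        have "y = x0 + (y - x0) \<and> y - x0 \<in> ball 0 r" if "y \<in> ball x0 r" for y
          using that by (simp add: dist_norm norm_minus_commute)
        moreover have "x0 + b \<in> ball x0 r" if "b \<in> ball 0 r" for b
          using that by (simp add: dist_norm)
        ultimately show ?thesis unfolding tube_def closed_segment_idem by blast
      qed
      ultimately have "L x0 r w" by (simp add: L_def)
      then show ?thesis unfolding D_def by blast
    qed
    then have "0 \<notin> I" by (simp add: I_def pt_def)
    then have \<tau>0: "\<tau> > 0" using \<tau>(1) by (cases "\<tau> = 0") (auto simp: I_def)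
    have on_seg: "pt t \<in> closed_segment x0 (pt t')" if "0 \<le> t" "t \<le> t'" "t' > 0" for t t'
    proof -
      have "pt t = (1 - t / t') *\<^sub>R x0 + (t / t') *\<^sub>R pt t'" using that by (simp add: pt_def algebra_simps)
      moreover have "0 \<le> t / t'" "t / t' \<le> 1" using that by auto
      ultimately show ?thesis unfolding in_segment by blast
    qed
    have lip: "norm (s (pt t') - s (pt t)) \<le> norm (pt t' - pt t)" if tt: "0 \<le> t" "t \<le> t'" "t' < \<tau>" "t' > 0" for t t'
    proof -
      obtain \<epsilon> u where L: "L (pt t') \<epsilon> u" using before[of t'] tt by (auto simp: D_def)
      then have \<epsilon>: "\<epsilon> > 0" and l: "lift_on (tube x0 (pt t') \<epsilon>) u" by (auto simp: L_def)
      have "s (pt t) = u (pt t)"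
      proof -
        obtain \<epsilon>2 u2 where L2: "L (pt t) \<epsilon>2 u2" using before[of t] tt by (auto simp: D_def)
        have "u2 (pt t) = u (pt t)"
          by (rule agree[OF L2 L]) (use L2 \<epsilon> on_seg[OF tt(1,2,4)] in \<open>auto simp: L_def intro: tube(3) ends\<close>)
        then show ?thesis by (simp add: s[OF L2])
      qed
      moreover have "s (pt t') = u (pt t')" by (rule s[OF L])
      moreover have "norm (u (pt t') - u (pt t)) \<le> norm (pt t' - pt t)"
        by (rule lift_contraction[OF l tube(1,2)]) (use \<epsilon> on_seg[OF tt(1,2,4)] in \<open>auto intro: tube(3)\<close>)
      ultimately show ?thesis by simp
    qed
    have lip2: "dist (s (pt t)) (s (pt t')) \<le> dist (pt t) (pt t')" if "0 < t" "t < \<tau>" "0 < t'" "t' < \<tau>" for t t'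
      using lip[of t t'] lip[of t' t] that by (cases "t \<le> t'") (simp_all add: dist_norm norm_minus_commute)
    define tn where "tn n = \<tau> * (1 - 1 / real (n + 2))" for n :: nat
    have tn: "0 < tn n" "tn n < \<tau>" for n using \<tau>0 by (auto simp: tn_def)
    have tn_lim: "tn \<longlonglongrightarrow> \<tau>"
    proof -
      have "(\<lambda>n. 1 / real (n + 2)) \<longlonglongrightarrow> 0" by (rule LIMSEQ_ignore_initial_segment[OF lim_1_over_n])
      then have "tn \<longlonglongrightarrow> \<tau> * (1 - 0)" unfolding tn_def by (intro tendsto_intros)
      then show ?thesis by simp
    qed
    then have pt_lim: "(\<lambda>n. pt (tn n)) \<longlonglongrightarrow> pt \<tau>" unfolding pt_def by (intro tendsto_intros)
    then have "Cauchy (\<lambda>n. pt (tn n))" by (rule LIMSEQ_imp_Cauchy)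
    then have "Cauchy (\<lambda>n. s (pt (tn n)))"
      unfolding Cauchy_def using lip2[OF tn tn] by (meson order_le_less_trans)
    then obtain yt where yt: "(\<lambda>n. s (pt (tn n))) \<longlonglongrightarrow> yt" using Cauchy_convergent_iff convergent_def by blast
    have inM: "(pt (tn n), s (pt (tn n))) \<in> M" for n
    proof -
      obtain \<epsilon> u where L: "L (pt (tn n)) \<epsilon> u" using before[of "tn n"] tn[of n] by (auto simp: D_def)
      then show ?thesis using ends(2) by (simp add: s[OF L] L_def lift_on_def)
    qed
    have lim: "(\<lambda>n. (pt (tn n), s (pt (tn n)))) \<longlonglongrightarrow> (pt \<tau>, yt)" by (intro tendsto_Pair pt_lim yt)
    have "(pt \<tau>, yt) \<in> M" by (rule closed_sequentially[OF closed inM lim])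
    then obtain W r w where W: "open W" "(pt \<tau>, yt) \<in> W" "r > 0" "M \<inter> W = graph_over (ball (pt \<tau>) r) w"
      and lw: "lift_on (ball (pt \<tau>) r) w" by (rule local_graph_at)
    have "eventually (\<lambda>n. (pt (tn n), s (pt (tn n))) \<in> W) sequentially" by (rule topological_tendstoD[OF lim W(1,2)])
    then obtain n where "(pt (tn n), s (pt (tn n))) \<in> W" by (auto simp: eventually_sequentially)
    then have "(pt (tn n), s (pt (tn n))) \<in> graph_over (ball (pt \<tau>) r) w" unfolding W(4)[symmetric] using inM by simp
    then have n: "pt (tn n) \<in> ball (pt \<tau>) r" "s (pt (tn n)) = w (pt (tn n))" by (auto simp: graph_over_def)
    obtain \<epsilon> u where L: "L (pt (tn n)) \<epsilon> u" using before[of "tn n"] tn[of n] by (auto simp: D_def)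
    then have \<epsilon>: "\<epsilon> > 0" and lu: "lift_on (tube x0 (pt (tn n)) \<epsilon>) u" and u0: "u x0 = y0" by (auto simp: L_def)
    let ?A = "tube x0 (pt (tn n)) \<epsilon>" and ?B = "ball (pt \<tau>) r"
    have "lift_on (?A \<union> ?B) (\<lambda>x. if x \<in> ?A then u x else w x)"
      by (rule lift_glue[OF lu tube(1,2) lw open_ball convex_ball ends(2)[OF \<epsilon>] n(1)]) (simp add: n(2)[symmetric] s[OF L])
    moreover define \<epsilon>' where "\<epsilon>' = min \<epsilon> (r - dist (pt \<tau>) (pt (tn n)))"
    have "tube x0 (pt \<tau>) \<epsilon>' \<subseteq> ?A \<union> ?B"
    proof
      fix y assume "y \<in> tube x0 (pt \<tau>) \<epsilon>'"
      then obtain a b where y: "y = a + b" "a \<in> closed_segment x0 (pt \<tau>)" "norm b < \<epsilon>'" by (auto simp: tube_def)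
      then obtain \<sigma> where \<sigma>: "0 \<le> \<sigma>" "\<sigma> \<le> 1" "a = (1 - \<sigma>) *\<^sub>R x0 + \<sigma> *\<^sub>R pt \<tau>" by (auto simp: in_segment)
      have a: "a = pt (\<sigma> * \<tau>)" by (simp add: \<sigma>(3) pt_def algebra_simps)
      show "y \<in> ?A \<union> ?B"
      proof (cases "\<sigma> * \<tau> \<le> tn n")
        case True
        then have "a \<in> closed_segment x0 (pt (tn n))" unfolding a using \<sigma>(1) \<tau>0 tn(1) by (intro on_seg) auto
        then have "y \<in> ?A" unfolding tube_def y(1) using y(3) by (auto simp: \<epsilon>'_def)
        then show ?thesis ..
      next
        case False
        have "\<sigma> * \<tau> \<le> 1 * \<tau>" using \<sigma>(2) \<tau>0 by (intro mult_right_mono) auto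
        have "norm (pt \<tau> - a) = norm ((\<tau> - \<sigma> * \<tau>) *\<^sub>R (x - x0))" unfolding a by (simp add: pt_def algebra_simps)
        also have "\<dots> = (\<tau> - \<sigma> * \<tau>) * norm (x - x0)" using \<open>\<sigma> * \<tau> \<le> 1 * \<tau>\<close> by simp
        also have "\<dots> \<le> (\<tau> - tn n) * norm (x - x0)" using False by (intro mult_right_mono) auto
        also have "\<dots> = norm ((\<tau> - tn n) *\<^sub>R (x - x0))" using tn(2)[of n] by simp
        also have "\<dots> = dist (pt \<tau>) (pt (tn n))" by (simp add: dist_norm pt_def algebra_simps)
        finally have "norm (pt \<tau> - a) \<le> dist (pt \<tau>) (pt (tn n))" .
        moreover have "norm (pt \<tau> - y) \<le> norm (pt \<tau> - a) + norm b"
          using norm_triangle_ineq4[of "pt \<tau> - a" b] by (simp add: y(1) algebra_simps)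
        ultimately have "y \<in> ?B" using y(3) by (simp add: \<epsilon>'_def dist_norm)
        then show ?thesis ..
      qed
    qed
    moreover have "\<epsilon>' > 0" using \<epsilon> n(1) by (simp add: \<epsilon>'_def)
    ultimately have "L (pt \<tau>) \<epsilon>' (\<lambda>x. if x \<in> ?A then u x else w x)"
      unfolding L_def using lift_on_subset ends(1)[OF \<epsilon>] u0 by simp
    then have "pt \<tau> \<in> D" by (auto simp: D_def)
    then show False using \<tau>(1) by (simp add: I_def)
  qed
  then have ex: "\<exists>\<epsilon> u. L x \<epsilon> u" for x by (auto simp: D_def)
  have "lift_on UNIV s"
    unfolding lift_on_def
  proof
    show "continuous_on UNIV s"
    proof (rule continuous_at_imp_continuous_on, rule ballI)
      fix x :: "real^'m"
      obtain \<epsilon> u where L: "L x \<epsilon> u" using ex by blast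
      then have \<epsilon>: "\<epsilon> > 0" and l: "lift_on (tube x0 x \<epsilon>) u" by (auto simp: L_def)
      have sub: "ball x (\<epsilon> / 2) \<subseteq> tube x0 x \<epsilon>"
      proof
        fix y assume "y \<in> ball x (\<epsilon> / 2)"
        then have "L y (\<epsilon> / 2) u" using near[OF L] by (simp add: dist_commute)
        then have "y \<in> tube x0 y (\<epsilon> / 2)" using ends(2) by (simp add: L_def)
        then show "y \<in> tube x0 x \<epsilon>" using tube_perturb[of y x \<epsilon> x0] \<open>y \<in> ball x (\<epsilon> / 2)\<close> by (auto simp: dist_commute)
      qed
      have "s y = u y" if "y \<in> ball x (\<epsilon> / 2)" for y
        by (rule s[OF near[OF L]]) (use that in \<open>simp add: dist_commute\<close>)
      moreover have "continuous_on (ball x (\<epsilon> / 2)) u"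
        using l sub continuous_on_subset by (auto simp: lift_on_def)
      ultimately have "continuous_on (ball x (\<epsilon> / 2)) s" using continuous_on_eq by metis
      then show "isCont s x" using \<epsilon> by (simp add: continuous_on_eq_continuous_at)
    qed
    show "\<forall>x\<in>UNIV. (x, s x) \<in> M"
    proof
      fix x :: "real^'m"
      obtain \<epsilon> u where L: "L x \<epsilon> u" using ex by blast
      then show "(x, s x) \<in> M" using ends(2) by (simp add: s[OF L] L_def lift_on_def)
    qed
  qed
  moreover have "s x0 = y0"
  proof -
    obtain \<epsilon> u where L: "L x0 \<epsilon> u" using ex by blast
    then show ?thesis by (simp add: s[OF L] L_def)
  qed
  ultimately show ?thesis by (rule that)
qed

text \<open>
  The graph of an entire lift is closed, and open in \<open>M\<close>.
\<close>

theorem entire_graph: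
  assumes closed: "closed M" and conn: "connected M" and ne: "M \<noteq> {}"
  obtains u where "smooth_on UNIV u" "M = graph_over UNIV u" "\<And>x v. v \<noteq> 0 \<Longrightarrow> norm (pd v u x) < norm v"
proof -
  obtain x0 y0 where p: "(x0, y0) \<in> M" using ne by auto
  obtain u where u: "lift_on UNIV u" "u x0 = y0" using entire_lift[OF closed p] by blast
  have cu: "continuous_on UNIV u" and sub: "graph_over UNIV u \<subseteq> M"
    using u(1) by (auto simp: lift_on_def graph_over_def)
  have "closed (graph_over UNIV u)"
  proof -
    have "graph_over UNIV u = {p. snd p = u (fst p)}" by (auto simp: graph_over_def image_iff)
    moreover have "closed {p. snd p = u (fst p)}"
      by (intro closed_Collect_eq continuous_on_snd continuous_on_id continuous_on_compose2[OF cu] continuous_on_fst) auto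
    ultimately show ?thesis by simp
  qed
  then have "closedin (top_of_set M) (graph_over UNIV u)" using sub by (simp add: closed_subset)
  moreover have "openin (top_of_set M) (graph_over UNIV u)"
    unfolding openin_contains_ball
  proof (intro conjI ballI)
    show "graph_over UNIV u \<subseteq> M" by fact
    fix p assume "p \<in> graph_over UNIV u"
    then obtain x where x: "p = (x, u x)" by (auto simp: graph_over_def)
    have "(x, u x) \<in> M" using u(1) by (simp add: lift_on_def)
    then obtain W r w where W: "open W" "(x, u x) \<in> W" "M \<inter> W = graph_over (ball x r) w" by (rule local_graph_at)
    obtain \<delta> where \<delta>: "\<delta> > 0" "\<And>x'. x' \<in> UNIV \<Longrightarrow> dist x' x < \<delta> \<Longrightarrow> u x' = w x' \<and> x' \<in> ball x r"
      using lift_local[OF u(1) UNIV_I W] by blast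
    obtain e where e: "e > 0" "ball p e \<subseteq> W" using W(1,2) x open_contains_ball by metis
    show "\<exists>e>0. ball p e \<inter> M \<subseteq> graph_over UNIV u"
    proof (intro exI conjI)
      show "min e \<delta> > 0" using e \<delta> by simp
      show "ball p (min e \<delta>) \<inter> M \<subseteq> graph_over UNIV u"
      proof
        fix q assume q: "q \<in> ball p (min e \<delta>) \<inter> M"
        then have "q \<in> graph_over (ball x r) w" unfolding W(3)[symmetric] using e(2) by auto
        then obtain x' where x': "q = (x', w x')" by (auto simp: graph_over_def)
        have "dist x' x \<le> dist q p" using dist_fst_le[of q p] by (simp add: x' x)
        then have "dist x' x < \<delta>" using q by (simp add: dist_commute)
        then have "q = (x', u x')" using \<delta>(2) x' by simp
        then show "q \<in> graph_over UNIV u" by (simp add: graph_over_def)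
      qed
    qed
  qed
  moreover have "graph_over UNIV u \<noteq> {}" by (simp add: graph_over_def)
  ultimately have "M = graph_over UNIV u" using conn connected_clopen[of M] by blast
  then show ?thesis using that lift_smooth[OF u(1) open_UNIV] by blast
qed

end

section \<open>Vanishing of the second fundamental form\<close>

locale entire_maximal_graph =
  fixes M :: "((real^'m) \<times> (real^'n)) set" and u :: "real^'m \<Rightarrow> real^'n"
  assumes smooth: "smooth_submanifold M" and space_like: "space_like M" and extremal: "extremal M"
    and u: "smooth_on UNIV u" and M: "M = graph_over UNIV u"
    and contr: "\<And>x v. v \<noteq> 0 \<Longrightarrow> norm (pd v u x) < norm v"
begin

text \<open>
  In order: the squared pseudo-distance from the point over \<open>a\<close> to the point over \<open>x\<close>; minus the square of the difference between the position
  vector relative to the point over \<open>a\<close> and the tangent vector with horizontal part \<open>c\<close>; minus the square of the acceleration, with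
  horizontal part \<open>c\<close>, of a curve with velocity over \<open>w\<close>; the square of this velocity. The largest values over \<open>c\<close> of \<open>nsq\<close> and \<open>asq\<close> are
  the squared lengths of the normal part of the position vector and of \<open>B(w,w)\<close>. All four are invariant under isometries.
\<close>

definition "sep a x = (norm (x - a))\<^sup>2 - (norm (u x - u a))\<^sup>2"
definition "nsq a x c = (norm (u x - u a - pd c u x))\<^sup>2 - (norm (x - a - c))\<^sup>2"
definition "asq x w c = (norm (pd w (pd w u) x + pd c u x))\<^sup>2 - (norm c)\<^sup>2"
definition "vsq x w = (norm w)\<^sup>2 - (norm (pd w u x))\<^sup>2"

lemma du: "u differentiable (at x)" "pd w u differentiable (at x)"
  using smooth_differentiable[OF u] smooth_differentiable[OF smooth_pd[OF u]] by auto

lemma contr_le: "norm (pd v u x) \<le> norm v"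
  using contr[of v x] pd_zero[OF du(1)] by (cases "v = 0") (auto simp: less_imp_le)

lemma u_contr: "x \<noteq> y \<Longrightarrow> norm (u y - u x) < norm (y - x)"
  by (rule strict_contraction[of UNIV]) (use du(1) contr in auto)

lemma u_contr_le: "norm (u y - u x) \<le> norm (y - x)"
  using u_contr[of x y] by (cases "x = y") auto

lemma sep_nonneg: "sep a x \<ge> 0"
  unfolding sep_def using power_mono[OF u_contr_le[of x a], of 2] by simp

lemma sep_pos: assumes "x \<noteq> a" shows "sep a x > 0"
  unfolding sep_def using power_strict_mono[OF u_contr[OF assms[symmetric]], of 2] by simp

lemma vsq_pos: assumes "w \<noteq> 0" shows "vsq x w > 0"
  unfolding vsq_def using power_strict_mono[OF contr[OF assms, of x], of 2] by simp

lemma jet_iff: "jet M (x, u x) V A \<longleftrightarrow> (\<exists>v c. V = (v, pd v u x) \<and> A = (c, pd v (pd v u) x + pd c u x))"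
  by (rule jet_graph[OF open_UNIV u open_UNIV _ UNIV_I]) (simp add: M)

text \<open>
  All quantities at points near \<open>x0\<close> are expressed by the graph that is horizontal at that point. The equality in the last but one
  conclusion is attained by the tangential part of the position vector.
\<close>

lemma normal_form_at:
  obtains r and u' :: "real^'m \<Rightarrow> real^'n" and xq :: "real^'m" and y :: "real^'n" where
    "tangential_graph u' r"
    "tangential_graph.sep u' xq y 0 = sep a x0"
    "\<And>x'. x' \<in> ball 0 r \<Longrightarrow> \<exists>x. tangential_graph.sep u' xq y x' = sep a x \<and>
       (\<forall>c'. \<exists>c. (norm (u' x' - y - pd c' u' x'))\<^sup>2 - (norm (x' - xq - c'))\<^sup>2 = nsq a x c) \<and>
       (\<forall>w' c'. \<exists>w c. (norm (pd w' (pd w' u') x' + pd c' u' x'))\<^sup>2 - (norm c')\<^sup>2 = asq x w c \<and>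
          (norm w')\<^sup>2 - (norm (pd w' u' x'))\<^sup>2 = vsq x w)"
    "\<And>c. nsq a x0 c \<le> (norm y)\<^sup>2" "\<exists>c. nsq a x0 c = (norm y)\<^sup>2"
    "\<And>w c. \<exists>v'. vsq x0 w = (norm v')\<^sup>2 \<and> asq x0 w c \<le> (norm (pd v' (pd v' u') 0))\<^sup>2"
proof -
  let ?p = "(x0, u x0)" and ?q = "(a, u a)"
  have pM: "?p \<in> M" by (simp add: M graph_over_def)
  obtain \<Phi> :: "(real^'m) \<times> (real^'n) \<Rightarrow> (real^'m) \<times> (real^'n)" and r and u' :: "real^'m \<Rightarrow> real^'n" where
    lin: "linear \<Phi>" and bij: "bij \<Phi>" and iso: "\<And>p q. pseudo_inner (\<Phi> p) (\<Phi> q) = pseudo_inner p q"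
    and r: "r > 0" and u': "smooth_on (ball 0 r) u'" "u' 0 = 0" "\<And>v. pd v u' 0 = 0"
    and eq: "\<And>x. x \<in> ball 0 r \<Longrightarrow> \<exists>a :: 'm \<Rightarrow> real^'m.
       (\<forall>i j. a i \<bullet> a j - pd (a i) u' x \<bullet> pd (a j) u' x = (if i = j then 1 else 0)) \<and>
       (\<Sum>i\<in>UNIV. pd (a i) (pd (a i) u') x) = 0"
    and nf: "\<And>x. x \<in> ball 0 r \<Longrightarrow> \<exists>q\<in>M. \<Phi> (q - ?p) = (x, u' x) \<and>
       (\<forall>V A. jet M q V A \<longleftrightarrow> (\<exists>v c. \<Phi> V = (v, pd v u' x) \<and> \<Phi> A = (c, pd v (pd v u') x + pd c u' x)))"
    by (rule tangential_normal_form[OF smooth space_like extremal pM]) (rule that)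
  interpret T: tangential_graph u' r
    by (rule tangential_graph.intro[OF r u' eq])
  obtain xq y where qy: "\<Phi> (?q - ?p) = (xq, y)" by (metis surj_pair)
  have surj: "\<exists>V. \<Phi> V = V'" for V' using bij by (metis bij_pointE)
  have zero: "\<Phi> V = 0 \<Longrightarrow> V = 0" for V
    using injD[OF bij_is_inj[OF bij], of V 0] by (simp add: linear_0[OF lin])
  have point: "\<exists>x. \<Phi> ((x, u x) - ?p) = (x', u' x') \<and> \<Phi> ((x, u x) - ?q) = (x' - xq, u' x' - y) \<and>
       (\<forall>V A. jet M (x, u x) V A \<longleftrightarrow> (\<exists>v c. \<Phi> V = (v, pd v u' x') \<and> \<Phi> A = (c, pd v (pd v u') x' + pd c u' x')))"
    if x': "x' \<in> ball 0 r" for x'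
  proof -
    from nf[OF x'] obtain q where q: "q \<in> M" "\<Phi> (q - ?p) = (x', u' x')"
      "\<forall>V A. jet M q V A \<longleftrightarrow> (\<exists>v c. \<Phi> V = (v, pd v u' x') \<and> \<Phi> A = (c, pd v (pd v u') x' + pd c u' x'))"
      by blast
    obtain x where x: "q = (x, u x)" using q(1) by (auto simp: M graph_over_def)
    have "q - ?q = (q - ?p) - (?q - ?p)" by (simp add: prod_eq_iff)
    then have "\<Phi> (q - ?q) = \<Phi> ((q - ?p) - (?q - ?p))" by (rule arg_cong)
    also have "\<dots> = \<Phi> (q - ?p) - \<Phi> (?q - ?p)" by (rule linear_diff[OF lin])
    also have "\<dots> = (x' - xq, u' x' - y)" unfolding q(2) qy by simp
    finally show ?thesis using q(2,3) unfolding x by blast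
  qed
  have sep_pi: "sep a x = pseudo_inner ((x, u x) - ?q) ((x, u x) - ?q)" for x
    by (simp add: sep_def pseudo_inner_eq power2_norm_eq_inner)
  have nsq_pi: "nsq a x c = - pseudo_inner ((x, u x) - ?q - (c, pd c u x)) ((x, u x) - ?q - (c, pd c u x))" for x c
    by (simp add: nsq_def pseudo_inner_eq power2_norm_eq_inner)
  have asq_pi: "asq x w c = - pseudo_inner (c, pd w (pd w u) x + pd c u x) (c, pd w (pd w u) x + pd c u x)" for x w c
    by (simp add: asq_def pseudo_inner_eq power2_norm_eq_inner)
  have vsq_pi: "vsq x w = pseudo_inner (w, pd w u x) (w, pd w u x)" for x w
    by (simp add: vsq_def pseudo_inner_eq power2_norm_eq_inner)
  have nsq_iso: "(norm (u' x' - y - snd (\<Phi> (c, pd c u x))))\<^sup>2 - (norm (x' - xq - fst (\<Phi> (c, pd c u x))))\<^sup>2 = nsq a x c"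
    if "\<Phi> ((x, u x) - ?q) = (x' - xq, u' x' - y)" for x x' c
  proof -
    let ?V = "(c, pd c u x)"
    have "nsq a x c = - pseudo_inner (\<Phi> ((x, u x) - ?q - ?V)) (\<Phi> ((x, u x) - ?q - ?V))"
      by (simp only: nsq_pi iso)
    also have "\<Phi> ((x, u x) - ?q - ?V) = \<Phi> ((x, u x) - ?q) - \<Phi> ?V" by (rule linear_diff[OF lin])
    also have "\<dots> = (x' - xq, u' x' - y) - \<Phi> ?V" by (simp only: that)
    finally show ?thesis by (simp add: pseudo_inner_eq power2_norm_eq_inner)
  qed
  obtain x1 where x1: "\<Phi> ((x1, u x1) - ?p) = (0, u' 0)" "\<Phi> ((x1, u x1) - ?q) = (0 - xq, u' 0 - y)"
    "\<And>V A. jet M (x1, u x1) V A \<longleftrightarrow> (\<exists>v c. \<Phi> V = (v, pd v u' 0) \<and> \<Phi> A = (c, pd v (pd v u') 0 + pd c u' 0))"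
    using point[OF T.ball_r(2)] by blast
  have "(x1, u x1) - ?p = 0" by (rule zero) (simp only: x1(1) u'(2) zero_prod_def)
  then have x10: "x1 = x0" by (simp add: prod_eq_iff)
  note x0 = x1[unfolded x10]
  show ?thesis
  proof (rule that[of u' r xq y])
    show "tangential_graph u' r" by unfold_locales
    have "sep a x0 = pseudo_inner (\<Phi> ((x0, u x0) - ?q)) (\<Phi> ((x0, u x0) - ?q))" by (simp only: sep_pi iso)
    then show "T.sep xq y 0 = sep a x0" unfolding x0(2) by (simp add: T.sep_def pseudo_inner_eq power2_norm_eq_inner)
  next
    fix x' :: "real^'m" assume x': "x' \<in> ball 0 r"
    from point[OF x'] obtain x where x: "\<Phi> ((x, u x) - ?q) = (x' - xq, u' x' - y)"
      and j: "\<And>V A. jet M (x, u x) V A \<longleftrightarrow> (\<exists>v c. \<Phi> V = (v, pd v u' x') \<and> \<Phi> A = (c, pd v (pd v u') x' + pd c u' x'))"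
      by blast
    have vec: "\<exists>w c. \<Phi> (w, pd w u x) = (w', pd w' u' x') \<and> \<Phi> (c, pd w (pd w u) x + pd c u x) = (c', pd w' (pd w' u') x' + pd c' u' x')"
      for w' c'
    proof -
      obtain V where V: "\<Phi> V = (w', pd w' u' x')" using surj by blast
      obtain A where A: "\<Phi> A = (c', pd w' (pd w' u') x' + pd c' u' x')" using surj by blast
      have "jet M (x, u x) V A" unfolding j using V A by blast
      then show ?thesis unfolding jet_iff using V A by blast
    qed
    have "sep a x = pseudo_inner (\<Phi> ((x, u x) - ?q)) (\<Phi> ((x, u x) - ?q))" by (simp only: sep_pi iso)
    then have "T.sep xq y x' = sep a x" unfolding x by (simp add: T.sep_def pseudo_inner_eq power2_norm_eq_inner)
    moreover have "\<exists>c. (norm (u' x' - y - pd c' u' x'))\<^sup>2 - (norm (x' - xq - c'))\<^sup>2 = nsq a x c" for c'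
    proof -
      obtain c where "\<Phi> (c, pd c u x) = (c', pd c' u' x')" using vec by blast
      then show ?thesis using nsq_iso[OF x, of c] by (intro exI[of _ c]) simp
    qed
    moreover have "\<exists>w c. (norm (pd w' (pd w' u') x' + pd c' u' x'))\<^sup>2 - (norm c')\<^sup>2 = asq x w c \<and>
          (norm w')\<^sup>2 - (norm (pd w' u' x'))\<^sup>2 = vsq x w" for w' c'
    proof -
      obtain w c where wc: "\<Phi> (w, pd w u x) = (w', pd w' u' x')"
        "\<Phi> (c, pd w (pd w u) x + pd c u x) = (c', pd w' (pd w' u') x' + pd c' u' x')" using vec by blast
      have "asq x w c = - pseudo_inner (\<Phi> (c, pd w (pd w u) x + pd c u x)) (\<Phi> (c, pd w (pd w u) x + pd c u x))"
        by (simp only: asq_pi iso)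
      moreover have "vsq x w = pseudo_inner (\<Phi> (w, pd w u x)) (\<Phi> (w, pd w u x))" by (simp only: vsq_pi iso)
      ultimately show ?thesis
        unfolding wc by (intro exI[of _ w] exI[of _ c]) (simp add: pseudo_inner_eq power2_norm_eq_inner)
    qed
    ultimately show "\<exists>x. T.sep xq y x' = sep a x \<and>
       (\<forall>c'. \<exists>c. (norm (u' x' - y - pd c' u' x'))\<^sup>2 - (norm (x' - xq - c'))\<^sup>2 = nsq a x c) \<and>
       (\<forall>w' c'. \<exists>w c. (norm (pd w' (pd w' u') x' + pd c' u' x'))\<^sup>2 - (norm c')\<^sup>2 = asq x w c \<and>
          (norm w')\<^sup>2 - (norm (pd w' u' x'))\<^sup>2 = vsq x w)" by blast
  next
    have tang: "\<exists>v'. \<Phi> (w, pd w u x0) = (v', 0) \<and>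
        (\<exists>c'. \<Phi> (c, pd w (pd w u) x0 + pd c u x0) = (c', pd v' (pd v' u') 0))" for w c
    proof -
      have "jet M (x0, u x0) (w, pd w u x0) (c, pd w (pd w u) x0 + pd c u x0)" unfolding jet_iff by blast
      then show ?thesis unfolding x0(3) by (auto simp: u'(3))
    qed
    show "nsq a x0 c \<le> (norm y)\<^sup>2" for c
    proof -
      obtain v' where "\<Phi> (c, pd c u x0) = (v', 0)" using tang by blast
      then have "(norm y)\<^sup>2 - (norm (- xq - v'))\<^sup>2 = nsq a x0 c" using nsq_iso[OF x0(2), of c] by (simp add: u'(2))
      then show ?thesis using zero_le_power2[of "norm (- xq - v')"] by linarith
    qed
    show "\<exists>c. nsq a x0 c = (norm y)\<^sup>2"
    proof -
      obtain V where V: "\<Phi> V = (- xq, 0)" using surj by blast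
      obtain A where A: "\<Phi> A = (0, pd (- xq) (pd (- xq) u') 0)" using surj by blast
      have "jet M (x0, u x0) V A" unfolding x0(3)
        by (rule exI[of _ "- xq"], rule exI[of _ 0]) (simp add: V A u'(3))
      then obtain c where "V = (c, pd c u x0)" unfolding jet_iff by blast
      then have "\<Phi> (c, pd c u x0) = (- xq, 0)" using V by simp
      then show ?thesis using nsq_iso[OF x0(2), of c] by (intro exI[of _ c]) (simp add: u'(2))
    qed
    show "\<exists>v'. vsq x0 w = (norm v')\<^sup>2 \<and> asq x0 w c \<le> (norm (pd v' (pd v' u') 0))\<^sup>2" for w c
    proof -
      obtain v' c' where v: "\<Phi> (w, pd w u x0) = (v', 0)"
        "\<Phi> (c, pd w (pd w u) x0 + pd c u x0) = (c', pd v' (pd v' u') 0)" using tang by blast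
      have "asq x0 w c = - pseudo_inner (\<Phi> (c, pd w (pd w u) x0 + pd c u x0)) (\<Phi> (c, pd w (pd w u) x0 + pd c u x0))"
        by (simp only: asq_pi iso)
      moreover have "vsq x0 w = pseudo_inner (\<Phi> (w, pd w u x0)) (\<Phi> (w, pd w u x0))" by (simp only: vsq_pi iso)
      ultimately show ?thesis
        unfolding v by (intro exI[of _ v']) (simp add: pseudo_inner_eq power2_norm_eq_inner)
    qed
  qed
qed

lemma u_cont: "continuous_on S u"
  by (rule continuous_on_subset[OF smooth_continuous[OF u]]) simp

lemma sep_cont: "continuous_on S (sep a)"
  unfolding sep_def by (intro continuous_intros u_cont)

text \<open>
  On a ray from \<open>a\<close> the difference \<open>|x - a| - |u x - u a|\<close> does not decrease, and at distance \<open>1\<close> it has a positive minimum.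
\<close>

lemma escape: obtains \<delta> where "0 < \<delta>" "\<delta> \<le> 1" "\<And>x. norm (x - a) \<ge> 1 \<Longrightarrow> norm (u x - u a) \<le> norm (x - a) - \<delta>"
proof -
  have ne: "sphere a 1 \<noteq> ({} :: (real^'m) set)" by simp
  have "continuous_on (sphere a 1) (\<lambda>x. 1 - norm (u x - u a))" by (intro continuous_intros u_cont)
  from continuous_attains_inf[OF compact_sphere ne this]
  obtain x1 where x1: "x1 \<in> sphere a 1" "\<And>x. x \<in> sphere a 1 \<Longrightarrow> 1 - norm (u x1 - u a) \<le> 1 - norm (u x - u a)" by blast
  define \<delta> where "\<delta> = 1 - norm (u x1 - u a)"
  show ?thesis
  proof (rule that[of \<delta>])
    have n1: "norm (x1 - a) = 1" using x1(1) by (simp add: dist_norm norm_minus_commute)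
    then have "x1 \<noteq> a" by auto
    then show "0 < \<delta>" using u_contr[of a x1] n1 by (simp add: \<delta>_def)
    show "\<delta> \<le> 1" by (simp add: \<delta>_def)
    fix x assume x: "norm (x - a) \<ge> 1"
    define y where "y = a + (1 / norm (x - a)) *\<^sub>R (x - a)"
    have "norm (y - a) = 1" using x by (auto simp: y_def)
    then have "y \<in> sphere a 1" by (simp add: dist_norm norm_minus_commute)
    then have "norm (u y - u a) \<le> 1 - \<delta>" using x1(2) by (simp add: \<delta>_def)
    moreover have "norm (u x - u y) \<le> norm (x - a) - 1"
    proof -
      have "x - y = (1 - 1 / norm (x - a)) *\<^sub>R (x - a)" by (simp add: y_def algebra_simps)
      moreover have "0 \<le> 1 - 1 / norm (x - a)" using x by (simp add: divide_le_eq_1)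
      ultimately have "norm (x - y) = (1 - 1 / norm (x - a)) * norm (x - a)" by simp
      also have "\<dots> = norm (x - a) - 1" using x by (auto simp: left_diff_distrib)
      finally show ?thesis using u_contr_le[of x y] by simp
    qed
    moreover have "norm (u x - u a) \<le> norm (u x - u y) + norm (u y - u a)"
      using norm_triangle_ineq[of "u x - u y" "u y - u a"] by simp
    ultimately show "norm (u x - u a) \<le> norm (x - a) - \<delta>" by linarith
  qed
qed

text \<open>
  By the previous lemma \<open>sep a x \<ge> \<delta> |x - a|\<close> when \<open>|x - a| \<ge> 1\<close>.
\<close>

lemma sublevel_compact: "compact {x. sep a x \<le> k}"
proof -
  obtain \<delta> where \<delta>: "0 < \<delta>" "\<delta> \<le> 1" "\<And>x. norm (x - a) \<ge> 1 \<Longrightarrow> norm (u x - u a) \<le> norm (x - a) - \<delta>"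
    by (rule escape[where a = a]) (rule that)
  have "norm (x - a) \<le> max 1 (k / \<delta>)" if "sep a x \<le> k" for x
  proof (cases "norm (x - a) \<ge> 1")
    case True
    let ?R = "norm (x - a)"
    have "(norm (u x - u a))\<^sup>2 \<le> (?R - \<delta>)\<^sup>2" by (rule power_mono[OF \<delta>(3)[OF True]]) simp
    then have "?R\<^sup>2 - (?R - \<delta>)\<^sup>2 \<le> k" using that by (simp add: sep_def)
    moreover have "?R\<^sup>2 - (?R - \<delta>)\<^sup>2 = \<delta> * ?R + \<delta> * (?R - \<delta>)" by (simp add: power2_eq_square algebra_simps)
    moreover have "\<delta> * (?R - \<delta>) \<ge> 0" using \<delta> True by simp
    ultimately have "\<delta> * ?R \<le> k" by linarith
    then have "?R \<le> k / \<delta>" using \<delta>(1) by (simp add: field_simps)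
    then show ?thesis by simp
  qed simp
  then have "{x. sep a x \<le> k} \<subseteq> cball a (max 1 (k / \<delta>))" by (auto simp: dist_norm norm_minus_commute)
  then have "bounded {x. sep a x \<le> k}" by (rule bounded_subset[OF bounded_cball])
  moreover have "closed {x. sep a x \<le> k}"
    by (intro closed_Collect_le sep_cont continuous_on_const)
  ultimately show ?thesis by (simp add: compact_eq_bounded_closed)
qed

lemma pd_cont: "continuous_on S (\<lambda>p. pd (snd p) u (fst p))"
proof -
  have "continuous_on S (\<lambda>p. \<Sum>i\<in>UNIV. snd p $ i *\<^sub>R pd (axis i 1) u (fst p))"
    by (intro continuous_intros continuous_on_compose2[OF smooth_continuous[OF smooth_pd[OF u]]]) auto
  then show ?thesis by (rule continuous_on_eq) (rule pd_axis[OF du(1), symmetric])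
qed

lemma pd2_cont: "continuous_on S (\<lambda>p. pd (snd p) (pd (snd p) u) (fst p))"
proof -
  have "continuous_on S (\<lambda>p. \<Sum>i\<in>UNIV. snd p $ i *\<^sub>R (\<Sum>j\<in>UNIV. snd p $ j *\<^sub>R pd (axis j 1) (pd (axis i 1) u) (fst p)))"
    by (intro continuous_intros continuous_on_compose2[OF smooth_continuous[OF smooth_pd[OF smooth_pd[OF u]]]]) auto
  moreover have "pd w (pd w u) x = (\<Sum>i\<in>UNIV. w $ i *\<^sub>R (\<Sum>j\<in>UNIV. w $ j *\<^sub>R pd (axis j 1) (pd (axis i 1) u) x))" for w x
  proof -
    have "pd w (pd w u) x = (\<Sum>i\<in>UNIV. w $ i *\<^sub>R pd (axis i 1) (pd w u) x)" by (rule pd_axis[OF du(2)])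
    also have "\<dots> = (\<Sum>i\<in>UNIV. w $ i *\<^sub>R (\<Sum>j\<in>UNIV. w $ j *\<^sub>R pd (axis j 1) (pd (axis i 1) u) x))"
      by (intro sum.cong refl arg_cong2[where f = scaleR])
         (simp add: pd_commute[OF open_UNIV u UNIV_I, of _ w] pd_axis[OF du(2), of w])
    finally show ?thesis .
  qed
  ultimately show ?thesis by simp
qed

text \<open>
  It confines the relevant \<open>c\<close> in \<open>nsq\<close> and \<open>asq\<close>, which tend to \<open>-\<infinity>\<close> as \<open>|c|\<close> grows, to a compact set.
\<close>

lemma uniform_contraction:
  assumes K: "compact K" "K \<noteq> {}"
  obtains \<theta> where "\<theta> < 1" "\<And>x c. x \<in> K \<Longrightarrow> norm (pd c u x) \<le> \<theta> * norm c"
proof -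
  let ?S = "sphere (0 :: real^'m) 1"
  have "compact (K \<times> ?S)" "K \<times> ?S \<noteq> {}" using K by (auto intro: compact_Times)
  moreover have "continuous_on (K \<times> ?S) (\<lambda>p. norm (pd (snd p) u (fst p)))"
    by (intro continuous_on_norm pd_cont)
  ultimately obtain p where p: "p \<in> K \<times> ?S"
    "\<And>q. q \<in> K \<times> ?S \<Longrightarrow> norm (pd (snd q) u (fst q)) \<le> norm (pd (snd p) u (fst p))"
    using continuous_attains_sup[of "K \<times> ?S" "\<lambda>p. norm (pd (snd p) u (fst p))"] by blast
  show ?thesis
  proof (rule that[of "norm (pd (snd p) u (fst p))"])
    have "norm (snd p) = 1" using p(1) by auto
    then show "norm (pd (snd p) u (fst p)) < 1" using contr[of "snd p" "fst p"] by (metis norm_zero zero_neq_one)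
    fix x c assume x: "x \<in> K"
    show "norm (pd c u x) \<le> norm (pd (snd p) u (fst p)) * norm c"
    proof (cases "c = 0")
      case False
      have "norm (pd ((1 / norm c) *\<^sub>R c) u x) \<le> norm (pd (snd p) u (fst p))"
        using p(2)[of "(x, (1 / norm c) *\<^sub>R c)"] x False by simp
      then show ?thesis using False by (simp add: pd_scale[OF du(1)] field_simps)
    qed (simp add: pd_zero[OF du(1)])
  qed
qed


text \<open>
  The weighted quantity has a maximum over the compact sublevel set. The maximum principle bounds it in coordinates that are horizontal at the maximum point.
\<close>

lemma normal_part_estimate_sublevel:
  assumes k: "k > 0" and x: "sep a x < k"
  shows "(k - sep a x) ^ (4 * CARD('m)) * nsq a x c \<le> ((2 * real CARD('m) + 1) * k) * k ^ (4 * CARD('m))"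
proof (cases "nsq a x c \<le> 0")
  case True
  have "(k - sep a x) ^ (4 * CARD('m)) * nsq a x c \<le> 0" using True x by (intro mult_nonneg_nonpos) auto
  also have "0 \<le> ((2 * real CARD('m) + 1) * k) * k ^ (4 * CARD('m))" using k by simp
  finally show ?thesis .
next
  case False
  define n where "n = 4 * CARD('m)"
  have n0: "n > 0" by (simp add: n_def)
  define F where "F p = (k - sep a (fst p)) ^ n * nsq a (fst p) (snd p)" for p
  define K where "K = {x. sep a x \<le> k}"
  have K: "compact K" "x \<in> K" using sublevel_compact x by (auto simp: K_def)
  then obtain \<theta> where \<theta>: "\<theta> < 1" "\<And>x c. x \<in> K \<Longrightarrow> norm (pd c u x) \<le> \<theta> * norm c"
    using uniform_contraction[of K] by blast
  obtain A where A: "\<And>x. x \<in> K \<Longrightarrow> norm (x - a) \<le> A"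
  proof -
    have "bounded ((\<lambda>x. x - a) ` K)"
      by (intro compact_imp_bounded compact_continuous_image K continuous_intros)
    then show ?thesis using that by (auto simp: bounded_iff)
  qed
  define R where "R = 2 * A / (1 - \<theta>)"
  have bound: "norm c \<le> R" if "x \<in> K" "nsq a x c > 0" for x c
  proof -
    have "(norm (x - a - c))\<^sup>2 < (norm (u x - u a - pd c u x))\<^sup>2" using that(2) by (simp add: nsq_def)
    then have "norm (x - a - c) < norm (u x - u a - pd c u x)" by (rule power2_less_imp_less) simp
    moreover have "norm (u x - u a - pd c u x) \<le> norm (u x - u a) + norm (pd c u x)" by (rule norm_triangle_ineq4)
    moreover have "norm c - norm (x - a) \<le> norm (x - a - c)"
      using norm_triangle_ineq2[of c "x - a"] by (simp add: norm_minus_commute)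
    ultimately have "(1 - \<theta>) * norm c \<le> 2 * A"
      using u_contr_le[where x = a and y = x] A[OF that(1)] \<theta>(2)[OF that(1), of c] by (simp add: algebra_simps)
    then show ?thesis using \<theta>(1) by (simp add: R_def field_simps)
  qed
  have Fcont: "continuous_on (K \<times> cball 0 R) F"
  proof -
    have *: "continuous_on (K \<times> cball 0 R) (\<lambda>p. u (fst p))" "continuous_on (K \<times> cball 0 R) (\<lambda>p. sep a (fst p))"
      by (intro continuous_on_compose2[OF u_cont[of UNIV]] continuous_on_compose2[OF sep_cont[of UNIV]] continuous_intros; simp)+
    show ?thesis unfolding F_def nsq_def by (intro continuous_intros * pd_cont)
  qed
  have x1: "(x, c) \<in> K \<times> cball 0 R" using K(2) bound[OF K(2), of c] False by simp
  have "compact (K \<times> cball (0 :: real^'m) R)" by (intro compact_Times K compact_cball)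
  then obtain p where p: "p \<in> K \<times> cball 0 R" "\<And>q. q \<in> K \<times> cball 0 R \<Longrightarrow> F q \<le> F p"
    using continuous_attains_sup[OF _ _ Fcont] x1 by blast
  obtain x0 c0 where xc: "p = (x0, c0)" by fastforce
  have "F (x, c) > 0" using False x by (simp add: F_def)
  then have Fp: "F p > 0" using p(2)[OF x1] by simp
  have x0K: "sep a x0 \<le> k" using p(1) by (simp add: xc K_def)
  have z0: "sep a x0 < k"
  proof (rule ccontr)
    assume "\<not> sep a x0 < k"
    then have "F p = 0" using x0K n0 by (simp add: F_def xc)
    then show False using Fp by simp
  qed
  then have f0: "nsq a x0 c0 > 0" using Fp by (simp add: F_def xc zero_less_mult_iff)
  have Fmax: "F (x, c) \<le> F p" if "sep a x < k" for x c
  proof (cases "nsq a x c > 0")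
    case True
    then show ?thesis using p(2)[of "(x, c)"] bound[of x c] that by (simp add: K_def)
  next
    case False
    then have "F (x, c) \<le> 0" using that by (simp add: F_def mult_nonneg_nonpos)
    then show ?thesis using Fp by simp
  qed
  obtain r and u' :: "real^'m \<Rightarrow> real^'n" and xq :: "real^'m" and y :: "real^'n" where
    T: "tangential_graph u' r" and
    sep: "tangential_graph.sep u' xq y 0 = sep a x0" and
    tr: "\<And>x'. x' \<in> ball 0 r \<Longrightarrow> \<exists>x. tangential_graph.sep u' xq y x' = sep a x \<and>
       (\<forall>c'. \<exists>c. (norm (u' x' - y - pd c' u' x'))\<^sup>2 - (norm (x' - xq - c'))\<^sup>2 = nsq a x c) \<and>
       (\<forall>w' c'. \<exists>w c. (norm (pd w' (pd w' u') x' + pd c' u' x'))\<^sup>2 - (norm c')\<^sup>2 = asq x w c \<and>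
          (norm w')\<^sup>2 - (norm (pd w' u' x'))\<^sup>2 = vsq x w)" and
    fy: "\<And>c. nsq a x0 c \<le> (norm y)\<^sup>2"
    by (rule normal_form_at[of a x0]) (rule that)
  interpret T: tangential_graph u' r by (rule T)
  have Fy: "F p \<le> (k - sep a x0) ^ n * (norm y)\<^sup>2"
    unfolding F_def xc fst_conv snd_conv using z0 fy[of c0] by (intro mult_left_mono) auto
  have y0: "y \<noteq> 0" using f0 fy[of c0] by auto
  have "(norm y)\<^sup>2 \<le> (2 * real CARD('m) + 1) * k"
  proof (rule T.normal_part_bound[of xq y k])
    show "0 \<le> T.sep xq y 0" "T.sep xq y 0 < k" using sep z0 sep_nonneg by simp_all
    show "y \<noteq> 0" by (rule y0)
    fix x' c' assume x': "x' \<in> ball 0 r" "T.sep xq y x' < k"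
    from tr[OF x'(1)] obtain x where xx: "T.sep xq y x' = sep a x"
      "\<forall>c'. \<exists>c. (norm (u' x' - y - pd c' u' x'))\<^sup>2 - (norm (x' - xq - c'))\<^sup>2 = nsq a x c" by blast
    from xx(2) obtain c where c: "(norm (u' x' - y - pd c' u' x'))\<^sup>2 - (norm (x' - xq - c'))\<^sup>2 = nsq a x c" by blast
    have "F (x, c) \<le> (k - sep a x0) ^ n * (norm y)\<^sup>2" using Fmax[of x c] x'(2) xx(1) Fy by simp
    then show "(k - T.sep xq y x') ^ (4 * CARD('m)) * ((norm (u' x' - y - pd c' u' x'))\<^sup>2 - (norm (x' - xq - c'))\<^sup>2)
      \<le> (k - T.sep xq y 0) ^ (4 * CARD('m)) * (norm y)\<^sup>2"
      by (simp only: xx(1) c sep F_def fst_conv snd_conv n_def)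
  qed
  then have "F p \<le> (k - sep a x0) ^ n * ((2 * real CARD('m) + 1) * k)"
    using Fy z0 by (smt (verit) mult_left_mono zero_le_power)
  also have "\<dots> \<le> k ^ n * ((2 * real CARD('m) + 1) * k)"
    using k z0 sep_nonneg[of a x0] by (intro mult_right_mono power_mono) auto
  finally have "F p \<le> k ^ n * ((2 * real CARD('m) + 1) * k)" .
  with Fmax[OF x, of c] show ?thesis by (simp add: F_def n_def mult_ac)
qed

definition "normal_const = 2 * (2 * real CARD('m) + 1) * 2 ^ (4 * CARD('m))"

text \<open>
  The level \<open>k = 2 sep\<close> in the preceding estimate. As \<open>|grad sep|\<^sup>2 = 4 (sep + |normal part|\<^sup>2)\<close>, this is a gradient estimate for \<open>sep\<close>.
\<close>

lemma normal_part_estimate: "nsq a x c \<le> normal_const * sep a x"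
proof (cases "x = a")
  case True
  have "(norm (pd c u a))\<^sup>2 \<le> (norm c)\<^sup>2" by (intro power_mono contr_le) simp
  then show ?thesis using True by (simp add: nsq_def sep_def)
next
  case False
  then have z: "sep a x > 0" by (rule sep_pos)
  have "(2 * sep a x - sep a x) ^ (4 * CARD('m)) * nsq a x c
     \<le> ((2 * real CARD('m) + 1) * (2 * sep a x)) * (2 * sep a x) ^ (4 * CARD('m))"
    by (rule normal_part_estimate_sublevel) (use z in simp_all)
  then have "sep a x ^ (4 * CARD('m)) * nsq a x c \<le> sep a x ^ (4 * CARD('m)) * (normal_const * sep a x)"
  proof -
    have d: "2 * sep a x - sep a x = sep a x" by simp
    assume "(2 * sep a x - sep a x) ^ (4 * CARD('m)) * nsq a x c
      \<le> ((2 * real CARD('m) + 1) * (2 * sep a x)) * (2 * sep a x) ^ (4 * CARD('m))"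
    also have "\<dots> = sep a x ^ (4 * CARD('m)) * (normal_const * sep a x)"
      by (simp only: normal_const_def power_mult_distrib mult_ac)
    finally show ?thesis unfolding d .
  qed
  then show ?thesis using z by (simp add: mult_le_cancel_left_pos)
qed

text \<open>
  At the maximum point of the weighted \<open>|B(w,w)|\<^sup>2\<close>, the gradient of \<open>sep\<close> enters through the weight. It is controlled by the estimate for the
  normal part, and the bound becomes linear in \<open>k\<close>.
\<close>

lemma second_derivative_estimate_sublevel:
  assumes k: "k > 0" and x: "sep a x < k" and w: "norm w = 1"
  shows "(k - sep a x)\<^sup>2 * asq x w c \<le> ((2 * real CARD('m) + 12 * (1 + normal_const)) * k) * (vsq x w)\<^sup>2"
proof (cases "asq x w c \<le> 0")
  case True
  have "(k - sep a x)\<^sup>2 * asq x w c \<le> 0" using True by (intro mult_nonneg_nonpos) auto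
  also have "0 \<le> ((2 * real CARD('m) + 12 * (1 + normal_const)) * k) * (vsq x w)\<^sup>2" using k by (simp add: normal_const_def)
  finally show ?thesis .
next
  case False
  define F where "F p = (k - sep a (fst p))\<^sup>2 * asq (fst p) (fst (snd p)) (snd (snd p)) / (vsq (fst p) (fst (snd p)))\<^sup>2" for p
  define K where "K = {x. sep a x \<le> k}"
  let ?S = "sphere (0 :: real^'m) 1"
  have K: "compact K" "x \<in> K" using sublevel_compact x by (auto simp: K_def)
  then obtain \<theta> where \<theta>: "\<theta> < 1" "\<And>x c. x \<in> K \<Longrightarrow> norm (pd c u x) \<le> \<theta> * norm c"
    using uniform_contraction[of K] by blast
  have vsqp: "vsq x w > 0" if "norm w = 1" for x w using vsq_pos[of w x] that by force
  obtain A where A: "\<And>x w. x \<in> K \<Longrightarrow> norm w = 1 \<Longrightarrow> norm (pd w (pd w u) x) \<le> A"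
  proof -
    have "bounded ((\<lambda>p. pd (snd p) (pd (snd p) u) (fst p)) ` (K \<times> ?S))"
      by (intro compact_imp_bounded compact_continuous_image pd2_cont compact_Times K compact_sphere)
    then show ?thesis using that by (fastforce simp: bounded_iff)
  qed
  define R where "R = A / (1 - \<theta>)"
  have bound: "norm c \<le> R" if "x \<in> K" "norm w = 1" "asq x w c > 0" for x w c
  proof -
    have "(norm c)\<^sup>2 < (norm (pd w (pd w u) x + pd c u x))\<^sup>2" using that(3) by (simp add: asq_def)
    then have "norm c < norm (pd w (pd w u) x + pd c u x)" by (rule power2_less_imp_less) simp
    moreover have "norm (pd w (pd w u) x + pd c u x) \<le> norm (pd w (pd w u) x) + norm (pd c u x)" by (rule norm_triangle_ineq)
    ultimately have "(1 - \<theta>) * norm c \<le> A"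
      using A[OF that(1,2)] \<theta>(2)[OF that(1), of c] by (simp add: algebra_simps)
    then show ?thesis using \<theta>(1) by (simp add: R_def field_simps)
  qed
  let ?D = "K \<times> ?S \<times> cball (0 :: real^'m) R"
  have Fcont: "continuous_on ?D F"
  proof -
    have 1: "continuous_on ?D (\<lambda>p. sep a (fst p))"
      by (intro continuous_on_compose2[OF sep_cont[of UNIV]] continuous_intros) simp
    have 2: "continuous_on ?D (\<lambda>p. pd (snd (snd p)) u (fst p))"
      using continuous_on_compose2[OF pd_cont[of UNIV], of ?D "\<lambda>p. (fst p, snd (snd p))"]
      by (simp add: continuous_intros)
    have 3: "continuous_on ?D (\<lambda>p. pd (fst (snd p)) u (fst p))"
      using continuous_on_compose2[OF pd_cont[of UNIV], of ?D "\<lambda>p. (fst p, fst (snd p))"]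
      by (simp add: continuous_intros)
    have 4: "continuous_on ?D (\<lambda>p. pd (fst (snd p)) (pd (fst (snd p)) u) (fst p))"
      using continuous_on_compose2[OF pd2_cont[of UNIV], of ?D "\<lambda>p. (fst p, fst (snd p))"]
      by (simp add: continuous_intros)
    have "(vsq (fst p) (fst (snd p)))\<^sup>2 \<noteq> 0" if "p \<in> ?D" for p
      using vsqp[of "fst (snd p)" "fst p"] that by auto
    then show ?thesis unfolding F_def asq_def vsq_def by (intro continuous_intros 1 2 3 4) auto
  qed
  have x1: "(x, w, c) \<in> ?D" using K(2) bound[OF K(2) w, of c] w False by simp
  have "compact ?D" by (intro compact_Times K compact_cball compact_sphere)
  then obtain p where p: "p \<in> ?D" "\<And>q. q \<in> ?D \<Longrightarrow> F q \<le> F p"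
    using continuous_attains_sup[OF _ _ Fcont] x1 by blast
  obtain x0 w0 c0 where xc: "p = (x0, w0, c0)" by (metis surj_pair)
  have w0: "norm w0 = 1" using p(1) by (simp add: xc)
  have "F (x, w, c) > 0" using False x vsqp[OF w, of x] by (simp add: F_def)
  then have Fp: "F p > 0" using p(2)[OF x1] by simp
  have x0K: "sep a x0 \<le> k" using p(1) by (simp add: xc K_def)
  have z0: "sep a x0 < k"
  proof (rule ccontr)
    assume "\<not> sep a x0 < k"
    then have "F p = 0" using x0K by (simp add: F_def xc)
    then show False using Fp by simp
  qed
  have unit: "(k - sep a x)\<^sup>2 * asq x w c \<le> F p * (vsq x w)\<^sup>2" if "sep a x < k" "norm w = 1" for x w c
  proof (cases "asq x w c > 0")
    case True
    then have "F (x, w, c) \<le> F p" using p(2)[of "(x, w, c)"] bound[of x w c] that by (simp add: K_def)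
    then show ?thesis using vsqp[OF that(2), of x] by (simp add: F_def pos_divide_le_eq)
  next
    case False
    then have "(k - sep a x)\<^sup>2 * asq x w c \<le> 0" by (simp add: mult_nonneg_nonpos)
    also have "0 \<le> F p * (vsq x w)\<^sup>2" using Fp by simp
    finally show ?thesis .
  qed
  \<comment> \<open>both sides are homogeneous in \<open>(w, c)\<close> with weights 1 and 2\<close>
  have all: "(k - sep a x)\<^sup>2 * asq x w c \<le> F p * (vsq x w)\<^sup>2" if z: "sep a x < k" for x w c
  proof (cases "w = 0")
    case True
    have "pd 0 (pd 0 u) x = 0" by (rule pd_zero[OF du(2)])
    then have "asq x w c \<le> 0" using True power_mono[OF contr_le[of c x], of 2] by (simp add: asq_def)
    then have "(k - sep a x)\<^sup>2 * asq x w c \<le> 0" by (simp add: mult_nonneg_nonpos)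
    also have "0 \<le> F p * (vsq x w)\<^sup>2" using Fp by simp
    finally show ?thesis .
  next
    case False
    define l where "l = 1 / norm w"
    have l: "l > 0" using False by (simp add: l_def)
    have "pd (l *\<^sub>R w) (pd (l *\<^sub>R w) u) x = (l * l) *\<^sub>R pd w (pd w u) x"
    proof -
      have "pd (l *\<^sub>R w) u = (\<lambda>x. l *\<^sub>R pd w u x)" by (rule ext) (rule pd_scale[OF du(1)])
      moreover have "pd (l *\<^sub>R w) (\<lambda>x. l *\<^sub>R pd w u x) x = l *\<^sub>R pd (l *\<^sub>R w) (pd w u) x"
        by (rule pd_eq) (rule has_derivative_scaleR_right[OF has_derivative_pd[OF du(2)]])
      ultimately show ?thesis by (simp add: pd_scale[OF du(2)])
    qed
    then have h: "asq x (l *\<^sub>R w) ((l * l) *\<^sub>R c) = (l * l)\<^sup>2 * asq x w c"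
      by (simp add: asq_def pd_scale[OF du(1)] scaleR_add_right[symmetric] power_mult_distrib right_diff_distrib)
    have g: "vsq x (l *\<^sub>R w) = (l * l) * vsq x w"
      using l by (simp add: vsq_def pd_scale[OF du(1)] power2_eq_square algebra_simps)
    have "(k - sep a x)\<^sup>2 * asq x (l *\<^sub>R w) ((l * l) *\<^sub>R c) \<le> F p * (vsq x (l *\<^sub>R w))\<^sup>2"
      by (rule unit[OF z]) (use False in \<open>simp add: l_def\<close>)
    then have "(l * l)\<^sup>2 * ((k - sep a x)\<^sup>2 * asq x w c) \<le> (l * l)\<^sup>2 * (F p * (vsq x w)\<^sup>2)"
      unfolding h g by (simp add: power_mult_distrib mult_ac)
    then show ?thesis using l by (simp add: mult_le_cancel_left_pos)
  qed
  obtain r and u' :: "real^'m \<Rightarrow> real^'n" and xq :: "real^'m" and y :: "real^'n" where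
    T: "tangential_graph u' r" and
    sep: "tangential_graph.sep u' xq y 0 = sep a x0" and
    tr: "\<And>x'. x' \<in> ball 0 r \<Longrightarrow> \<exists>x. tangential_graph.sep u' xq y x' = sep a x \<and>
       (\<forall>c'. \<exists>c. (norm (u' x' - y - pd c' u' x'))\<^sup>2 - (norm (x' - xq - c'))\<^sup>2 = nsq a x c) \<and>
       (\<forall>w' c'. \<exists>w c. (norm (pd w' (pd w' u') x' + pd c' u' x'))\<^sup>2 - (norm c')\<^sup>2 = asq x w c \<and>
          (norm w')\<^sup>2 - (norm (pd w' u' x'))\<^sup>2 = vsq x w)" and
    fy: "\<And>c. nsq a x0 c \<le> (norm y)\<^sup>2" "\<exists>c. nsq a x0 c = (norm y)\<^sup>2" and
    hy: "\<And>w c. \<exists>v'. vsq x0 w = (norm v')\<^sup>2 \<and> asq x0 w c \<le> (norm (pd v' (pd v' u') 0))\<^sup>2"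
    by (rule normal_form_at[of a x0]) (rule that)
  interpret T: tangential_graph u' r by (rule T)
  from hy[of w0 c0] obtain v' where v': "vsq x0 w0 = (norm v')\<^sup>2" "asq x0 w0 c0 \<le> (norm (pd v' (pd v' u') 0))\<^sup>2" by blast
  have v'0: "norm v' > 0" using vsqp[OF w0, of x0] v'(1) by auto
  define l where "l = 1 / norm v'"
  define v where "v = l *\<^sub>R v'"
  have v: "norm v = 1" using v'0 by (simp add: v_def l_def)
  have Vv: "pd v (pd v u') 0 = (l * l) *\<^sub>R pd v' (pd v' u') 0"
  proof -
    have "pd v (pd v u') 0 = pd v (\<lambda>x. l *\<^sub>R pd v' u' x) 0"
      by (rule pd_cong_open(1)[OF T.ball_r]) (simp add: v_def pd_scale[OF smooth_differentiable[OF T.u]])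
    also have "\<dots> = l *\<^sub>R pd v (pd v' u') 0"
      by (rule pd_eq) (rule has_derivative_scaleR_right[OF has_derivative_pd[OF T.differentiable_at_0(2)]])
    finally show ?thesis by (simp add: v_def pd_scale[OF T.differentiable_at_0(2)])
  qed
  have Fv: "F p \<le> (k - sep a x0)\<^sup>2 * (norm (pd v (pd v u') 0))\<^sup>2"
  proof -
    have "F p \<le> (k - sep a x0)\<^sup>2 * (norm (pd v' (pd v' u') 0))\<^sup>2 / ((norm v')\<^sup>2)\<^sup>2"
      unfolding F_def xc fst_conv snd_conv v'(1)
      using v'(2) by (intro divide_right_mono mult_left_mono) auto
    also have "\<dots> = (k - sep a x0)\<^sup>2 * (norm (pd v (pd v u') 0))\<^sup>2"
      by (simp add: Vv l_def power_mult_distrib power2_eq_square)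
    finally show ?thesis .
  qed
  have V0: "pd v (pd v u') 0 \<noteq> 0" using Fv Fp by auto
  have "(k - T.sep xq y 0)\<^sup>2 * (norm (pd v (pd v u') 0))\<^sup>2 \<le> 2 * real CARD('m) * (k - T.sep xq y 0) + 12 * (norm xq)\<^sup>2"
  proof (rule T.second_derivative_bound[OF _ v V0])
    show "T.sep xq y 0 < k" using sep z0 by simp
    fix x' w' c' assume x': "x' \<in> ball 0 r" "T.sep xq y x' < k"
    from tr[OF x'(1)] obtain x where xx: "T.sep xq y x' = sep a x"
      "\<forall>w' c'. \<exists>w c. (norm (pd w' (pd w' u') x' + pd c' u' x'))\<^sup>2 - (norm c')\<^sup>2 = asq x w c \<and>
          (norm w')\<^sup>2 - (norm (pd w' u' x'))\<^sup>2 = vsq x w" by blast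
    from xx(2) obtain w c where wc: "(norm (pd w' (pd w' u') x' + pd c' u' x'))\<^sup>2 - (norm c')\<^sup>2 = asq x w c"
      "(norm w')\<^sup>2 - (norm (pd w' u' x'))\<^sup>2 = vsq x w" by blast
    have "(k - sep a x)\<^sup>2 * asq x w c \<le> F p * (vsq x w)\<^sup>2" using all x'(2) xx(1) by simp
    also have "\<dots> \<le> ((k - sep a x0)\<^sup>2 * (norm (pd v (pd v u') 0))\<^sup>2) * (vsq x w)\<^sup>2"
      by (intro mult_right_mono Fv) simp
    finally show "(k - T.sep xq y x')\<^sup>2 * ((norm (pd w' (pd w' u') x' + pd c' u' x'))\<^sup>2 - (norm c')\<^sup>2)
      \<le> ((k - T.sep xq y 0)\<^sup>2 * (norm (pd v (pd v u') 0))\<^sup>2) * ((norm w')\<^sup>2 - (norm (pd w' u' x'))\<^sup>2)\<^sup>2"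
      by (simp only: xx(1) wc sep)
  qed
  then have "F p \<le> 2 * real CARD('m) * (k - sep a x0) + 12 * (norm xq)\<^sup>2" using Fv by (simp only: sep)
  moreover have "(norm xq)\<^sup>2 \<le> (1 + normal_const) * sep a x0"
  proof -
    from fy(2) obtain c where "nsq a x0 c = (norm y)\<^sup>2" by blast
    then have "(norm y)\<^sup>2 \<le> normal_const * sep a x0" using normal_part_estimate[of a x0 c] by simp
    then show ?thesis using sep by (simp add: T.sep_0 algebra_simps)
  qed
  moreover have "(1 + normal_const) * sep a x0 \<le> (1 + normal_const) * k" using z0 by (intro mult_left_mono) (auto simp: normal_const_def)
  moreover have "2 * real CARD('m) * (k - sep a x0) \<le> 2 * real CARD('m) * k"
    using sep_nonneg by (intro mult_left_mono) auto
  ultimately have "F p \<le> (2 * real CARD('m) + 12 * (1 + normal_const)) * k" by (simp add: algebra_simps)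
  then have "F p * (vsq x w)\<^sup>2 \<le> ((2 * real CARD('m) + 12 * (1 + normal_const)) * k) * (vsq x w)\<^sup>2" by (intro mult_right_mono) auto
  with unit[OF x w, of c] show ?thesis by linarith
qed

text \<open>
  The estimate at \<open>x = a\<close>, where the weight is \<open>k\<^sup>2\<close> and the bound is linear in \<open>k\<close>, for \<open>k \<rightarrow> \<infinity>\<close>.
\<close>

lemma second_derivative_zero: "pd w (pd w u) a = 0"
proof -
  have unit: "pd w (pd w u) a = 0" if w: "norm w = 1" for w
  proof -
    define C where "C = (2 * real CARD('m) + 12 * (1 + normal_const)) * (vsq a w)\<^sup>2"
    define h where "h = (norm (pd w (pd w u) a))\<^sup>2"
    have "k * h \<le> C" if k: "k > 0" for k
    proof -
      have "(k - sep a a)\<^sup>2 * asq a w 0 \<le> ((2 * real CARD('m) + 12 * (1 + normal_const)) * k) * (vsq a w)\<^sup>2"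
        by (rule second_derivative_estimate_sublevel[OF k _ w]) (simp add: sep_def k)
      then have "k * (k * h) \<le> k * C"
        by (simp add: sep_def asq_def pd_zero[OF du(1)] C_def h_def power2_eq_square mult_ac)
      then show ?thesis using k by (simp add: mult_le_cancel_left_pos)
    qed
    have C0: "C \<ge> 0" by (simp add: C_def normal_const_def)
    have "h \<le> 0"
    proof (rule ccontr)
      assume "\<not> h \<le> 0"
      then have h: "h > 0" by simp
      have "((C + 1) / h) * h \<le> C" using h C0 by (intro \<open>\<And>k. k > 0 \<Longrightarrow> k * h \<le> C\<close>) simp
      then show False using h by simp
    qed
    then show ?thesis by (simp add: h_def)
  qed
  show ?thesis
  proof (cases "w = 0")
    case True
    then show ?thesis by (simp add: pd_zero[OF du(2)])
  next
    case False
    define l where "l = norm w"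
    define v where "v = (1 / l) *\<^sub>R w"
    have v: "w = l *\<^sub>R v" "norm v = 1" using False by (simp_all add: l_def v_def)
    have "pd w u = (\<lambda>x. l *\<^sub>R pd v u x)" by (rule ext) (simp add: v(1) pd_scale[OF du(1)])
    then have "pd w (pd w u) a = pd w (\<lambda>x. l *\<^sub>R pd v u x) a" by simp
    also have "\<dots> = l *\<^sub>R pd w (pd v u) a"
      by (rule pd_eq) (rule has_derivative_scaleR_right[OF has_derivative_pd[OF du(2)]])
    also have "pd w (pd v u) a = l *\<^sub>R pd v (pd v u) a" unfolding v(1) by (rule pd_scale[OF du(2)])
    finally show ?thesis by (simp add: unit[OF v(2)])
  qed
qed

theorem affine_M: "affine M"
proof -
  have lin: "u v = u 0 + pd v u 0" for v
  proof -
    have d1: "((\<lambda>t. pd v u (t *\<^sub>R v)) has_vector_derivative 0) (at t)" for t :: real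
      using line_derivative[of "pd v u" 0 t v] du(2) by (simp add: second_derivative_zero)
    have const: "pd v u (t *\<^sub>R v) = pd v u 0" for t :: real
    proof -
      have "\<exists>c. \<forall>t::real. t \<in> UNIV \<longrightarrow> pd v u (t *\<^sub>R v) = c"
        using has_vector_derivative_zero_constant[of UNIV "\<lambda>t. pd v u (t *\<^sub>R v)"] d1 by fastforce
      then obtain c where "\<And>t::real. pd v u (t *\<^sub>R v) = c" by blast
      from this[of t] this[of 0] show ?thesis by simp
    qed
    have "((\<lambda>t. u (t *\<^sub>R v) - t *\<^sub>R pd v u 0) has_vector_derivative pd v u 0 - pd v u 0) (at t)" for t :: real
    proof (intro has_vector_derivative_diff)
      show "((\<lambda>t. u (t *\<^sub>R v)) has_vector_derivative pd v u 0) (at t)"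
        using line_derivative[of u 0 t v] du(1) by (simp add: const)
      show "((\<lambda>t. t *\<^sub>R pd v u 0) has_vector_derivative pd v u 0) (at t)"
        unfolding has_vector_derivative_def
        by (rule bounded_linear_imp_has_derivative) (rule bounded_linear_scaleR_left)
    qed
    then have "\<exists>c. \<forall>t::real. t \<in> UNIV \<longrightarrow> u (t *\<^sub>R v) - t *\<^sub>R pd v u 0 = c"
      using has_vector_derivative_zero_constant[of UNIV "\<lambda>t. u (t *\<^sub>R v) - t *\<^sub>R pd v u 0"] by fastforce
    then obtain c where c: "\<And>t::real. u (t *\<^sub>R v) - t *\<^sub>R pd v u 0 = c" by blast
    from c[of 1] c[of 0] show ?thesis by (simp add: algebra_simps)
  qed
  have comb: "s *\<^sub>R u x + t *\<^sub>R u y = u (s *\<^sub>R x + t *\<^sub>R y)" if st: "s + t = 1" for s t x y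
  proof -
    have "u (s *\<^sub>R x + t *\<^sub>R y) = (s + t) *\<^sub>R u 0 + (s *\<^sub>R pd x u 0 + t *\<^sub>R pd y u 0)"
      unfolding lin[of "s *\<^sub>R x + t *\<^sub>R y"] pd_plus[OF du(1)] pd_scale[OF du(1)] by (simp add: st)
    also have "\<dots> = s *\<^sub>R (u 0 + pd x u 0) + t *\<^sub>R (u 0 + pd y u 0)" by (simp add: algebra_simps)
    finally show ?thesis by (simp add: lin[of x, symmetric] lin[of y, symmetric])
  qed
  show ?thesis
    unfolding affine_def
  proof (intro ballI allI impI)
    fix p q and s t :: real assume "p \<in> M" "q \<in> M" and st: "s + t = 1"
    then obtain x y where xy: "p = (x, u x)" "q = (y, u y)" by (auto simp: M graph_over_def)
    have "s *\<^sub>R p + t *\<^sub>R q = (s *\<^sub>R x + t *\<^sub>R y, u (s *\<^sub>R x + t *\<^sub>R y))" by (simp add: xy comb[OF st])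
    then show "s *\<^sub>R p + t *\<^sub>R q \<in> M" by (simp add: M graph_over_def)
  qed
qed

end

theorem closed_maximal_submanifold_affine:
  fixes M :: "((real^'m) \<times> (real^'n)) set"
  assumes "smooth_submanifold M" "connected M" "space_like M" "extremal M" "closed M"
  shows "affine M"
proof (cases "M = {}")
  case False
  interpret S: space_like_submanifold M by (rule space_like_submanifold.intro) fact+
  obtain u where u: "smooth_on UNIV u" "M = graph_over UNIV u" "\<And>x v. v \<noteq> 0 \<Longrightarrow> norm (pd v u x) < norm v"
    using S.entire_graph[OF assms(5,2) False] by blast
  interpret E: entire_maximal_graph M u
    by (rule entire_maximal_graph.intro[OF assms(1,3,4) u])
  show ?thesis by (rule E.affine_M)
qed simp

section \<open>Gradient graphs in null coordinates\<close>

lemma smooth_gradient: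
  fixes F :: "real^'k \<Rightarrow> real"
  assumes F: "smooth_on UNIV F"
  shows "continuous_on UNIV (gradient F)" "pd v F x = gradient F x \<bullet> v"
proof -
  have g: "gradient F x $ i = pd (axis i 1) F x" for x i by (simp add: gradient_def pd_def)
  have "continuous_on UNIV (\<lambda>x. \<chi> i. pd (axis i 1) F x)"
    by (intro continuous_on_vec_lambda smooth_continuous[OF smooth_pd[OF F]])
  moreover have "gradient F = (\<lambda>x. \<chi> i. pd (axis i 1) F x)" by (simp add: fun_eq_iff vec_eq_iff g)
  ultimately show "continuous_on UNIV (gradient F)" by simp
  have "pd v F x = (\<Sum>i\<in>UNIV. v $ i *\<^sub>R pd (axis i 1) F x)"
    by (rule pd_axis[OF smooth_differentiable[OF F UNIV_I]])
  then show "pd v F x = gradient F x \<bullet> v" by (simp add: inner_vec_def g mult.commute)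
qed

text \<open>
  Integration of the gradient along rays from the origin.
\<close>

lemma quadratic_if_gradient_affine:
  fixes F :: "real^'k \<Rightarrow> real"
  assumes F: "smooth_on UNIV F"
    and aff: "\<And>s t x y. s + t = 1 \<Longrightarrow> gradient F (s *\<^sub>R x + t *\<^sub>R y) = s *\<^sub>R gradient F x + t *\<^sub>R gradient F y"
  shows "quadratic_polynomial F"
proof -
  define b where "b = gradient F 0"
  define A where "A x = gradient F x - b" for x
  have scale: "A (t *\<^sub>R x) = t *\<^sub>R A x" for t x
    using aff[of "1 - t" t 0 x] by (simp add: A_def b_def algebra_simps)
  have add: "A (x + y) = A x + A y" for x y
  proof -
    have "A (x + y) = A (2 *\<^sub>R ((1/2) *\<^sub>R x + (1/2) *\<^sub>R y))" by (simp add: scaleR_add_right)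
    also have "\<dots> = 2 *\<^sub>R A ((1/2) *\<^sub>R x + (1/2) *\<^sub>R y)" by (rule scale)
    also have "A ((1/2) *\<^sub>R x + (1/2) *\<^sub>R y) = (1/2) *\<^sub>R A x + (1/2) *\<^sub>R A y"
    proof -
      have "b = (1/2) *\<^sub>R b + (1/2) *\<^sub>R b" by (simp add: scaleR_add_left[symmetric])
      then show ?thesis using aff[of "1/2" "1/2" x y] by (simp add: A_def algebra_simps)
    qed
    finally show ?thesis by (simp add: scaleR_add_right)
  qed
  have linA: "linear A" by (rule linearI) (simp_all add: add scale)
  have F_eq: "F x = (1/2) * (A x \<bullet> x) + b \<bullet> x + F 0" for x
  proof -
    define g where "g t = F (t *\<^sub>R x) - ((t * t) * ((1/2) * (A x \<bullet> x)) + t * (b \<bullet> x))" for t :: real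
    have "(g has_real_derivative 0) (at t)" for t
    proof -
      have "((\<lambda>t. F (t *\<^sub>R x)) has_real_derivative gradient F (t *\<^sub>R x) \<bullet> x) (at t)"
        using line_derivative[of F 0 t x] smooth_differentiable[OF F, of "t *\<^sub>R x"]
        by (simp add: has_real_derivative_iff_has_vector_derivative smooth_gradient(2)[OF F])
      moreover have "((\<lambda>t. (t * t) * ((1/2) * (A x \<bullet> x)) + t * (b \<bullet> x)) has_real_derivative
          t * (A x \<bullet> x) + b \<bullet> x) (at t)"
        by (rule derivative_eq_intros refl | simp)+
      ultimately have "(g has_real_derivative gradient F (t *\<^sub>R x) \<bullet> x - (t * (A x \<bullet> x) + b \<bullet> x)) (at t)"
        unfolding g_def by (rule DERIV_diff)
      moreover have "gradient F (t *\<^sub>R x) = t *\<^sub>R A x + b" using scale[of t x] by (simp add: A_def algebra_simps)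
      ultimately show ?thesis by (simp add: inner_add_left)
    qed
    then have "g 1 = g 0" using DERIV_isconst_all[of g] by blast
    then show ?thesis by (simp add: g_def algebra_simps)
  qed
  have "A x \<bullet> x = (\<Sum>i\<in>UNIV. \<Sum>j\<in>UNIV. (A (axis i 1) $ j) * x $ i * x $ j)" for x
  proof -
    have "A x = A (\<Sum>i\<in>UNIV. x $ i *\<^sub>R axis i 1)"
      by (metis (no_types, lifting) basis_expansion scalar_mult_eq_scaleR sum.cong)
    also have "\<dots> = (\<Sum>i\<in>UNIV. x $ i *\<^sub>R A (axis i 1))" by (simp add: linear_sum[OF linA] linear_scale[OF linA])
    finally have "A x \<bullet> x = (\<Sum>i\<in>UNIV. x $ i * (A (axis i 1) \<bullet> x))" by (simp add: inner_sum_left)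
    then show ?thesis by (simp add: inner_vec_def sum_distrib_left mult_ac)
  qed
  then have "F x = (\<Sum>i\<in>UNIV. \<Sum>j\<in>UNIV. ((1/2) * A (axis i 1) $ j) * x $ i * x $ j) + (\<Sum>i\<in>UNIV. b $ i * x $ i) + F 0" for x
    using F_eq[of x] by (simp add: inner_vec_def[of b] sum_distrib_left mult_ac)
  then show ?thesis unfolding quadratic_polynomial_def
    by (intro exI[of _ "\<lambda>i j. (1/2) * A (axis i 1) $ j"] exI[of _ "\<lambda>i. b $ i"] exI[of _ "F 0"]) blast
qed

lemma gradient_graph_closed_connected:
  fixes F :: "real^'k \<Rightarrow> real"
  assumes F: "smooth_on UNIV F" and N: "linear N" "bij N"
  shows "closed (gradient_graph N F)" "connected (gradient_graph N F)"
proof -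
  define G where "G = range (\<lambda>x. (x, gradient F x))"
  have eq: "gradient_graph N F = N ` G" by (auto simp: gradient_graph_def G_def)
  have c: "continuous_on UNIV (gradient F)" by (rule smooth_gradient(1)[OF F])
  have "connected G" unfolding G_def
    by (intro connected_continuous_image continuous_on_Pair continuous_on_id c connected_UNIV)
  then show "connected (gradient_graph N F)"
    unfolding eq by (intro connected_continuous_image linear_continuous_on) (use N in \<open>simp_all add: linear_conv_bounded_linear\<close>)
  have "G = {p. snd p = gradient F (fst p)}" by (auto simp: G_def image_iff)
  moreover have "closed {p. snd p = gradient F (fst p)}"
    by (intro closed_Collect_eq continuous_on_snd continuous_on_id continuous_on_compose2[OF c] continuous_on_fst) auto
  ultimately have "closed G" by simp
  then show "closed (gradient_graph N F)"
    unfolding eq using N by (intro closed_injective_linear_image) (simp_all add: bij_def)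
qed

lemma gradient_affine_if_graph_affine:
  fixes F :: "real^'k \<Rightarrow> real"
  assumes N: "linear N" "bij N" and aff: "affine (gradient_graph N F)" and st: "s + t = 1"
  shows "gradient F (s *\<^sub>R x + t *\<^sub>R y) = s *\<^sub>R gradient F x + t *\<^sub>R gradient F y"
proof -
  have "N (x, gradient F x) \<in> gradient_graph N F" for x by (auto simp: gradient_graph_def)
  then have "s *\<^sub>R N (x, gradient F x) + t *\<^sub>R N (y, gradient F y) \<in> gradient_graph N F"
    using aff st unfolding affine_def by blast
  then obtain z where "s *\<^sub>R N (x, gradient F x) + t *\<^sub>R N (y, gradient F y) = N (z, gradient F z)"
    by (auto simp: gradient_graph_def)
  moreover have "s *\<^sub>R N (x, gradient F x) + t *\<^sub>R N (y, gradient F y) = N (s *\<^sub>R (x, gradient F x) + t *\<^sub>R (y, gradient F y))"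
    by (simp only: linear_add[OF N(1)] linear_scale[OF N(1)])
  ultimately have "s *\<^sub>R (x, gradient F x) + t *\<^sub>R (y, gradient F y) = (z, gradient F z)"
    using injD[OF bij_is_inj[OF N(2)]] by metis
  then show ?thesis by auto
qed

theorem theorem4p2:
  shows "(\<forall>M :: ((real^'m) \<times> (real^'n)) set.
            smooth_submanifold M \<and> connected M \<and> space_like M \<and> extremal M \<and> closed M
              \<longrightarrow> affine M) \<and>
         (\<forall>(F :: real^'k \<Rightarrow> real) N.
            smooth_on UNIV F \<and> null_coordinates N \<and>
            smooth_submanifold (gradient_graph N F) \<and> space_like (gradient_graph N F) \<and>
            extremal (gradient_graph N F)
              \<longrightarrow> quadratic_polynomial F)"
proof (intro conjI allI impI)
  fix M :: "((real^'m) \<times> (real^'n)) set"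
  assume "smooth_submanifold M \<and> connected M \<and> space_like M \<and> extremal M \<and> closed M"
  then show "affine M" using closed_maximal_submanifold_affine by blast
next
  fix F :: "real^'k \<Rightarrow> real" and N
  assume a: "smooth_on UNIV F \<and> null_coordinates N \<and>
            smooth_submanifold (gradient_graph N F) \<and> space_like (gradient_graph N F) \<and>
            extremal (gradient_graph N F)"
  then have F: "smooth_on UNIV F" and N: "linear N" "bij N" by (auto simp: null_coordinates_def)
  have "affine (gradient_graph N F)"
    by (rule closed_maximal_submanifold_affine) (use a gradient_graph_closed_connected[OF F N] in auto)
  from gradient_affine_if_graph_affine[OF N this] show "quadratic_polynomial F"
    by (rule quadratic_if_gradient_affine[OF F])
qed

end
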